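(* Consider the interconnection of $n$ impulsive subsystems $$\dot x_i(t)=f_i(x_1(t),\dots,x_n(t),u_i(t)),\ t\ne t_k,\qquad x_i(t)=g_i(x_1^-(t),\dots,x_n^-(t),u_i^-(t)),\ t=t_k,$$ $k\in\mathbb{N}$, $i=1,\dots,n$, viewed as the single system $\dot x=f(x,u)$, $t\neq t_k$, $x(t)=g(x^-(t),u^-(t))$, $t=t_k$, with $x=(x_1^T,\dots,x_n^T)^T$, $u=(u_1^T,\dots,u_n^T)^T$, $f=(f_1^T,\dots,f_n^T)^T$, $g=(g_1^T,\dots,g_n^T)^T$. Assume each subsystem has an exponential ISS-Lyapunov function $V_i$ with linear gains $\gamma_{ij}(r)=\gamma_{ij}r$ ($\gamma_{ij}\ge0$, $\gamma_{ii}=0$), gains $\gamma_i$, and rate coefficients $c_i,d_i$ with $d_i\ne0$. If the matrix $\Gamma=(\gamma_{ij})_{n\times n}$ satisfies the small-gain condition $\Gamma(v)\not\ge v$ for all $v\in\mathbb{R}^n_+\setminus\{0\}$, then for any $s=(s_1,\dots,s_n)^T\in\mathbb{R}^n$ with $s>0$ and $\Gamma(s)<s$, the function $$V(x):=\max_i\Big\{\tfrac{1}{s_i}V_i(x_i)\Big\}$$ is an exponential ISS-Lyapunov function for the whole system with gain $\gamma(r):=\max\{e^d,1\}\max_i\frac{1}{s_i}\gamma_i(r)$ and rate coefficients $c:=\min_i c_i$ and $d:=\min_{i,j,\,j\ne i}\{d_i,-\ln(\tfrac{s_j}{s_i}\gamma_{ij})\}$. In particular, for all $\mu,\lambda>0$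 the system is uniformly ISS over $\mathcal{S}[\mu,\lambda]$, the class of impulse time sequences satisfying $-dN(t,s')-(c-\lambda)(t-s')\le\mu$ for all $t\ge s'\ge t_0$.
   Context: $x_i\in\mathbb{R}^{N_i}$ is absolutely continuous between impulses, $u_i\in\mathbb{R}^{M_i}$ are locally bounded, Lebesgue measurable inputs; all signals are right-continuous with left limits, $x_i^-(t)=\lim_{s\nearrow t}x_i(s)$, $u_i^-(t)=\lim_{s\nearrow t}u_i(s)$. Each $f_i$ is locally Lipschitz. The impulse times (common to all subsystems) form a strictly increasing sequence in $(t_0,\infty)$, finite or infinite and unbounded, with no finite accumulation point; $N(t,s)$ is the number of impulse times in $(s,t]$. $\mathbb{R}_+=[0,\infty)$; for vectors, $x\ge y$ means $x_i\ge y_i$ for all $i$, $x\not\ge y$ means $x_i<y_i$ for some $i$, and $x>y$ means $x_i>y_i$ for all $i$. The gain operator is $\Gamma(v):=(\max_j\gamma_{1j}v_j,\dots,\max_j\gamma_{nj}v_j)^T$ for $v\in\mathbb{R}^n_+$. $\mathcal{K}_\infty$ is the class of continuous, strictly increasing, unbounded $\gamma:\mathbb{R}_+\to\mathbb{R}_+$ with $\gamma(0)=0$; $\mathcal{KL}$ is the class of $\beta$ with $\beta(\cdot,t)$ continuous strictly increasing with $\beta(0,t)=0$ and $\beta(r,\cdot)$ continuous decreasing to $0$. Subsystem Lyapunov functions: $V_i:\mathbb{R}^{N_i}\to\mathbb{R}_+$ is continuous, proper, positive definite and locally Lipschitz on $\mathbb{R}^{N_i}\setminus\{0\}$; it is an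 exponential ISS-Lyapunov function with rate coefficients $c_i,d_i\in\mathbb{R}$ if there are $\gamma_{ij},\gamma_i\in\mathcal{K}_\infty$ (here $\gamma_{ij}$ linear) such that whenever $V_i(x_i)\ge\max\{\max_{j\ne i}\gamma_{ij}(V_j(x_j)),\gamma_i(|u_i|)\}$ then $\nabla V_i(x_i)\cdot f_i(x,u_i)\le-c_iV_i(x_i)$ for almost all $x$ and all $u_i$, and for all $x,u_i$: $V_i(g_i(x,u_i))\le\max\{e^{-d_i}V_i(x_i),\max_{j\ne i}\gamma_{ij}(V_j(x_j)),\gamma_i(|u_i|)\}$. Whole-system exponential ISS-Lyapunov function with rate coefficients $c,d$ and gain $\gamma\in\mathcal{K}_\infty$: $V:\mathbb{R}^N\to\mathbb{R}_+$ locally Lipschitz, positive definite, radially unbounded, such that whenever $V(x)\ge\gamma(|u|)$: $\nabla V(x)\cdot f(x,u)\le-cV(x)$ for almost all $x$ and all $u$, and $V(g(x,u))\le e^{-d}V(x)$ for all $x,u$. Uniformly ISS over a class $\mathcal{S}$: there exist $\beta\in\mathcal{KL}$, $\tilde\gamma\in\mathcal{K}_\infty$ independent of the sequence in $\mathcal{S}$ such that for every sequence in $\mathcal{S}$, every initial condition and input, the solution exists globally and $|x(t)|\le\max\{\beta(|x(t_0)|,t-t_0),\tilde\gamma(\|u\|_{[t_0,t]})\}$ for all $t\ge t_0$.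
   Formalization: V is shown to be continuous on R^N and locally Lipschitz on R^N\{0} only, not at 0: since the V_i are locally Lipschitz only away from 0 (e.g. V_1(x)=√|x|, f=-x, g=x/2), V need not be Lipschitz at the origin. *)

theory Defs
  imports "HOL-Analysis.Analysis"
begin

definition Kinf :: "(real \<Rightarrow> real) \<Rightarrow> bool" where
  "Kinf \<gamma> \<longleftrightarrow> continuous_on {0..} \<gamma> \<and> strict_mono_on {0..} \<gamma> \<and> \<gamma> 0 = 0
     \<and> filterlim \<gamma> at_top at_top"

definition KL :: "(real \<Rightarrow> real \<Rightarrow> real) \<Rightarrow> bool" where
  "KL \<beta> \<longleftrightarrow>
     (\<forall>t\<ge>0. continuous_on {0..} (\<lambda>r. \<beta> r t) \<and> strict_mono_on {0..} (\<lambda>r. \<beta> r t) \<and> \<beta> 0 t = 0) \<and>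
     (\<forall>r\<ge>0. continuous_on {0..} (\<beta> r) \<and> (\<forall>a b. 0 \<le> a \<longrightarrow> a \<le> b \<longrightarrow> \<beta> r b \<le> \<beta> r a)
            \<and> (\<beta> r \<longlongrightarrow> 0) at_top)"

text \<open>The whole state lives in a Euclidean space; its orthonormal basis is partitioned
  into blocks B 0, ..., B (n-1); subsystem i's state space R^{N_i} is span (B i) and
  x_i is the orthogonal projection of x onto it.  Same for inputs with blocks C i.\<close>

definition bproj :: "'a::euclidean_space set \<Rightarrow> 'a \<Rightarrow> 'a" where
  "bproj B x = (\<Sum>b\<in>B. (x \<bullet> b) *\<^sub>R b)"

definition basis_partition :: "nat \<Rightarrow> (nat \<Rightarrow> 'a::euclidean_space set) \<Rightarrow> bool" where
  "basis_partition n B \<longleftrightarrow> (\<Union>i<n. B i) = Basis \<and>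
     (\<forall>i<n. \<forall>j<n. i \<noteq> j \<longrightarrow> B i \<inter> B j = {})"

definition loc_lipschitz_on :: "'a::metric_space set \<Rightarrow> ('a \<Rightarrow> 'b::metric_space) \<Rightarrow> bool" where
  "loc_lipschitz_on S h \<longleftrightarrow> (\<forall>z\<in>S. \<exists>e>0. \<exists>L. \<forall>p\<in>ball z e \<inter> S. \<forall>q\<in>ball z e \<inter> S.
      dist (h p) (h q) \<le> L * dist p q)"

definition sub_lyap_candidate :: "'x::euclidean_space set \<Rightarrow> ('x \<Rightarrow> real) \<Rightarrow> bool" where
  "sub_lyap_candidate B W \<longleftrightarrow>
     continuous_on (span B) W \<and>
     (\<forall>K. compact K \<longrightarrow> compact {\<xi>\<in>span B. W \<xi> \<in> K}) \<and>
     W 0 = 0 \<and> (\<forall>\<xi>\<in>span B. \<xi> \<noteq> 0 \<longrightarrow> W \<xi> > 0) \<and>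
     loc_lipschitz_on (span B - {0}) W"

text \<open>max over j<n, j \<noteq> i of gamma_ij V_j(x_j)  (0 if there is no such j; all terms are \<ge> 0)\<close>
definition others :: "nat \<Rightarrow> (nat \<Rightarrow> 'x::euclidean_space set) \<Rightarrow> (nat \<Rightarrow> 'x \<Rightarrow> real)
    \<Rightarrow> (nat \<Rightarrow> nat \<Rightarrow> real) \<Rightarrow> nat \<Rightarrow> 'x \<Rightarrow> real" where
  "others n B V G i x = Max ({0} \<union> (\<lambda>j. G i j * V j (bproj (B j) x)) ` ({..<n} - {i}))"

definition sub_exp_iss_lyap ::
  "nat \<Rightarrow> (nat \<Rightarrow> 'x::euclidean_space set) \<Rightarrow> (nat \<Rightarrow> 'u::euclidean_space set)
   \<Rightarrow> ('x \<Rightarrow> 'u \<Rightarrow> 'x) \<Rightarrow> ('x \<Rightarrow> 'u \<Rightarrow> 'x) \<Rightarrow> (nat \<Rightarrow> 'x \<Rightarrow> real)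
   \<Rightarrow> (nat \<Rightarrow> nat \<Rightarrow> real) \<Rightarrow> (nat \<Rightarrow> real \<Rightarrow> real) \<Rightarrow> (nat \<Rightarrow> real) \<Rightarrow> (nat \<Rightarrow> real)
   \<Rightarrow> nat \<Rightarrow> bool" where
  "sub_exp_iss_lyap n B C f g V G gam c d i \<longleftrightarrow>
     sub_lyap_candidate (B i) (V i) \<and> Kinf (gam i) \<and>
     (\<exists>Z\<in>null_sets lebesgue. \<forall>x. x \<notin> Z \<longrightarrow>
        (\<exists>D. (V i has_derivative D) (at (bproj (B i) x) within span (B i)) \<and>
             (\<forall>u. V i (bproj (B i) x) \<ge> max (others n B V G i x) (gam i (norm (bproj (C i) u)))
                  \<longrightarrow> D (bproj (B i) (f x u)) \<le> - c i * V i (bproj (B i) x)))) \<and>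
     (\<forall>x u. V i (bproj (B i) (g x u)) \<le>
        max (exp (- d i) * V i (bproj (B i) x)) (max (others n B V G i x) (gam i (norm (bproj (C i) u)))))"

definition exp_iss_lyap :: "('x::euclidean_space \<Rightarrow> 'u::euclidean_space \<Rightarrow> 'x) \<Rightarrow> ('x \<Rightarrow> 'u \<Rightarrow> 'x)
    \<Rightarrow> ('x \<Rightarrow> real) \<Rightarrow> real \<Rightarrow> real \<Rightarrow> (real \<Rightarrow> real) \<Rightarrow> bool" where
  "exp_iss_lyap f g W c d \<gamma> \<longleftrightarrow>
     continuous_on UNIV W \<and> loc_lipschitz_on (UNIV - {0}) W \<and>
     W 0 = 0 \<and> (\<forall>x. x \<noteq> 0 \<longrightarrow> W x > 0) \<and> filterlim W at_top at_infinity \<and> Kinf \<gamma> \<and>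
     (\<exists>Z\<in>null_sets lebesgue. \<forall>x. x \<notin> Z \<longrightarrow>
        (\<exists>D. (W has_derivative D) (at x) \<and>
             (\<forall>u. W x \<ge> \<gamma> (norm u) \<longrightarrow> D (f x u) \<le> - c * W x))) \<and>
     (\<forall>x u. W x \<ge> \<gamma> (norm u) \<longrightarrow> W (g x u) \<le> exp (- d) * W x)"

definition Gam :: "nat \<Rightarrow> (nat \<Rightarrow> nat \<Rightarrow> real) \<Rightarrow> (nat \<Rightarrow> real) \<Rightarrow> nat \<Rightarrow> real" where
  "Gam n G v i = Max ((\<lambda>j. G i j * v j) ` {..<n})"

definition Vtot :: "nat \<Rightarrow> (nat \<Rightarrow> 'x::euclidean_space set) \<Rightarrow> (nat \<Rightarrow> 'x \<Rightarrow> real)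
    \<Rightarrow> (nat \<Rightarrow> real) \<Rightarrow> 'x \<Rightarrow> real" where
  "Vtot n B V s x = Max ((\<lambda>i. V i (bproj (B i) x) / s i) ` {..<n})"

definition cmin :: "nat \<Rightarrow> (nat \<Rightarrow> real) \<Rightarrow> real" where
  "cmin n c = Min (c ` {..<n})"

text \<open>Terms with gamma_ij = 0 equal -ln 0 = +infinity and are therefore omitted from the min.\<close>
definition dmin :: "nat \<Rightarrow> (nat \<Rightarrow> nat \<Rightarrow> real) \<Rightarrow> (nat \<Rightarrow> real) \<Rightarrow> (nat \<Rightarrow> real) \<Rightarrow> real" where
  "dmin n G s d = Min (d ` {..<n} \<union>
      {- ln (s j / s i * G i j) | i j. i < n \<and> j < n \<and> j \<noteq> i \<and> G i j > 0})"

definition gain :: "nat \<Rightarrow> (nat \<Rightarrow> real \<Rightarrow> real) \<Rightarrow> (nat \<Rightarrow> real) \<Rightarrow> real \<Rightarrow> real \<Rightarrow> real" where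
  "gain n gam s dd r = max (exp dd) 1 * Max ((\<lambda>i. gam i r / s i) ` {..<n})"

text \<open>A set T of impulse times: strictly increasing sequence in (t0,inf), finite or
  unbounded, no finite accumulation point.\<close>
definition impulse_times :: "real \<Rightarrow> real set \<Rightarrow> bool" where
  "impulse_times t0 T \<longleftrightarrow> T \<subseteq> {t0<..} \<and> (\<forall>b. finite (T \<inter> {..b}))"

definition Ncount :: "real set \<Rightarrow> real \<Rightarrow> real \<Rightarrow> nat" where
  "Ncount T t s = card (T \<inter> {s<..t})"

definition seq_class :: "real \<Rightarrow> real \<Rightarrow> real \<Rightarrow> real \<Rightarrow> real \<Rightarrow> real set set" where
  "seq_class t0 c d \<mu> lam = {T. impulse_times t0 T \<and>
      (\<forall>s t. t0 \<le> s \<longrightarrow> s \<le> t \<longrightarrow> - d * real (Ncount T t s) - (c - lam) * (t - s) \<le> \<mu>)}"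

definition admissible_input :: "real \<Rightarrow> (real \<Rightarrow> 'u::euclidean_space) \<Rightarrow> bool" where
  "admissible_input t0 u \<longleftrightarrow> set_borel_measurable lebesgue {t0..} u \<and>
     (\<forall>b. bounded (u ` {t0..b})) \<and>
     (\<forall>t\<ge>t0. continuous (at_right t) u) \<and> (\<forall>t>t0. \<exists>l. (u \<longlongrightarrow> l) (at_left t))"

text \<open>x solves the impulsive system on [t0,inf): absolutely continuous (Caratheodory)
  between impulses and x(t) = g(x^-(t), u^-(t)) at impulse times.\<close>
definition is_solution :: "('x::euclidean_space \<Rightarrow> 'u::euclidean_space \<Rightarrow> 'x) \<Rightarrow> ('x \<Rightarrow> 'u \<Rightarrow> 'x)
    \<Rightarrow> real \<Rightarrow> real set \<Rightarrow> (real \<Rightarrow> 'u) \<Rightarrow> (real \<Rightarrow> 'x) \<Rightarrow> bool" where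
  "is_solution f g t0 T u x \<longleftrightarrow>
     (\<forall>a t. t0 \<le> a \<longrightarrow> a \<le> t \<longrightarrow> T \<inter> {a<..t} = {} \<longrightarrow>
        ((\<lambda>\<tau>. f (x \<tau>) (u \<tau>)) has_integral (x t - x a)) {a..t}) \<and>
     (\<forall>t\<in>T. \<exists>xl ul. (x \<longlongrightarrow> xl) (at_left t) \<and> (u \<longlongrightarrow> ul) (at_left t) \<and> x t = g xl ul)"

definition unif_ISS :: "('x::euclidean_space \<Rightarrow> 'u::euclidean_space \<Rightarrow> 'x) \<Rightarrow> ('x \<Rightarrow> 'u \<Rightarrow> 'x)
    \<Rightarrow> real \<Rightarrow> real set set \<Rightarrow> bool" where
  "unif_ISS f g t0 SS \<longleftrightarrow> (\<exists>\<beta> \<gamma>'. KL \<beta> \<and> Kinf \<gamma>' \<and>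
     (\<forall>T\<in>SS. \<forall>x0 u. admissible_input t0 u \<longrightarrow>
        (\<exists>x. is_solution f g t0 T u x \<and> x t0 = x0) \<and>
        (\<forall>x. is_solution f g t0 T u x \<longrightarrow> x t0 = x0 \<longrightarrow>
           (\<forall>t\<ge>t0. norm (x t) \<le> max (\<beta> (norm x0) (t - t0))
                                      (\<gamma>' (Sup ((\<lambda>\<tau>. norm (u \<tau>)) ` {t0..t})))))))"

end

theory Submission
  imports Defs
begin

text \<open>
  Each \<open>V\<^sub>i\<close> is differentiable almost everywhere, and so is their weighted maximum \<open>V\<close>: two
  differentiable functions that agree at a point with different derivatives have a difference with a
  regular zero there, and the regular zeros lie on countably many Lipschitz graphs over hyperplanes.
  At a point where \<open>V\<^sub>i / s\<^sub>i\<close> attains the maximum, \<open>\<Gamma>(s) < s\<close> makes \<open>V\<^sub>i\<close> dominate all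
  its internal gain terms, so the decay estimate of subsystem \<open>i\<close> applies.

  For the stability statement, the jump estimate is used in the form
  \<open>V(g(x,u)) \<le> max (exp(-d) V(x), \<gamma>(|u|))\<close> with \<open>\<gamma> = max\<^sub>i \<gamma>\<^sub>i / s\<^sub>i\<close>, which holds for all \<open>x\<close> and \<open>u\<close>.
  Inputs are right-continuous, so solutions have right derivatives everywhere. The gradient inequality
  holds only almost everywhere, but integrating \<open>V\<close> over small boxes (dominated convergence) turns it
  into a bound on every increment \<open>V(x + v) - V(x)\<close>, hence on the upper right Dini derivative of \<open>V\<close>
  along solutions. With the weight \<open>\<rho>(t) = exp (c (t - t\<^sub>0) + d N(t,t\<^sub>0))\<close>, the product \<open>\<rho> V\<close> does not
  increase, neither along the flow nor at jumps, as long as \<open>V\<close> exceeds \<open>R = \<gamma>(\<parallel>u\<parallel>)\<close>. Hence it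
  never rises above \<open>M = max (V(x(t\<^sub>0)), sup \<rho> R)\<close>, and the condition on the impulse times is exactly
  \<open>\<rho>(s) \<le> exp (\<mu> - \<lambda> (t - s)) \<rho>(t)\<close>. The same barrier argument without jumps excludes finite escape
  times, and so gives global existence.
\<close>

section \<open>Almost everywhere differentiability of finite maxima\<close>

lemma negligible_cone_condition:
  fixes S :: "'a::euclidean_space set"
  assumes "w \<noteq> 0" "K < 1"
    and cone: "\<And>y z. \<lbrakk>y \<in> S; z \<in> S\<rbrakk> \<Longrightarrow> \<bar>w \<bullet> (y - z)\<bar> \<le> K * norm w * norm (y - z)"
  shows "negligible S"
proof -
  define P where "P z = z - ((w \<bullet> z) / (w \<bullet> w)) *\<^sub>R w" for z
  have expanding: "norm (y - z) \<le> 1 / (1 - K) * norm (P y - P z)" if "y \<in> S" "z \<in> S" for y z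
  proof -
    have "y - z = (P y - P z) + ((w \<bullet> (y - z)) / (w \<bullet> w)) *\<^sub>R w"
      by (simp add: P_def algebra_simps diff_divide_distrib)
    then have "norm (y - z) \<le> norm (P y - P z) + norm (((w \<bullet> (y - z)) / (w \<bullet> w)) *\<^sub>R w)"
      by (metis norm_triangle_ineq)
    also have "norm (((w \<bullet> (y - z)) / (w \<bullet> w)) *\<^sub>R w) \<le> K * norm (y - z)"
      using cone[OF that] \<open>w \<noteq> 0\<close>
      by (simp add: field_simps power2_norm_eq_inner[symmetric] power2_eq_square)
    finally show ?thesis using \<open>K < 1\<close> by (simp add: field_simps)
  qed
  then have inj: "inj_on P S"
    by (fastforce intro!: inj_onI)
  have "P ` S \<subseteq> {z. w \<bullet> z = 0}"
    using \<open>w \<noteq> 0\<close> by (auto simp: P_def inner_diff_right)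
  then have "negligible (P ` S)"
    using \<open>w \<noteq> 0\<close> by (intro negligible_subset[OF negligible_hyperplane]) auto
  then have "negligible (inv_into S P ` P ` S)"
  proof (rule negligible_locally_Lipschitz_image[rotated])
    fix p assume "p \<in> P ` S"
    then show "\<exists>T B. open T \<and> p \<in> T \<and>
        (\<forall>q \<in> P ` S \<inter> T. norm (inv_into S P q - inv_into S P p) \<le> B * norm (q - p))"
      using expanding by (intro exI[of _ UNIV] exI[of _ "1 / (1 - K)"]) (auto simp: inv_into_f_f[OF inj])
  qed auto
  then show ?thesis
    using inj by (simp add: inv_into_image_cancel)
qed

lemma negligible_local_cone_condition:
  fixes S :: "'a::euclidean_space set"
  assumes "w \<noteq> 0" "K < 1" "r > 0"
    and cone: "\<And>y z. \<lbrakk>y \<in> S; z \<in> S; dist y z < r\<rbrakk> \<Longrightarrow> \<bar>w \<bullet> (y - z)\<bar> \<le> K * norm w * norm (y - z)"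
  shows "negligible S"
  unfolding locally_negligible_alt[of S]
proof
  fix x assume "x \<in> S"
  define U where "U = S \<inter> ball x (r / 2)"
  have "negligible U"
  proof (rule negligible_cone_condition[OF assms(1,2)])
    fix y z assume "y \<in> U" "z \<in> U"
    then show "\<bar>w \<bullet> (y - z)\<bar> \<le> K * norm w * norm (y - z)"
      using dist_triangle_half_r[of x y r z] by (intro cone) (auto simp: U_def)
  qed
  moreover have "openin (top_of_set S) U" "x \<in> U"
    using \<open>x \<in> S\<close> \<open>r > 0\<close> by (auto simp: U_def intro!: openin_open_Int)
  ultimately show "\<exists>U. openin (top_of_set S) U \<and> x \<in> U \<and> negligible U"
    by blast
qed

lemma cone_condition_perturb:
  fixes w w' h :: "'a::real_inner"
  assumes "0 \<le> K" "K < 1"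
    and near: "norm (w' - w) \<le> (1 - K) / 4 * norm w"
    and cone: "\<bar>w \<bullet> h\<bar> \<le> K * norm w * norm h"
  shows "\<bar>w' \<bullet> h\<bar> \<le> (1 + K) / 2 * norm w' * norm h"
proof -
  have "\<bar>w' \<bullet> h\<bar> \<le> \<bar>w \<bullet> h\<bar> + \<bar>(w' - w) \<bullet> h\<bar>"
    unfolding inner_diff_left by linarith
  also have "\<bar>(w' - w) \<bullet> h\<bar> \<le> (1 - K) / 4 * norm w * norm h"
    using Cauchy_Schwarz_ineq2 mult_right_mono[OF near norm_ge_zero] by (rule order_trans)
  also have "\<bar>w \<bullet> h\<bar> + (1 - K) / 4 * norm w * norm h \<le> (1 + 3 * K) / 4 * norm w * norm h"
    using cone by (simp add: field_simps)
  also have "(1 + 3 * K) / 4 * norm w \<le> (1 + K) / 2 * ((3 + K) / 4 * norm w)"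
    using mult_right_mono[OF zero_le_power2[of "1 - K"] norm_ge_zero[of w]]
    by (simp add: field_simps power2_eq_square)
  also have "(3 + K) / 4 * norm w \<le> norm w'"
    using near norm_triangle_ineq2[of w "w - w'"] by (simp add: norm_minus_commute field_simps)
  finally show ?thesis using \<open>0 \<le> K\<close> by (simp add: mult_left_mono mult_right_mono)
qed

lemma negligible_tangent_cone_condition:
  fixes S :: "'a::euclidean_space set"
  assumes "0 \<le> K" "K < 1"
    and cone: "\<And>x. x \<in> S \<Longrightarrow>
      \<exists>w. w \<noteq> 0 \<and> (\<forall>\<^sub>F y in at x within S. \<bar>w \<bullet> (y - x)\<bar> \<le> K * norm w * norm (y - x))"
  shows "negligible S"
proof -
  obtain Q :: "'a set" where "countable Q" and dense: "\<And>X. open X \<Longrightarrow> X \<noteq> {} \<Longrightarrow> \<exists>q\<in>Q. q \<in> X"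
    using countable_dense_setE by metis
  define A where "A w k = {x \<in> S. \<forall>y\<in>S. dist y x < 1 / Suc k \<longrightarrow>
      \<bar>w \<bullet> (y - x)\<bar> \<le> (1 + K) / 2 * norm w * norm (y - x)}" for w :: 'a and k :: nat
  have "negligible (A w k)" if "w \<noteq> 0" for w k
  proof (rule negligible_local_cone_condition[OF that, of "(1 + K) / 2" "1 / Suc k"])
    fix y z assume "y \<in> A w k" "z \<in> A w k" "dist y z < 1 / Suc k"
    then show "\<bar>w \<bullet> (y - z)\<bar> \<le> (1 + K) / 2 * norm w * norm (y - z)" by (auto simp: A_def)
  qed (use \<open>K < 1\<close> in auto)
  then have "negligible (\<Union> ((\<lambda>(w, k). A w k) ` ((Q - {0}) \<times> UNIV)))"
    using \<open>countable Q\<close> by (intro negligible_countable_Union) auto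
  moreover have "S \<subseteq> \<Union> ((\<lambda>(w, k). A w k) ` ((Q - {0}) \<times> UNIV))"
  proof
    fix x assume "x \<in> S"
    then obtain w r where "w \<noteq> 0" "r > 0" and
      w: "\<And>y. y \<in> S \<Longrightarrow> dist y x < r \<Longrightarrow> \<bar>w \<bullet> (y - x)\<bar> \<le> K * norm w * norm (y - x)"
      using cone[of x] unfolding eventually_at
      by (metis diff_self inner_zero_right abs_zero norm_zero mult_zero_right order_refl)
    define \<epsilon> where "\<epsilon> = (1 - K) / 4 * norm w"
    have \<epsilon>: "0 < \<epsilon>" "\<epsilon> < norm w"
      using \<open>w \<noteq> 0\<close> assms(1,2) mult_strict_right_mono[of "(1 - K) / 4" 1 "norm w"]
      by (auto simp: \<epsilon>_def)
    then obtain q where q: "q \<in> Q" "q \<in> ball w \<epsilon>"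
      using dense[of "ball w \<epsilon>"] by auto
    have "q \<noteq> 0" using q(2) \<epsilon> by auto
    obtain k where k: "1 / Suc k < r" using \<open>r > 0\<close> nat_approx_posE by blast
    have "norm (q - w) \<le> (1 - K) / 4 * norm w"
      using q(2) by (simp add: \<epsilon>_def dist_norm norm_minus_commute)
    from cone_condition_perturb[OF assms(1,2) this w] have "x \<in> A q k"
      unfolding A_def using \<open>x \<in> S\<close> k by simp
    then show "x \<in> \<Union> ((\<lambda>(w, k). A w k) ` ((Q - {0}) \<times> UNIV))"
      using q(1) \<open>q \<noteq> 0\<close> by blast
  qed
  ultimately show ?thesis by (rule negligible_subset)
qed

lemma negligible_regular_zeros:
  fixes F :: "'a::euclidean_space \<Rightarrow> real"
  shows "negligible {x. F x = 0 \<and> (\<exists>D. (F has_derivative D) (at x) \<and> D \<noteq> (\<lambda>_. 0))}" (is "negligible ?S")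
proof (rule negligible_tangent_cone_condition)
  fix x assume "x \<in> ?S"
  then obtain D where x: "F x = 0" and D: "(F has_derivative D) (at x)" "D \<noteq> (\<lambda>_. 0)" by blast
  define w where "w = adjoint D 1"
  have D_eq: "D h = w \<bullet> h" for h
    using adjoint_works[OF has_derivative_linear[OF D(1)], of h 1]
    by (simp add: w_def inner_commute)
  then have "w \<noteq> 0" using D(2) by auto
  then have "\<forall>\<^sub>F y in at x. \<bar>F y - w \<bullet> (y - x)\<bar> \<le> 1 / 2 * norm w * norm (y - x)"
    using D(1) unfolding has_derivative_within_alt2
    by (auto simp: x D_eq dest!: conjunct2 spec[of _ "1 / 2 * norm w"])
  then have "\<forall>\<^sub>F y in at x within ?S. \<bar>w \<bullet> (y - x)\<bar> \<le> 1 / 2 * norm w * norm (y - x)"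
    unfolding eventually_at_filter by eventually_elim auto
  then show "\<exists>w. w \<noteq> 0 \<and> (\<forall>\<^sub>F y in at x within ?S. \<bar>w \<bullet> (y - x)\<bar> \<le> 1 / 2 * norm w * norm (y - x))"
    using \<open>w \<noteq> 0\<close> by blast
qed auto

lemma negligible_coincidence_distinct_derivatives:
  fixes F G :: "'a::euclidean_space \<Rightarrow> real"
  shows "negligible {x. F x = G x \<and>
    (\<exists>D E. (F has_derivative D) (at x) \<and> (G has_derivative E) (at x) \<and> D \<noteq> E)}"
proof (rule negligible_subset[OF negligible_regular_zeros[of "\<lambda>x. F x - G x"]], safe)
  fix x D E
  assume D: "(F has_derivative D) (at x)" "(G has_derivative E) (at x)" "D \<noteq> E"
  have "((\<lambda>x. F x - G x) has_derivative (\<lambda>h. D h - E h)) (at x)"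
    using D(1,2) by (rule has_derivative_diff)
  moreover have "(\<lambda>h. D h - E h) \<noteq> (\<lambda>_. 0)"
    using D(3) by (metis eq_iff_diff_eq_0 ext)
  ultimately show "\<exists>D. ((\<lambda>x. F x - G x) has_derivative D) (at x) \<and> D \<noteq> (\<lambda>_. 0)" by blast
qed simp

lemma continuous_on_Max_image:
  fixes v :: "'i \<Rightarrow> 'a::topological_space \<Rightarrow> real"
  assumes "finite A" "A \<noteq> {}" "\<And>i. i \<in> A \<Longrightarrow> continuous_on S (v i)"
  shows "continuous_on S (\<lambda>x. Max ((\<lambda>i. v i x) ` A))"
  using assms
proof (induction A rule: finite_ne_induct)
  case (insert i F)
  then have "continuous_on S (\<lambda>x. max (v i x) (Max ((\<lambda>i. v i x) ` F)))"
    by (intro continuous_on_max) simp_all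
  then show ?case using insert.hyps by simp
qed simp

lemma eventually_Max_image_active:
  fixes v :: "'i \<Rightarrow> 'a::t2_space \<Rightarrow> real"
  assumes A: "finite A" "A \<noteq> {}" and cont: "\<And>i. i \<in> A \<Longrightarrow> isCont (v i) z"
  shows "\<forall>\<^sub>F y in nhds z. Max ((\<lambda>i. v i y) ` A)
    = Max ((\<lambda>i. v i y) ` {i \<in> A. v i z = Max ((\<lambda>i. v i z) ` A)})"
    (is "\<forall>\<^sub>F y in nhds z. _ = Max (_ ` ?I)")
proof -
  obtain i0 where i0: "i0 \<in> A" "Max ((\<lambda>i. v i z) ` A) = v i0 z"
    using obtains_MAX[OF A] by metis
  have "\<forall>\<^sub>F y in nhds z. v j y < v i0 y" if j: "j \<in> A - ?I" for j
  proof -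
    have "v j z < v i0 z"
      using j i0(2) Max_ge[of "(\<lambda>i. v i z) ` A" "v j z"] A by force
    moreover have "((\<lambda>y. v i0 y - v j y) \<longlongrightarrow> v i0 z - v j z) (nhds z)"
      using cont[of i0] cont[of j] i0 j
      by (intro tendsto_diff) (auto simp: isCont_def tendsto_nhds_iff)
    ultimately have "\<forall>\<^sub>F y in nhds z. 0 < v i0 y - v j y"
      by (intro order_tendstoD) auto
    then show ?thesis by eventually_elim simp
  qed
  then have "\<forall>\<^sub>F y in nhds z. \<forall>j\<in>A - ?I. v j y < v i0 y"
    using A by (intro eventually_ball_finite) auto
  then show ?thesis
  proof eventually_elim
    case (elim y)
    obtain k where k: "k \<in> A" "Max ((\<lambda>i. v i y) ` A) = v k y"
      using obtains_MAX[OF A] by metis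
    then have "v i0 y \<le> v k y"
      using Max_ge[of "(\<lambda>i. v i y) ` A" "v i0 y"] A i0 by auto
    then have "k \<in> ?I" using elim k(1) by (meson DiffI not_le)
    then have "Max ((\<lambda>i. v i y) ` A) \<le> Max ((\<lambda>i. v i y) ` ?I)"
      unfolding k(2) using A by (intro Max_ge) auto
    moreover have "Max ((\<lambda>i. v i y) ` ?I) \<le> Max ((\<lambda>i. v i y) ` A)"
      using A i0 by (intro Max_mono) auto
    ultimately show ?case by simp
  qed
qed

lemma has_derivative_Max_image:
  fixes v :: "'i \<Rightarrow> 'a::real_normed_vector \<Rightarrow> real"
  assumes A: "finite A" "A \<noteq> {}" and cont: "\<And>i. i \<in> A \<Longrightarrow> isCont (v i) x"
    and der: "\<And>i. i \<in> A \<Longrightarrow> v i x = Max ((\<lambda>i. v i x) ` A) \<Longrightarrow> (v i has_derivative D) (at x)"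
  shows "((\<lambda>y. Max ((\<lambda>i. v i y) ` A)) has_derivative D) (at x)"
  unfolding has_derivative_within_alt2
proof (intro conjI allI impI)
  let ?I = "{i \<in> A. v i x = Max ((\<lambda>i. v i x) ` A)}"
  have "?I \<noteq> {}" using obtains_MAX[OF A] by (metis (mono_tags, lifting) empty_iff mem_Collect_eq)
  then show "bounded_linear D" using der has_derivative_bounded_linear by blast
  fix e :: real assume "e > 0"
  have "\<forall>\<^sub>F y in at x. \<forall>i\<in>?I. norm (v i y - v i x - D (y - x)) \<le> e * norm (y - x)"
    using A der \<open>e > 0\<close> unfolding has_derivative_within_alt2
    by (intro eventually_ball_finite) auto
  moreover have "\<forall>\<^sub>F y in at x. Max ((\<lambda>i. v i y) ` A) = Max ((\<lambda>i. v i y) ` ?I)"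
    using eventually_Max_image_active[where v = v and z = x, OF A cont]
    unfolding eventually_at_filter by (auto elim: eventually_mono)
  ultimately show "\<forall>\<^sub>F y in at x.
      norm (Max ((\<lambda>i. v i y) ` A) - Max ((\<lambda>i. v i x) ` A) - D (y - x)) \<le> e * norm (y - x)"
  proof eventually_elim
    case (elim y)
    obtain k where "k \<in> ?I" "Max ((\<lambda>i. v i y) ` ?I) = v k y"
      using obtains_MAX[of ?I "\<lambda>i. v i y"] A \<open>?I \<noteq> {}\<close> by auto
    then show ?case using elim by auto
  qed
qed

lemma has_derivative_Max_image_ae:
  fixes v :: "'i \<Rightarrow> 'a::euclidean_space \<Rightarrow> real"
  assumes A: "finite A" "A \<noteq> {}"
  obtains N where "negligible N"
    "\<And>x D i. \<lbrakk>x \<notin> N; \<And>j. j \<in> A \<Longrightarrow> (v j has_derivative D j) (at x);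
      i \<in> A; v i x = Max ((\<lambda>i. v i x) ` A)\<rbrakk>
      \<Longrightarrow> ((\<lambda>y. Max ((\<lambda>i. v i y) ` A)) has_derivative D i) (at x)"
proof
  define Y where "Y i j = {x. v i x = v j x \<and>
      (\<exists>D E. (v i has_derivative D) (at x) \<and> (v j has_derivative E) (at x) \<and> D \<noteq> E)}" for i j
  have "negligible (Y i j)" for i j
    unfolding Y_def by (rule negligible_coincidence_distinct_derivatives)
  then show "negligible (\<Union>i\<in>A. \<Union>j\<in>A. Y i j)"
    using A by (auto intro!: negligible_Union)
  fix x D i
  assume x: "x \<notin> (\<Union>i\<in>A. \<Union>j\<in>A. Y i j)" and D: "\<And>j. j \<in> A \<Longrightarrow> (v j has_derivative D j) (at x)"
    and i: "i \<in> A" "v i x = Max ((\<lambda>i. v i x) ` A)"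
  show "((\<lambda>y. Max ((\<lambda>i. v i y) ` A)) has_derivative D i) (at x)"
  proof (rule has_derivative_Max_image[OF A])
    fix j assume j: "j \<in> A"
    show "isCont (v j) x" using D[OF j] by (rule has_derivative_continuous)
    assume "v j x = Max ((\<lambda>i. v i x) ` A)"
    then have "v i x = v j x" using i(2) by simp
    moreover have "x \<notin> Y i j" using x i(1) j by blast
    ultimately have "D i = D j" using D[OF i(1)] D[OF j] by (auto simp: Y_def)
    then show "(v j has_derivative D i) (at x)" using D[OF j] by simp
  qed
qed

section \<open>Increments of Lipschitz functions differentiable almost everywhere\<close>

lemma has_derivative_imp_has_vector_derivative_line:
  assumes "(W has_derivative D) (at (p + t *\<^sub>R v))"
  shows "((\<lambda>\<tau>. W (p + \<tau> *\<^sub>R v)) has_vector_derivative D v) (at t within T)"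
proof -
  have "((\<lambda>\<tau>. W (p + \<tau> *\<^sub>R v)) has_derivative (\<lambda>\<tau>. D (\<tau> *\<^sub>R v))) (at t within T)"
    by (rule has_derivative_compose[of "\<lambda>\<tau>. p + \<tau> *\<^sub>R v" "\<lambda>\<tau>. \<tau> *\<^sub>R v"])
       (use assms in \<open>auto intro!: derivative_eq_intros\<close>)
  then show ?thesis
    by (simp add: has_vector_derivative_def linear_scale[OF has_derivative_linear[OF assms]])
qed

lemma lipschitz_on_imp_norm_derivative_le:
  assumes lip: "L-lipschitz_on S W" and "open S" "p \<in> S" and D: "(W has_derivative D) (at p)"
  shows "norm (D v) \<le> L * norm v"
proof (rule field_le_epsilon)
  fix \<epsilon> :: real assume "\<epsilon> > 0"
  have "((\<lambda>\<tau>. W (p + \<tau> *\<^sub>R v)) has_vector_derivative D v) (at_right 0)"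
    using has_derivative_imp_has_vector_derivative_line[of W D p 0 v] D by simp
  then have "\<forall>\<^sub>F \<tau> in at_right 0. norm (W (p + \<tau> *\<^sub>R v) - W p - \<tau> *\<^sub>R D v) \<le> \<epsilon> * norm \<tau>"
    using \<open>\<epsilon> > 0\<close> by (simp add: has_vector_derivative_def has_derivative_within_alt2)
  moreover have "((\<lambda>\<tau>. p + \<tau> *\<^sub>R v) \<longlongrightarrow> p + 0 *\<^sub>R v) (at_right 0)" by (intro tendsto_intros)
  then have "\<forall>\<^sub>F \<tau> in at_right 0. p + \<tau> *\<^sub>R v \<in> S"
    using \<open>open S\<close> \<open>p \<in> S\<close> by (intro topological_tendstoD) auto
  moreover have "\<forall>\<^sub>F \<tau>::real in at_right 0. 0 < \<tau>" by (rule eventually_at_right_less)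
  ultimately have "\<forall>\<^sub>F \<tau> in at_right 0. 0 < \<tau> \<and> p + \<tau> *\<^sub>R v \<in> S \<and>
      norm (W (p + \<tau> *\<^sub>R v) - W p - \<tau> *\<^sub>R D v) \<le> \<epsilon> * \<tau>"
    by eventually_elim simp
  then obtain \<tau> where \<tau>: "0 < \<tau>" "p + \<tau> *\<^sub>R v \<in> S"
      "norm (W (p + \<tau> *\<^sub>R v) - W p - \<tau> *\<^sub>R D v) \<le> \<epsilon> * \<tau>"
    using eventually_happens'[OF trivial_limit_at_right_real] by blast
  have "norm (\<tau> *\<^sub>R D v) \<le> norm (W (p + \<tau> *\<^sub>R v) - W p) + norm (W (p + \<tau> *\<^sub>R v) - W p - \<tau> *\<^sub>R D v)"
    using norm_triangle_ineq4[of "W (p + \<tau> *\<^sub>R v) - W p" "W (p + \<tau> *\<^sub>R v) - W p - \<tau> *\<^sub>R D v"]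
    by simp
  also have "norm (W (p + \<tau> *\<^sub>R v) - W p) \<le> L * norm (\<tau> *\<^sub>R v)"
    using lipschitz_on_normD[OF lip \<tau>(2) \<open>p \<in> S\<close>] by simp
  finally have "\<tau> * norm (D v) \<le> \<tau> * (L * norm v + \<epsilon>)"
    using \<tau> by (simp add: algebra_simps)
  then show "norm (D v) \<le> L * norm v + \<epsilon>"
    using \<tau>(1) by simp
qed

lemma has_real_derivative_integral_Lipschitz:
  fixes F :: "real \<Rightarrow> 'a::euclidean_space \<Rightarrow> real"
  assumes int: "\<And>t. t \<in> T \<Longrightarrow> F t integrable_on B"
    and g: "g integrable_on B" "\<And>t y. t \<in> T \<Longrightarrow> y \<in> B \<Longrightarrow> \<bar>F t y - F r y\<bar> \<le> g y * \<bar>t - r\<bar>"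
    and r: "r \<in> T" "r islimpt T"
    and Z: "negligible Z"
    and der: "\<And>y. y \<in> B - Z \<Longrightarrow> ((\<lambda>t. F t y) has_real_derivative F' y) (at r within T)"
  shows "F' integrable_on B"
    and "((\<lambda>t. integral B (F t)) has_real_derivative integral B F') (at r within T)"
proof -
  define q where "q t y = (F t y - F r y) / (t - r)" for t y
  have spike: "integral (B - Z) k = integral B k" "k integrable_on (B - Z) \<longleftrightarrow> k integrable_on B"
    for k :: "'a \<Rightarrow> real"
    by (intro integral_spike_set integrable_spike_set_eq negligible_subset[OF Z]; auto)+
  have limit: "F' integrable_on B \<and> (\<lambda>k. integral B (q (X k))) \<longlonglongrightarrow> integral B F'"
    if X: "\<And>k. X k \<in> T - {r}" "X \<longlonglongrightarrow> r" for X
  proof -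
    have q_int: "q (X k) integrable_on B - Z" for k
      unfolding spike q_def using X(1)[of k] r(1)
      by (intro integrable_on_divide integrable_diff int) auto
    have g_int: "g integrable_on B - Z"
      unfolding spike by (rule g(1))
    have q_le: "norm (q (X k) y) \<le> g y" if "y \<in> B - Z" for k y
      using g(2)[of "X k" y] X(1)[of k] that by (simp add: q_def pos_divide_le_eq)
    have q_lim: "(\<lambda>k. q (X k) y) \<longlonglongrightarrow> F' y" if "y \<in> B - Z" for y
    proof -
      have "((\<lambda>t. q t y) \<longlongrightarrow> F' y) (at r within T)"
        using der[OF that] by (simp add: has_field_derivative_iff q_def)
      then show ?thesis
        using X unfolding tendsto_at_iff_sequentially comp_def by simp
    qed
    from dominated_convergence[OF q_int g_int q_le q_lim] show ?thesis
      by (simp add: spike)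
  qed
  show "((\<lambda>t. integral B (F t)) has_real_derivative integral B F') (at r within T)"
    unfolding has_field_derivative_iff tendsto_at_iff_sequentially comp_def
  proof (intro allI impI)
    fix X assume X: "\<forall>k. X k \<in> T - {r}" "X \<longlonglongrightarrow> r"
    then have "(integral B (F (X k)) - integral B (F r)) / (X k - r) = integral B (q (X k))" for k
      unfolding q_def using int r(1) by (simp add: integral_diff)
    then show "(\<lambda>k. (integral B (F (X k)) - integral B (F r)) / (X k - r)) \<longlonglongrightarrow> integral B F'"
      using limit X by simp
  qed
  obtain X where "\<And>k. X k \<in> T - {r}" "X \<longlonglongrightarrow> r"
    using r(2) unfolding islimpt_sequential by blast
  then show "F' integrable_on B" using limit[of X] by simp
qed

lemma integral_translation_has_derivative_le:
  fixes W :: "'a::euclidean_space \<Rightarrow> real"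
  assumes lip: "L-lipschitz_on S W"
    and segment: "\<And>y t. y \<in> cbox a b \<Longrightarrow> t \<in> {0..1} \<Longrightarrow> y + t *\<^sub>R v \<in> S"
    and Z: "negligible Z"
    and der: "\<And>p. p \<in> S - Z \<Longrightarrow> \<exists>D. (W has_derivative D) (at p) \<and> D v \<le> \<kappa>"
    and t: "t \<in> {0..1}"
  shows "\<exists>m\<le>\<kappa> * measure lborel (cbox a b).
    ((\<lambda>t. integral (cbox a b) (\<lambda>y. W (y + t *\<^sub>R v))) has_real_derivative m) (at t within {0..1})"
proof -
  have int: "(\<lambda>y. W (y + t *\<^sub>R v)) integrable_on cbox a b" if "t \<in> {0..1}" for t
  proof (intro integrable_continuous continuous_on_compose2[OF lipschitz_on_continuous_on[OF lip]])
    show "(\<lambda>y. y + t *\<^sub>R v) ` cbox a b \<subseteq> S" using segment that by blast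
  qed (intro continuous_intros)
  define Z' where "Z' = (+) (- (t *\<^sub>R v)) ` Z"
  have Z': "negligible Z'" unfolding Z'_def by (rule negligible_translation[OF Z])
  have "\<exists>D. (W has_derivative D) (at (y + t *\<^sub>R v)) \<and> D v \<le> \<kappa>" if "y \<in> cbox a b - Z'" for y
  proof (rule der)
    show "y + t *\<^sub>R v \<in> S - Z"
      using that segment[of y t] t by (auto simp: Z'_def image_iff add.commute)
  qed
  then obtain D where D: "\<And>y. y \<in> cbox a b - Z' \<Longrightarrow> (W has_derivative D y) (at (y + t *\<^sub>R v))"
    "\<And>y. y \<in> cbox a b - Z' \<Longrightarrow> D y v \<le> \<kappa>" by metis
  define w where "w y = (if y \<in> Z' then \<kappa> else D y v)" for y
  have bound: "\<bar>W (y + \<tau> *\<^sub>R v) - W (y + t *\<^sub>R v)\<bar> \<le> L * norm v * \<bar>\<tau> - t\<bar>"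
    if "\<tau> \<in> {0..1}" "y \<in> cbox a b" for \<tau> y
    using lipschitz_on_normD[OF lip segment[OF that(2,1)] segment[OF that(2) t]]
    by (simp add: scaleR_diff_left[symmetric] ac_simps)
  have slope: "((\<lambda>\<tau>. W (y + \<tau> *\<^sub>R v)) has_real_derivative w y) (at t within {0..1})"
    if "y \<in> cbox a b - Z'" for y
    using has_derivative_imp_has_vector_derivative_line[OF D(1)[OF that]] that
    by (simp add: has_real_derivative_iff_has_vector_derivative w_def)
  have "t islimpt {0..1}" using t by (simp add: islimpt_Icc)
  note deriv = has_real_derivative_integral_Lipschitz[OF int integrable_const bound t this Z' slope]
  have "integral (cbox a b) w \<le> integral (cbox a b) (\<lambda>_. \<kappa>)"
    using D(2) by (intro integral_le deriv(1)) (auto simp: w_def)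
  then show ?thesis using deriv(2) by (auto simp: mult.commute)
qed

lemma integral_translation_increment_le:
  fixes W :: "'a::euclidean_space \<Rightarrow> real"
  assumes lip: "L-lipschitz_on S W" and S: "convex S" "cbox a b \<subseteq> S" "(\<lambda>y. y + v) ` cbox a b \<subseteq> S"
    and Z: "negligible Z"
    and der: "\<And>p. p \<in> S - Z \<Longrightarrow> \<exists>D. (W has_derivative D) (at p) \<and> D v \<le> \<kappa>"
  shows "integral (cbox a b) (\<lambda>y. W (y + v)) - integral (cbox a b) W \<le> \<kappa> * measure lborel (cbox a b)"
proof -
  define \<Phi> where "\<Phi> t = integral (cbox a b) (\<lambda>y. W (y + t *\<^sub>R v))" for t
  have segment: "y + t *\<^sub>R v \<in> S" if "y \<in> cbox a b" "t \<in> {0..1}" for y t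
  proof -
    have "y \<in> S" "y + v \<in> S" using S(2,3) that by auto
    then have "(1 - t) *\<^sub>R y + t *\<^sub>R (y + v) \<in> S"
      using that by (intro convexD_alt[OF S(1)]) auto
    then show ?thesis by (simp add: algebra_simps)
  qed
  obtain \<Phi>' where \<Phi>': "\<And>t. t \<in> {0..1} \<Longrightarrow> (\<Phi> has_real_derivative \<Phi>' t) (at t within {0..1})"
     "\<And>t. t \<in> {0..1} \<Longrightarrow> \<Phi>' t \<le> \<kappa> * measure lborel (cbox a b)"
    using integral_translation_has_derivative_le[OF lip segment Z der] unfolding \<Phi>_def[abs_def] by metis
  obtain t where "t \<in> {0..1}" "\<Phi> 1 - \<Phi> 0 = \<Phi>' t * (1 - 0)"
    using mvt_very_simple[of 0 1 \<Phi> "\<lambda>t. (*) (\<Phi>' t)"] \<Phi>'(1) by (auto simp: has_field_derivative_def)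
  then show ?thesis using \<Phi>'(2)[of t] by (simp add: \<Phi>_def)
qed

lemma nonpos_if_cbox_integrals_nonpos:
  fixes h :: "'a::euclidean_space \<Rightarrow> real"
  assumes "open S" "x \<in> S" and cont: "continuous_on S h"
    and int: "\<And>a b. cbox a b \<subseteq> S \<Longrightarrow> integral (cbox a b) h \<le> 0"
  shows "h x \<le> 0"
proof (rule ccontr)
  assume "\<not> h x \<le> 0"
  have "open (S \<inter> h -` {h x / 2<..})"
    using cont \<open>open S\<close> by (intro continuous_open_preimage) auto
  moreover have "x \<in> S \<inter> h -` {h x / 2<..}"
    using \<open>x \<in> S\<close> \<open>\<not> h x \<le> 0\<close> by simp
  ultimately obtain a b where ab: "cbox a b \<subseteq> S \<inter> h -` {h x / 2<..}" "\<forall>i\<in>Basis. a \<bullet> i < b \<bullet> i"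
    by (rule open_contains_cbox)
  have "0 < h x / 2 * measure lborel (cbox a b)"
    using content_pos_lt[OF ab(2)] \<open>\<not> h x \<le> 0\<close> by simp
  also have "\<dots> = integral (cbox a b) (\<lambda>_. h x / 2)"
    by simp
  also have "\<dots> \<le> integral (cbox a b) h"
    using ab(1) by (intro integral_le integrable_continuous continuous_on_subset[OF cont]) auto
  also have "\<dots> \<le> 0"
    using ab(1) by (intro int) auto
  finally show False by simp
qed

lemma increment_le_ae_directional_derivative:
  fixes W :: "'a::euclidean_space \<Rightarrow> real"
  assumes lip: "L-lipschitz_on S W" and S: "open S" "convex S" "x \<in> S" "x + v \<in> S"
    and Z: "negligible Z"
    and der: "\<And>p. p \<in> S - Z \<Longrightarrow> \<exists>D. (W has_derivative D) (at p) \<and> D v \<le> \<kappa>"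
  shows "W (x + v) \<le> W x + \<kappa>"
proof -
  let ?S = "S \<inter> (\<lambda>y. y + v) -` S"
  have cont: "continuous_on A W" "continuous_on A (\<lambda>y. W (y + v))" if "A \<subseteq> ?S" for A
    using that
    by (auto intro!: continuous_on_compose2[OF lipschitz_on_continuous_on[OF lip]] continuous_intros)
  have "W (x + v) - W x - \<kappa> \<le> 0"
  proof (rule nonpos_if_cbox_integrals_nonpos[where S = ?S])
    show "open ?S"
      using S(1) by (intro open_Int open_vimage continuous_intros)
    show "continuous_on ?S (\<lambda>y. W (y + v) - W y - \<kappa>)"
      by (intro continuous_intros cont order_refl)
    fix a b assume ab: "cbox a b \<subseteq> ?S"
    then have "integral (cbox a b) (\<lambda>y. W (y + v)) - integral (cbox a b) W
        \<le> \<kappa> * measure lborel (cbox a b)"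
      using S(2) by (intro integral_translation_increment_le[OF lip _ _ _ Z der]) auto
    then show "integral (cbox a b) (\<lambda>y. W (y + v) - W y - \<kappa>) \<le> 0"
      using cont[OF ab] by (simp add: integral_diff integrable_diff integrable_continuous mult.commute)
  qed (use S in simp)
  then show ?thesis by simp
qed

section \<open>Upper right Dini derivatives\<close>

definition upper_dini_le :: "(real \<Rightarrow> real) \<Rightarrow> real \<Rightarrow> real \<Rightarrow> bool" where
  "upper_dini_le y m s \<longleftrightarrow> (\<forall>e>0. \<forall>\<^sub>F t in at_right s. y t \<le> y s + (m + e) * (t - s))"

lemma upper_dini_leD:
  "upper_dini_le y m s \<Longrightarrow> e > 0 \<Longrightarrow> \<forall>\<^sub>F t in at_right s. y t \<le> y s + (m + e) * (t - s)"
  by (simp add: upper_dini_le_def)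

lemma upper_dini_le_mono:
  assumes "upper_dini_le y m s" "m \<le> m'"
  shows "upper_dini_le y m' s"
  unfolding upper_dini_le_def
proof (intro allI impI)
  fix e :: real assume "e > 0"
  from upper_dini_leD[OF assms(1) this] eventually_at_right_less
  show "\<forall>\<^sub>F t in at_right s. y t \<le> y s + (m' + e) * (t - s)"
  proof eventually_elim
    case (elim t)
    then have "(m + e) * (t - s) \<le> (m' + e) * (t - s)"
      using \<open>m \<le> m'\<close> by (intro mult_right_mono) auto
    then show ?case using elim by linarith
  qed
qed

lemma upper_dini_le_norm:
  fixes z :: "real \<Rightarrow> 'a::real_normed_vector"
  assumes "(z has_vector_derivative w) (at_right s)"
  shows "upper_dini_le (\<lambda>t. norm (z t)) (norm w) s"
  unfolding upper_dini_le_def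
proof (intro allI impI)
  fix e :: real assume "e > 0"
  then have "\<forall>\<^sub>F t in at_right s. norm (z t - z s - (t - s) *\<^sub>R w) \<le> e * norm (t - s)"
    using assms unfolding has_vector_derivative_def has_derivative_within_alt2 by blast
  then show "\<forall>\<^sub>F t in at_right s. norm (z t) \<le> norm (z s) + (norm w + e) * (t - s)"
    using eventually_at_right_less
  proof eventually_elim
    case (elim t)
    have "norm (z t) \<le> norm (z s) + norm ((t - s) *\<^sub>R w) + norm (z t - z s - (t - s) *\<^sub>R w)"
      using norm_triangle_ineq[of "z s + (t - s) *\<^sub>R w" "z t - z s - (t - s) *\<^sub>R w"]
        norm_triangle_ineq[of "z s" "(t - s) *\<^sub>R w"] by simp
    also have "norm ((t - s) *\<^sub>R w) = norm w * (t - s)" using elim by simp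
    finally show ?case using elim by (simp add: distrib_right)
  qed
qed

lemma upper_dini_le_mult:
  assumes y: "upper_dini_le y m s" and p: "(p has_real_derivative p') (at_right s)" "\<And>t. p t > 0"
  shows "upper_dini_le (\<lambda>t. p t * y t) (p' * y s + p s * m) s"
  unfolding upper_dini_le_def
proof (intro allI impI)
  fix e :: real assume "e > 0"
  define e' where "e' = e / (2 * p s)"
  have "e' > 0" using \<open>e > 0\<close> p(2) by (simp add: e'_def)
  define q where "q t = p t * (y s + (m + e') * (t - s))" for t
  have "(q has_real_derivative p' * y s + p s * m + e / 2) (at_right s)"
    unfolding q_def using p(2)[of s]
    by (auto intro!: derivative_eq_intros p(1) simp: algebra_simps e'_def)
  then have "\<forall>\<^sub>F t in at_right s. (q t - q s) / (t - s) < p' * y s + p s * m + e"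
    unfolding has_field_derivative_iff using \<open>e > 0\<close> by (intro order_tendstoD(2)) auto
  then show "\<forall>\<^sub>F t in at_right s. p t * y t \<le> p s * y s + (p' * y s + p s * m + e) * (t - s)"
    using upper_dini_leD[OF y \<open>e' > 0\<close>] eventually_at_right_less
  proof eventually_elim
    case (elim t)
    have "p t * y t \<le> q t" using elim(2) p(2)[of t] by (simp add: q_def)
    also have "q t \<le> q s + (p' * y s + p s * m + e) * (t - s)"
      using elim by (simp add: pos_divide_less_eq)
    finally show ?case by (simp add: q_def)
  qed
qed

lemma closed_Icc_induct:
  fixes S :: "real set"
  assumes "closed S" "a \<in> S" "a \<le> b"
    and step: "\<And>\<tau>. \<lbrakk>\<tau> \<in> S; a \<le> \<tau>; \<tau> < b\<rbrakk> \<Longrightarrow> \<forall>\<^sub>F t in at_right \<tau>. t < b \<longrightarrow> t \<in> S"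
  shows "b \<in> S"
proof -
  let ?S = "S \<inter> {a..b}"
  define \<tau> where "\<tau> = Sup ?S"
  have bdd: "bdd_above ?S" by auto
  have "closed ?S" using \<open>closed S\<close> by (intro closed_Int) auto
  then have "\<tau> \<in> ?S" unfolding \<tau>_def using assms(2,3) bdd by (intro closed_contains_Sup) auto
  have "\<tau> = b"
  proof (rule ccontr)
    assume "\<tau> \<noteq> b"
    then have \<tau>: "\<tau> \<in> S" "a \<le> \<tau>" "\<tau> < b" using \<open>\<tau> \<in> ?S\<close> by auto
    have "\<forall>\<^sub>F t in at_right \<tau>. t < b"
      using \<open>\<tau> < b\<close> eventually_at_right_field by blast
    with step[OF \<tau>] eventually_at_right_less have "\<forall>\<^sub>F t in at_right \<tau>. \<tau> < t \<and> t \<in> ?S"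
      by eventually_elim (use \<tau>(2) in auto)
    then obtain t where "\<tau> < t" "t \<in> ?S"
      using eventually_happens'[OF trivial_limit_at_right_real] by blast
    then show False using cSup_upper[OF _ bdd, of t] by (simp add: \<tau>_def)
  qed
  then show ?thesis using \<open>\<tau> \<in> ?S\<close> by simp
qed

lemma upper_dini_barrier:
  assumes "a \<le> b" and cont: "continuous_on {a..b} y" and "y a \<le> M"
    and dini: "\<And>s. \<lbrakk>a \<le> s; s < b; M < y s\<rbrakk> \<Longrightarrow> upper_dini_le y 0 s"
  shows "y b \<le> M"
proof (rule field_le_epsilon)
  fix \<epsilon> :: real assume "\<epsilon> > 0"
  define e where "e = \<epsilon> / (b - a + 1)"
  have e: "e > 0" "e * (b - a + 1) = \<epsilon>"
    using \<open>\<epsilon> > 0\<close> \<open>a \<le> b\<close> by (auto simp: e_def)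
  define bar where "bar s = M + e * (s - a + 1)" for s
  have cont_bar: "continuous_on A bar" for A
    unfolding bar_def by (intro continuous_intros)
  have "b \<in> {s \<in> {a..b}. y s \<le> bar s}"
  proof (rule closed_Icc_induct[OF _ _ \<open>a \<le> b\<close>])
    show "closed {s \<in> {a..b}. y s \<le> bar s}"
      by (intro continuous_on_closed_Collect_le cont cont_bar) simp
    show "a \<in> {s \<in> {a..b}. y s \<le> bar s}"
      using \<open>a \<le> b\<close> \<open>y a \<le> M\<close> e(1) by (simp add: bar_def)
    fix \<tau> assume "\<tau> \<in> {s \<in> {a..b}. y s \<le> bar s}" and \<tau>: "a \<le> \<tau>" "\<tau> < b"
    then consider "y \<tau> = bar \<tau>" | "y \<tau> < bar \<tau>" by force
    then have "\<forall>\<^sub>F t in at_right \<tau>. y t \<le> bar t"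
    proof cases
      case 1
      then have "upper_dini_le y 0 \<tau>" using \<tau> e(1) by (intro dini) (auto simp: bar_def add_pos_nonneg)
      from upper_dini_leD[OF this e(1)] show ?thesis
        by eventually_elim (simp add: 1 bar_def algebra_simps)
    next
      case 2
      have "continuous_on {\<tau>..b} (\<lambda>t. bar t - y t)"
        using \<tau> by (intro continuous_on_diff cont_bar continuous_on_subset[OF cont]) auto
      then have "((\<lambda>t. bar t - y t) \<longlongrightarrow> bar \<tau> - y \<tau>) (at_right \<tau>)"
        using \<tau>(2) by (rule continuous_on_Icc_at_rightD)
      then have "\<forall>\<^sub>F t in at_right \<tau>. 0 < bar t - y t"
        using 2 by (intro order_tendstoD) auto
      then show ?thesis by eventually_elim simp
    qed
    with eventually_at_right_less
    show "\<forall>\<^sub>F t in at_right \<tau>. t < b \<longrightarrow> t \<in> {s \<in> {a..b}. y s \<le> bar s}"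
      by eventually_elim (use \<tau>(1) in auto)
  qed
  then show "y b \<le> M + \<epsilon>" using e(2) by (simp add: bar_def)
qed

lemma upper_dini_gronwall:
  assumes "a \<le> b" and cont: "continuous_on {a..b} y"
    and dini: "\<And>s. \<lbrakk>a \<le> s; s < b\<rbrakk> \<Longrightarrow> upper_dini_le y (K * y s) s"
  shows "y b \<le> exp (K * (b - a)) * y a"
proof -
  have "exp (- K * (b - a)) * y b \<le> exp (- K * (a - a)) * y a"
  proof (rule upper_dini_barrier[OF \<open>a \<le> b\<close> _ order_refl])
    show "continuous_on {a..b} (\<lambda>s. exp (- K * (s - a)) * y s)"
      by (intro continuous_intros cont)
    fix s assume s: "a \<le> s" "s < b"
    have "((\<lambda>t. exp (- K * (t - a))) has_real_derivative - K * exp (- K * (s - a))) (at_right s)"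
      by (auto intro!: derivative_eq_intros)
    from upper_dini_le_mult[OF dini[OF s] this]
    show "upper_dini_le (\<lambda>s. exp (- K * (s - a)) * y s) 0 s" by (simp add: algebra_simps)
  qed
  then have "exp (K * (b - a)) * (exp (- K * (b - a)) * y b) \<le> exp (K * (b - a)) * y a" by simp
  then show ?thesis by (simp add: mult.assoc[symmetric] exp_add[symmetric])
qed

lemma upper_dini_le_line:
  fixes W :: "'a::euclidean_space \<Rightarrow> real"
  assumes lip: "L-lipschitz_on U W" and U: "open U" "p \<in> U"
    and Z: "negligible Z"
    and der: "\<And>e. e > 0 \<Longrightarrow>
      \<forall>\<^sub>F q in nhds p. q \<notin> Z \<longrightarrow> (\<exists>D. (W has_derivative D) (at q) \<and> D w \<le> m + e)"
  shows "upper_dini_le (\<lambda>t. W (p + (t - s) *\<^sub>R w)) m s"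
  unfolding upper_dini_le_def
proof (intro allI impI)
  fix e :: real assume "e > 0"
  have "\<forall>\<^sub>F q in nhds p. q \<in> U \<and> (q \<notin> Z \<longrightarrow> (\<exists>D. (W has_derivative D) (at q) \<and> D w \<le> m + e))"
    using U \<open>e > 0\<close> by (intro eventually_conj eventually_nhds_in_open der) auto
  then obtain r where "r > 0" and near: "\<And>q. q \<in> ball p r \<Longrightarrow>
      q \<in> U \<and> (q \<notin> Z \<longrightarrow> (\<exists>D. (W has_derivative D) (at q) \<and> D w \<le> m + e))"
    unfolding eventually_nhds_metric by (auto simp: dist_commute)
  have lip': "L-lipschitz_on (ball p r) W"
    using near by (intro lipschitz_on_subset[OF lip]) auto
  have "((\<lambda>t. p + (t - s) *\<^sub>R w) \<longlongrightarrow> p + (s - s) *\<^sub>R w) (at_right s)"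
    by (intro tendsto_intros)
  then have "\<forall>\<^sub>F t in at_right s. p + (t - s) *\<^sub>R w \<in> ball p r"
    using \<open>r > 0\<close> by (intro topological_tendstoD) auto
  then show "\<forall>\<^sub>F t in at_right s. W (p + (t - s) *\<^sub>R w) \<le> W (p + (s - s) *\<^sub>R w) + (m + e) * (t - s)"
    using eventually_at_right_less
  proof eventually_elim
    case (elim t)
    have "\<exists>D. (W has_derivative D) (at q) \<and> D ((t - s) *\<^sub>R w) \<le> (m + e) * (t - s)"
      if "q \<in> ball p r - Z" for q
    proof -
      obtain D where D: "(W has_derivative D) (at q)" "D w \<le> m + e"
        using near[of q] \<open>q \<in> ball p r - Z\<close> by auto
      moreover have "D ((t - s) *\<^sub>R w) = D w * (t - s)"
        using linear_scale[OF has_derivative_linear[OF D(1)]] by simp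
      ultimately show ?thesis using elim by (auto intro!: mult_right_mono)
    qed
    then show ?case
      using elim \<open>r > 0\<close> increment_le_ae_directional_derivative[OF lip' _ _ _ _ Z] by simp
  qed
qed

lemma upper_dini_le_tangent:
  assumes x: "(x has_vector_derivative w) (at_right s)"
    and lip: "L-lipschitz_on U W" and U: "open U" "x s \<in> U"
    and line: "upper_dini_le (\<lambda>t. W (x s + (t - s) *\<^sub>R w)) m s"
  shows "upper_dini_le (\<lambda>t. W (x t)) m s"
  unfolding upper_dini_le_def
proof (intro allI impI)
  fix e :: real assume "e > 0"
  have "L \<ge> 0" using lip by (rule lipschitz_on_nonneg)
  define \<delta> where "\<delta> = e / (2 * (L + 1))"
  have \<delta>: "\<delta> > 0" "L * \<delta> \<le> e / 2" using \<open>e > 0\<close> \<open>L \<ge> 0\<close> by (auto simp: \<delta>_def field_simps)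
  have "\<forall>\<^sub>F t in at_right s. norm (x t - x s - (t - s) *\<^sub>R w) \<le> \<delta> * norm (t - s)"
    using x \<delta>(1) unfolding has_vector_derivative_def has_derivative_within_alt2 by blast
  moreover have "(x \<longlongrightarrow> x s) (at_right s)"
    using has_vector_derivative_continuous[OF x] by (simp add: continuous_within)
  then have "\<forall>\<^sub>F t in at_right s. x t \<in> U"
    using U by (intro topological_tendstoD) auto
  moreover have "((\<lambda>t. x s + (t - s) *\<^sub>R w) \<longlongrightarrow> x s + (s - s) *\<^sub>R w) (at_right s)"
    by (intro tendsto_intros)
  then have "\<forall>\<^sub>F t in at_right s. x s + (t - s) *\<^sub>R w \<in> U"
    using U by (intro topological_tendstoD) auto
  moreover note upper_dini_leD[OF line half_gt_zero[OF \<open>e > 0\<close>]] eventually_at_right_less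
  ultimately show "\<forall>\<^sub>F t in at_right s. W (x t) \<le> W (x s) + (m + e) * (t - s)"
  proof eventually_elim
    case (elim t)
    define p where "p = x s + (t - s) *\<^sub>R w"
    have "norm (W (x t) - W p) \<le> L * norm (x t - p)"
      using elim by (intro lipschitz_on_normD[OF lip]) (auto simp: p_def)
    also have "\<dots> \<le> L * (\<delta> * (t - s))"
      using elim \<open>L \<ge> 0\<close> by (intro mult_left_mono) (auto simp: p_def diff_diff_eq)
    also have "\<dots> \<le> e / 2 * (t - s)"
      using mult_right_mono[OF \<delta>(2), of "t - s"] elim by (simp add: mult.assoc)
    finally have "W (x t) \<le> W p + e / 2 * (t - s)" unfolding real_norm_def by linarith
    also have "W p \<le> W (x s) + (m + e / 2) * (t - s)"
      using elim by (simp add: p_def)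
    finally show ?case by (simp add: algebra_simps)
  qed
qed

section \<open>Comparison functions\<close>

lemma Kinf_mono: "Kinf \<gamma> \<Longrightarrow> 0 \<le> r \<Longrightarrow> r \<le> s \<Longrightarrow> \<gamma> r \<le> \<gamma> s"
  unfolding Kinf_def by (auto intro: strict_mono_on_leD)

lemma Kinf_nonneg: "Kinf \<gamma> \<Longrightarrow> 0 \<le> r \<Longrightarrow> 0 \<le> \<gamma> r"
  using Kinf_mono[of \<gamma> 0 r] by (simp add: Kinf_def)

lemma Kinf_compose:
  assumes \<sigma>: "Kinf \<sigma>" and \<gamma>: "Kinf \<gamma>"
  shows "Kinf (\<lambda>r. \<sigma> (\<gamma> r))"
  unfolding Kinf_def
proof (intro conjI)
  have nonneg: "0 \<le> \<gamma> r" if "0 \<le> r" for r using Kinf_nonneg[OF \<gamma> that] .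
  show "continuous_on {0..} (\<lambda>r. \<sigma> (\<gamma> r))"
    using \<sigma> \<gamma> nonneg by (auto simp: Kinf_def intro: continuous_on_compose2[of "{0..}" \<sigma>])
  show "strict_mono_on {0..} (\<lambda>r. \<sigma> (\<gamma> r))"
    using \<sigma> \<gamma> nonneg unfolding Kinf_def strict_mono_on_def by simp
  show "\<sigma> (\<gamma> 0) = 0" using \<sigma> \<gamma> by (simp add: Kinf_def)
  show "filterlim (\<lambda>r. \<sigma> (\<gamma> r)) at_top at_top"
    using filterlim_compose[of \<sigma> at_top at_top \<gamma>] \<sigma> \<gamma> by (simp add: Kinf_def)
qed

lemma Kinf_cmult:
  assumes "Kinf \<gamma>" "k > 0"
  shows "Kinf (\<lambda>r. k * \<gamma> r)"
  unfolding Kinf_def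
proof (intro conjI)
  show "continuous_on {0..} (\<lambda>r. k * \<gamma> r)"
    using assms by (intro continuous_on_mult_left) (simp add: Kinf_def)
  show "strict_mono_on {0..} (\<lambda>r. k * \<gamma> r)" "k * \<gamma> 0 = 0"
    using assms by (simp_all add: Kinf_def strict_mono_on_def)
  show "filterlim (\<lambda>r. k * \<gamma> r) at_top at_top"
    using assms by (intro filterlim_tendsto_pos_mult_at_top[OF tendsto_const]) (simp_all add: Kinf_def)
qed

lemma Kinf_max:
  assumes "Kinf \<gamma>" "Kinf \<delta>"
  shows "Kinf (\<lambda>r. max (\<gamma> r) (\<delta> r))"
  unfolding Kinf_def
proof (intro conjI)
  show "continuous_on {0..} (\<lambda>r. max (\<gamma> r) (\<delta> r))"
    using assms by (intro continuous_on_max) (simp_all add: Kinf_def)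
  show "strict_mono_on {0..} (\<lambda>r. max (\<gamma> r) (\<delta> r))"
  proof (rule strict_mono_onI)
    fix r s :: real assume "r \<in> {0..}" "s \<in> {0..}" "r < s"
    then have "\<gamma> r < \<gamma> s" "\<delta> r < \<delta> s" using assms by (auto simp: Kinf_def strict_mono_on_def)
    then show "max (\<gamma> r) (\<delta> r) < max (\<gamma> s) (\<delta> s)" by linarith
  qed
  show "max (\<gamma> 0) (\<delta> 0) = 0"
    using assms by (simp add: Kinf_def)
  show "filterlim (\<lambda>r. max (\<gamma> r) (\<delta> r)) at_top at_top"
    by (rule filterlim_at_top_mono[of \<gamma>]) (use assms in \<open>simp_all add: Kinf_def\<close>)
qed

lemma Kinf_Max_image:
  assumes "finite A" "A \<noteq> {}" "\<And>i. i \<in> A \<Longrightarrow> Kinf (k i)"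
  shows "Kinf (\<lambda>r. Max ((\<lambda>i. k i r) ` A))"
  using assms
proof (induction A rule: finite_ne_induct)
  case (insert i F)
  then have "Kinf (\<lambda>r. max (k i r) (Max ((\<lambda>i. k i r) ` F)))"
    by (intro Kinf_max) simp_all
  then show ?case using insert.hyps by simp
qed simp

lemma KL_exp_decay:
  assumes \<sigma>: "Kinf \<sigma>" and \<alpha>: "Kinf \<alpha>" and "lam > 0"
  shows "KL (\<lambda>r t. \<sigma> (exp (\<mu> - lam * t) * \<alpha> r))"
  unfolding KL_def
proof (intro conjI allI impI)
  fix t :: real
  have "Kinf (\<lambda>r. \<sigma> (exp (\<mu> - lam * t) * \<alpha> r))"
    by (intro Kinf_compose[OF \<sigma>] Kinf_cmult \<alpha>) simp
  then show "continuous_on {0..} (\<lambda>r. \<sigma> (exp (\<mu> - lam * t) * \<alpha> r))"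
    "strict_mono_on {0..} (\<lambda>r. \<sigma> (exp (\<mu> - lam * t) * \<alpha> r))" "\<sigma> (exp (\<mu> - lam * t) * \<alpha> 0) = 0"
    by (auto simp: Kinf_def)
next
  fix r :: real assume "0 \<le> r"
  then have "\<alpha> r \<ge> 0" by (rule Kinf_nonneg[OF \<alpha>])
  have cont: "continuous_on {0..} \<sigma>" and "\<sigma> 0 = 0" using \<sigma> by (auto simp: Kinf_def)
  show "continuous_on {0..} (\<lambda>t. \<sigma> (exp (\<mu> - lam * t) * \<alpha> r))"
    using \<open>\<alpha> r \<ge> 0\<close> by (intro continuous_on_compose2[OF cont] continuous_intros) auto
  show "\<sigma> (exp (\<mu> - lam * b) * \<alpha> r) \<le> \<sigma> (exp (\<mu> - lam * a) * \<alpha> r)" if "0 \<le> a" "a \<le> b" for a b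
    using \<open>\<alpha> r \<ge> 0\<close> that \<open>lam > 0\<close> by (intro Kinf_mono[OF \<sigma>] mult_right_mono) auto
  have "filterlim (\<lambda>t. - \<mu> + lam * t) at_top at_top"
    using \<open>lam > 0\<close>
    by (intro filterlim_tendsto_add_at_top[OF tendsto_const]
        filterlim_tendsto_pos_mult_at_top[OF tendsto_const] filterlim_ident)
  then have "((\<lambda>t. inverse (exp (- \<mu> + lam * t)) * \<alpha> r) \<longlongrightarrow> 0) at_top"
    by (intro tendsto_mult_left_zero tendsto_inverse_0_at_top filterlim_compose[OF exp_at_top])
  then have "((\<lambda>t. exp (\<mu> - lam * t) * \<alpha> r) \<longlongrightarrow> 0) at_top"
    by (simp add: exp_minus[symmetric])
  from continuous_on_tendsto_compose[OF cont this]
  show "((\<lambda>t. \<sigma> (exp (\<mu> - lam * t) * \<alpha> r)) \<longlongrightarrow> 0) at_top"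
    using \<open>\<alpha> r \<ge> 0\<close> \<open>\<sigma> 0 = 0\<close> by simp
qed

text \<open>Averaging \<open>h\<close> over \<open>[r, 2 r]\<close> makes it continuous, and keeps it monotone and above \<open>h r\<close>.\<close>

definition dilation_mean :: "(real \<Rightarrow> real) \<Rightarrow> real \<Rightarrow> real" where
  "dilation_mean h r = integral {1..2} (\<lambda>\<tau>. h (r * \<tau>))"

lemma integrable_on_dilation:
  fixes h :: "real \<Rightarrow> real"
  assumes "mono_on {0..} h" "0 \<le> r"
  shows "(\<lambda>\<tau>. h (r * \<tau>)) integrable_on {1..2::real}"
proof (intro integrable_on_mono_on mono_onI)
  fix \<sigma> \<tau> :: real assume "\<sigma> \<in> {1..2}" "\<tau> \<in> {1..2}" "\<sigma> \<le> \<tau>"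
  then show "h (r * \<sigma>) \<le> h (r * \<tau>)"
    using assms(2) by (intro mono_onD[OF assms(1)] mult_left_mono) auto
qed

lemma dilation_mean_mono:
  assumes "mono_on {0..} h" "0 \<le> r" "r \<le> s"
  shows "dilation_mean h r \<le> dilation_mean h s"
  unfolding dilation_mean_def
proof (intro integral_le integrable_on_dilation[OF assms(1)])
  fix \<tau> :: real assume "\<tau> \<in> {1..2}"
  then show "h (r * \<tau>) \<le> h (s * \<tau>)"
    using assms(2,3) by (intro mono_onD[OF assms(1)] mult_right_mono) auto
qed (use assms in auto)

lemma dilation_mean_bounds:
  assumes "mono_on {0..} h" "0 \<le> r"
  shows "h r \<le> dilation_mean h r" "dilation_mean h r \<le> h (2 * r)"
proof -
  have const: "integral {1..2::real} (\<lambda>_. k) = k" for k :: real by simp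
  have between: "h r \<le> h (r * \<tau>)" "h (r * \<tau>) \<le> h (2 * r)" if "\<tau> \<in> {1..2}" for \<tau>
    using that assms(2) mult_left_mono[of 1 \<tau> r] mult_left_mono[of \<tau> 2 r]
    by (auto intro!: mono_onD[OF assms(1)])
  have "integral {1..2::real} (\<lambda>_. h r) \<le> dilation_mean h r"
    unfolding dilation_mean_def
    by (intro integral_le integrable_on_dilation assms integrable_const_ivl between(1))
  then show "h r \<le> dilation_mean h r" unfolding const .
  have "dilation_mean h r \<le> integral {1..2::real} (\<lambda>_. h (2 * r))"
    unfolding dilation_mean_def
    by (intro integral_le integrable_on_dilation assms integrable_const_ivl between(2))
  then show "dilation_mean h r \<le> h (2 * r)" unfolding const .
qed

lemma isCont_dilation_mean:
  assumes "mono_on {0..} h" "0 < r"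
  shows "isCont (dilation_mean h) r"
proof -
  define H where "H s = integral {0..s} h" for s
  have h_int: "h integrable_on {a..b}" if "0 \<le> a" for a b
    using that by (intro integrable_on_mono_on mono_on_subset[OF assms(1)]) auto
  have mean_eq: "dilation_mean h s = (H (2 * s) - H s) / s" if "0 < s" for s
  proof -
    have "((\<lambda>\<tau>. h (s * \<tau>)) has_integral (1 / \<bar>s\<bar>) *\<^sub>R integral {s..2 * s} h)
        ((\<lambda>\<tau>. \<tau> / s) ` {s..2 * s})"
      using has_integral_stretch_real[OF integrable_integral[OF h_int[of s "2 * s"]], of s] that by simp
    moreover have "(\<lambda>\<tau>. \<tau> / s) ` {s..2 * s} = {1..2}"
      using that by (auto simp: image_iff field_simps intro!: bexI[of _ "s * _"])
    ultimately have "dilation_mean h s = integral {s..2 * s} h / s"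
      unfolding dilation_mean_def using that by (simp add: integral_unique)
    moreover have "H s + integral {s..2 * s} h = H (2 * s)"
      unfolding H_def using that by (intro Henstock_Kurzweil_Integration.integral_combine h_int) auto
    ultimately show ?thesis by (simp add: field_simps)
  qed
  have H: "continuous_on {0..2 * (r + 1)} H"
    unfolding H_def by (intro indefinite_integral_continuous_1 h_int) simp
  have "continuous_on {0<..<r + 1} (\<lambda>s. (H (2 * s) - H s) / s)"
    by (intro continuous_intros continuous_on_compose2[OF H]) auto
  then have "continuous_on {0<..<r + 1} (dilation_mean h)"
    by (rule continuous_on_eq) (simp add: mean_eq)
  then show ?thesis using \<open>0 < r\<close> by (simp add: continuous_on_eq_continuous_at)
qed

lemma Kinf_majorant:
  assumes mono: "mono_on {0..} h" and "h 0 = 0" and lim: "(h \<longlongrightarrow> 0) (at_right 0)"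
  obtains \<sigma> where "Kinf \<sigma>" "\<And>r. 0 \<le> r \<Longrightarrow> h r \<le> \<sigma> r"
proof -
  define \<sigma> where "\<sigma> r = r + dilation_mean h r" for r
  have mean_0: "dilation_mean h 0 = 0" using \<open>h 0 = 0\<close> by (simp add: dilation_mean_def)
  then have mean_nonneg: "0 \<le> dilation_mean h r" if "0 \<le> r" for r
    using dilation_mean_mono[OF mono order_refl that] by simp
  have "filterlim (\<lambda>r. 2 * r) (at_right 0) (at_right (0::real))"
    by (rule filterlim_times_pos[OF filterlim_ident]) auto
  then have lim_2: "((\<lambda>r. h (2 * r)) \<longlongrightarrow> 0) (at_right 0)"
    by (rule filterlim_compose[OF lim])
  have "(dilation_mean h \<longlongrightarrow> 0) (at_right 0)"
  proof (rule tendsto_sandwich[OF _ _ tendsto_const lim_2])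
    show "\<forall>\<^sub>F r in at_right 0. 0 \<le> dilation_mean h r"
      "\<forall>\<^sub>F r in at_right 0. dilation_mean h r \<le> h (2 * r)"
      using mean_nonneg dilation_mean_bounds(2)[OF mono] by (simp_all add: eventually_at_filter)
  qed
  then have cont_0: "continuous (at_right 0) (dilation_mean h)"
    by (simp add: continuous_within mean_0)
  have "continuous_on {0..} \<sigma>"
    unfolding \<sigma>_def continuous_on_eq_continuous_within
  proof (intro ballI continuous_add continuous_ident)
    fix r :: real assume "r \<in> {0..}"
    then consider "r = 0" | "0 < r" by force
    then show "continuous (at r within {0..}) (dilation_mean h)"
      using cont_0 isCont_dilation_mean[OF mono]
      by cases (auto simp: at_within_Ici_at_right intro: continuous_at_imp_continuous_at_within)
  qed
  moreover have "strict_mono_on {0..} \<sigma>"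
    by (auto simp: strict_mono_on_def \<sigma>_def intro!: add_less_le_mono dilation_mean_mono[OF mono])
  moreover have "\<forall>\<^sub>F r in at_top. r \<le> \<sigma> r"
    using eventually_ge_at_top[of 0] by eventually_elim (simp add: \<sigma>_def mean_nonneg)
  then have "filterlim \<sigma> at_top at_top"
    by (rule filterlim_at_top_mono[OF filterlim_ident])
  ultimately have "Kinf \<sigma>" by (simp add: Kinf_def \<sigma>_def mean_0)
  then show ?thesis
    using dilation_mean_bounds(1)[OF mono]
    by (intro that[of \<sigma>]) (auto simp: \<sigma>_def intro: add_increasing)
qed

lemma Kinf_comparison:
  fixes \<phi> \<psi> :: "'a \<Rightarrow> real"
  assumes nonneg: "\<And>x. 0 \<le> \<psi> x"
    and bdd: "\<And>r. bdd_above (\<phi> ` {x. \<psi> x \<le> r})"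
    and small: "\<And>e. e > 0 \<Longrightarrow> \<exists>\<delta>>0. \<forall>x. \<psi> x < \<delta> \<longrightarrow> \<phi> x \<le> e"
  obtains \<sigma> where "Kinf \<sigma>" "\<And>x. \<phi> x \<le> \<sigma> (\<psi> x)"
proof -
  define h where "h r = Sup (insert 0 (\<phi> ` {x. \<psi> x \<le> r}))" for r
  have bdd': "bdd_above (insert 0 (\<phi> ` {x. \<psi> x \<le> r}))" for r
    using bdd by simp
  have h_ge: "\<phi> x \<le> h (\<psi> x)" for x
    unfolding h_def by (intro cSup_upper bdd') auto
  have h_nonneg: "0 \<le> h r" for r
    unfolding h_def by (intro cSup_upper bdd') simp
  have h_le: "h r \<le> e" if "0 \<le> e" "\<And>x. \<psi> x \<le> r \<Longrightarrow> \<phi> x \<le> e" for r e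
    unfolding h_def using that by (intro cSup_least) auto
  have "mono_on {0..} h"
    unfolding h_def by (intro mono_onI cSup_subset_mono bdd') auto
  moreover have "h 0 \<le> 0"
  proof (rule h_le)
    fix x assume "\<psi> x \<le> 0"
    show "\<phi> x \<le> 0"
    proof (rule field_le_epsilon)
      fix e :: real assume "e > 0"
      then obtain \<delta> where "\<delta> > 0" "\<And>x. \<psi> x < \<delta> \<Longrightarrow> \<phi> x \<le> e" using small by blast
      then show "\<phi> x \<le> 0 + e" using \<open>\<psi> x \<le> 0\<close> by simp
    qed
  qed simp
  then have "h 0 = 0" using h_nonneg[of 0] by simp
  moreover have "(h \<longlongrightarrow> 0) (at_right 0)"
  proof (rule tendstoI)
    fix e :: real assume "e > 0"
    then obtain \<delta> where \<delta>: "\<delta> > 0" "\<And>x. \<psi> x < \<delta> \<Longrightarrow> \<phi> x \<le> e / 2"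
      using small[of "e / 2"] by auto
    have "dist (h r) 0 < e" if "0 < r" "r < \<delta>" for r
    proof -
      have "h r \<le> e / 2" using \<open>e > 0\<close> that by (intro h_le \<delta>) auto
      then show ?thesis using h_nonneg[of r] \<open>e > 0\<close> by (simp add: dist_real_def)
    qed
    then show "\<forall>\<^sub>F r in at_right 0. dist (h r) 0 < e"
      unfolding eventually_at_right_field using \<delta>(1) by blast
  qed
  ultimately obtain \<sigma> where "Kinf \<sigma>" "\<And>r. 0 \<le> r \<Longrightarrow> h r \<le> \<sigma> r"
    by (rule Kinf_majorant) blast
  then show ?thesis using h_ge nonneg by (meson order_trans that)
qed

lemma Kinf_upper_bound:
  fixes W :: "'a::euclidean_space \<Rightarrow> real"
  assumes cont: "continuous_on UNIV W" and "W 0 = 0"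
  obtains \<alpha> where "Kinf \<alpha>" "\<And>x. W x \<le> \<alpha> (norm x)"
proof (rule Kinf_comparison[of norm W])
  show "bdd_above (W ` {x. norm x \<le> r})" for r
  proof -
    have "compact (W ` cball 0 r)"
      by (intro compact_continuous_image continuous_on_subset[OF cont]) auto
    then show ?thesis by (auto simp: cball_def dest: compact_imp_bounded bounded_imp_bdd_above)
  qed
  fix e :: real assume "e > 0"
  have "isCont W 0" using cont by (simp add: continuous_on_eq_continuous_at)
  then obtain \<delta> where "\<delta> > 0" "\<And>x. norm x < \<delta> \<Longrightarrow> dist (W x) (W 0) < e"
    using \<open>e > 0\<close> unfolding continuous_at_eps_delta by (metis diff_zero dist_norm)
  then show "\<exists>\<delta>>0. \<forall>x. norm x < \<delta> \<longrightarrow> W x \<le> e"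
    by (force simp: \<open>W 0 = 0\<close> dist_real_def)
qed (use that in auto)

lemma Kinf_lower_bound:
  fixes W :: "'a::euclidean_space \<Rightarrow> real"
  assumes cont: "continuous_on UNIV W" and "W 0 = 0" and pos: "\<And>x. x \<noteq> 0 \<Longrightarrow> 0 < W x"
    and unbounded: "filterlim W at_top at_infinity"
  obtains \<sigma> where "Kinf \<sigma>" "\<And>x. norm x \<le> \<sigma> (W x)"
proof (rule Kinf_comparison[of W norm])
  show "0 \<le> W x" for x using pos[of x] \<open>W 0 = 0\<close> by (cases "x = 0") auto
  have outside: "\<exists>R. \<forall>x. W x \<le> r \<longrightarrow> norm x \<le> R" for r
    using unbounded unfolding filterlim_at_top_dense eventually_at_infinity by (meson linear not_le)
  show "bdd_above (norm ` {x. W x \<le> r})" for r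
    using outside[of r] by (auto simp: bdd_above_def)
  fix e :: real assume "e > 0"
  obtain R where R: "\<And>x. W x \<le> 1 \<Longrightarrow> norm x \<le> R" using outside by blast
  define K where "K = cball (0::'a) R - ball 0 e"
  have "compact K" unfolding K_def by (intro compact_diff) auto
  have "\<exists>m>0. \<forall>x\<in>K. m \<le> W x"
  proof (cases "K = {}")
    case False
    then obtain x where x: "x \<in> K" "\<And>y. y \<in> K \<Longrightarrow> W x \<le> W y"
      using continuous_attains_inf[OF \<open>compact K\<close> False continuous_on_subset[OF cont]] by blast
    then have "x \<noteq> 0" using \<open>e > 0\<close> by (auto simp: K_def)
    then show ?thesis using x pos by blast
  qed (auto intro: exI[of _ 1])
  then obtain m where m: "m > 0" "\<And>x. x \<in> K \<Longrightarrow> m \<le> W x" by blast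
  have "norm x \<le> e" if "W x < min m 1" for x
    using that R[of x] m(2)[of x] by (fastforce simp: K_def)
  then show "\<exists>\<delta>>0. \<forall>x. W x < \<delta> \<longrightarrow> norm x \<le> e"
    using m(1) by (intro exI[of _ "min m 1"]) auto
qed (use that in auto)

section \<open>Locally Lipschitz functions\<close>

lemma loc_lipschitz_on_iff_open:
  "loc_lipschitz_on S h \<longleftrightarrow> (\<forall>z\<in>S. \<exists>U L. open U \<and> z \<in> U \<and> L-lipschitz_on (U \<inter> S) h)"
proof
  assume h: "loc_lipschitz_on S h"
  show "\<forall>z\<in>S. \<exists>U L. open U \<and> z \<in> U \<and> L-lipschitz_on (U \<inter> S) h"
  proof
    fix z assume "z \<in> S"
    then obtain e L where "e > 0"
      and L: "\<And>p q. p \<in> ball z e \<inter> S \<Longrightarrow> q \<in> ball z e \<inter> S \<Longrightarrow> dist (h p) (h q) \<le> L * dist p q"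
      using h unfolding loc_lipschitz_on_def by meson
    have "(max L 0)-lipschitz_on (ball z e \<inter> S) h"
    proof (rule lipschitz_onI)
      fix p q assume "p \<in> ball z e \<inter> S" "q \<in> ball z e \<inter> S"
      then have "dist (h p) (h q) \<le> L * dist p q" by (rule L)
      also have "\<dots> \<le> max L 0 * dist p q" by (intro mult_right_mono) auto
      finally show "dist (h p) (h q) \<le> max L 0 * dist p q" .
    qed simp
    then show "\<exists>U L. open U \<and> z \<in> U \<and> L-lipschitz_on (U \<inter> S) h"
      using \<open>e > 0\<close> by (meson centre_in_ball open_ball)
  qed
next
  assume h: "\<forall>z\<in>S. \<exists>U L. open U \<and> z \<in> U \<and> L-lipschitz_on (U \<inter> S) h"
  show "loc_lipschitz_on S h"
    unfolding loc_lipschitz_on_def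
  proof
    fix z assume "z \<in> S"
    then obtain U L where U: "open U" "z \<in> U" and L: "L-lipschitz_on (U \<inter> S) h" using h by blast
    obtain e where "e > 0" "ball z e \<subseteq> U" using U openE by blast
    then show "\<exists>e>0. \<exists>L. \<forall>p\<in>ball z e \<inter> S. \<forall>q\<in>ball z e \<inter> S. dist (h p) (h q) \<le> L * dist p q"
      using lipschitz_onD[OF L] by (intro exI[of _ e] conjI exI[of _ L]) auto
  qed
qed

lemma loc_lipschitz_on_continuous:
  assumes "loc_lipschitz_on S h"
  shows "continuous_on S h"
  unfolding continuous_on_eq_continuous_within
proof
  fix z assume "z \<in> S"
  then obtain U L where U: "open U" "z \<in> U" and L: "L-lipschitz_on (U \<inter> S) h"
    using assms by (auto simp: loc_lipschitz_on_iff_open)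
  have "continuous (at z within U \<inter> S) h"
    using lipschitz_on_continuous_within[OF L, of z] U \<open>z \<in> S\<close> by simp
  moreover have "at z within U \<inter> S = at z within S"
    using U by (intro at_within_nhd) auto
  ultimately show "continuous (at z within S) h" by simp
qed

lemma loc_lipschitz_on_imp_local_lipschitz:
  fixes f :: "'x::metric_space \<Rightarrow> 'u::metric_space \<Rightarrow> 'y::metric_space"
  assumes "loc_lipschitz_on UNIV (\<lambda>p. f (fst p) (snd p))"
  shows "local_lipschitz U X (\<lambda>v x. f x v)"
proof (rule local_lipschitzI)
  fix v x
  obtain N L where N: "open N" "(x, v) \<in> N" and L: "L-lipschitz_on N (\<lambda>p. f (fst p) (snd p))"
    using assms unfolding loc_lipschitz_on_iff_open by (metis Int_UNIV_right UNIV_I)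
  obtain A B where AB: "open A" "open B" "x \<in> A" "v \<in> B" "A \<times> B \<subseteq> N"
    by (rule open_prod_elim[OF N]) auto
  obtain e where e: "e > 0" "cball x e \<subseteq> A" "cball v e \<subseteq> B"
  proof -
    obtain e1 e2 where "e1 > 0" "cball x e1 \<subseteq> A" "e2 > 0" "cball v e2 \<subseteq> B"
      using AB by (meson open_contains_cball)
    then show ?thesis by (intro that[of "min e1 e2"]) auto
  qed
  have "L-lipschitz_on (cball x e \<inter> X) (\<lambda>x. f x w)" if "w \<in> cball v e \<inter> U" for w
  proof (rule lipschitz_onI[OF _ lipschitz_on_nonneg[OF L]])
    fix p q assume "p \<in> cball x e \<inter> X" "q \<in> cball x e \<inter> X"
    then have "(p, w) \<in> A \<times> B" "(q, w) \<in> A \<times> B" using that e by auto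
    then have "(p, w) \<in> N" "(q, w) \<in> N" using AB(5) by blast+
    from lipschitz_onD[OF L this] show "dist (f p w) (f q w) \<le> L * dist p q"
      by (simp add: dist_Pair_Pair)
  qed
  then show "\<exists>u>0. \<exists>L. \<forall>w\<in>cball v u \<inter> U. L-lipschitz_on (cball x u \<inter> X) (\<lambda>x. f x w)"
    using e(1) by blast
qed

lemma loc_lipschitz_on_compact_imp_lipschitz:
  fixes f :: "'x::metric_space \<Rightarrow> 'u::metric_space \<Rightarrow> 'y::metric_space"
  assumes f: "loc_lipschitz_on UNIV (\<lambda>p. f (fst p) (snd p))" and "compact X" "compact U"
  obtains L where "\<And>v. v \<in> U \<Longrightarrow> L-lipschitz_on X (\<lambda>x. f x v)"
proof -
  have "continuous_on U (\<lambda>v. f x v)" for x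
    using continuous_on_compose2[OF loc_lipschitz_on_continuous[OF f], of U "\<lambda>v. (x, v)"]
    by (simp add: continuous_on_Pair)
  then show ?thesis
    using local_lipschitz_compact_implies_lipschitz[where f = "\<lambda>v x. f x v",
        OF loc_lipschitz_on_imp_local_lipschitz[OF f] assms(2,3)] that by blast
qed

lemma lipschitz_on_Max_image:
  fixes v :: "'i \<Rightarrow> 'a::metric_space \<Rightarrow> real"
  assumes A: "finite A" "A \<noteq> {}" and lip: "\<And>i. i \<in> A \<Longrightarrow> L-lipschitz_on S (v i)"
  shows "L-lipschitz_on S (\<lambda>x. Max ((\<lambda>i. v i x) ` A))"
proof (rule lipschitz_onI)
  have one_sided: "Max ((\<lambda>i. v i p) ` A) - Max ((\<lambda>i. v i q) ` A) \<le> L * dist p q"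
    if "p \<in> S" "q \<in> S" for p q
  proof -
    obtain i where i: "i \<in> A" "Max ((\<lambda>i. v i p) ` A) = v i p" using obtains_MAX[OF A] by metis
    have "v i q \<le> Max ((\<lambda>i. v i q) ` A)" using A i by (intro Max_ge) auto
    then show ?thesis
      using lipschitz_onD[OF lip[OF i(1)] that] i(2) by (simp add: dist_real_def abs_le_iff)
  qed
  show "dist (Max ((\<lambda>i. v i p) ` A)) (Max ((\<lambda>i. v i q) ` A)) \<le> L * dist p q"
    if "p \<in> S" "q \<in> S" for p q
    using one_sided[OF that] one_sided[OF that(2,1)] by (simp add: dist_real_def dist_commute abs_le_iff)
  show "L \<ge> 0" using A lip lipschitz_on_nonneg by blast
qed

lemma lipschitz_near_Max_image:
  fixes v :: "'i \<Rightarrow> 'a::metric_space \<Rightarrow> real"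
  assumes A: "finite A" "A \<noteq> {}" and cont: "\<And>i. i \<in> A \<Longrightarrow> isCont (v i) z"
    and lip: "\<And>i. i \<in> A \<Longrightarrow> v i z = Max ((\<lambda>i. v i z) ` A) \<Longrightarrow>
      \<exists>U L. open U \<and> z \<in> U \<and> L-lipschitz_on U (v i)"
  shows "\<exists>U L. open U \<and> z \<in> U \<and> L-lipschitz_on U (\<lambda>x. Max ((\<lambda>i. v i x) ` A))"
proof -
  let ?I = "{i \<in> A. v i z = Max ((\<lambda>i. v i z) ` A)}"
  have I: "finite ?I" "?I \<noteq> {}"
    using A obtains_MAX[OF A] by (auto, metis)
  have "\<forall>i\<in>?I. \<exists>U L. open U \<and> z \<in> U \<and> L-lipschitz_on U (v i)"
    using lip by blast
  then obtain U L where UL: "\<And>i. i \<in> ?I \<Longrightarrow> open (U i) \<and> z \<in> U i \<and> (L i)-lipschitz_on (U i) (v i)"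
    by metis
  obtain U0 where U0: "open U0" "z \<in> U0"
    and active: "\<And>x. x \<in> U0 \<Longrightarrow> Max ((\<lambda>i. v i x) ` A) = Max ((\<lambda>i. v i x) ` ?I)"
    using eventually_Max_image_active[where v = v and z = z, OF A cont]
    unfolding eventually_nhds by blast
  have "(Max (L ` ?I))-lipschitz_on (U0 \<inter> (\<Inter>i\<in>?I. U i)) (v i)" if "i \<in> ?I" for i
    by (rule lipschitz_on_mono[of "L i" "U i"]) (use UL that I in auto)
  then have "(Max (L ` ?I))-lipschitz_on (U0 \<inter> (\<Inter>i\<in>?I. U i)) (\<lambda>x. Max ((\<lambda>i. v i x) ` ?I))"
    by (rule lipschitz_on_Max_image[OF I])
  then have "(Max (L ` ?I))-lipschitz_on (U0 \<inter> (\<Inter>i\<in>?I. U i)) (\<lambda>x. Max ((\<lambda>i. v i x) ` A))"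
    by (rule lipschitz_on_transform) (simp add: active)
  moreover have "open (U0 \<inter> (\<Inter>i\<in>?I. U i))" "z \<in> U0 \<inter> (\<Inter>i\<in>?I. U i)"
    using U0 UL I by (auto intro!: open_INT)
  ultimately show ?thesis by blast
qed

section \<open>Caratheodory solutions\<close>

definition caratheodory_on ::
  "(real \<Rightarrow> 'a::euclidean_space \<Rightarrow> 'a) \<Rightarrow> (real \<Rightarrow> 'a) \<Rightarrow> real \<Rightarrow> real \<Rightarrow> bool" where
  "caratheodory_on F x a b \<longleftrightarrow>
    (\<forall>t\<in>{a..b}. ((\<lambda>\<tau>. F \<tau> (x \<tau>)) has_integral (x t - x a)) {a..t})"

lemma caratheodory_on_eq_integral:
  "caratheodory_on F x a b \<Longrightarrow> t \<in> {a..b} \<Longrightarrow> x t = x a + integral {a..t} (\<lambda>\<tau>. F \<tau> (x \<tau>))"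
  by (auto simp: caratheodory_on_def dest!: bspec integral_unique)

lemma caratheodory_on_integrable:
  "caratheodory_on F x a b \<Longrightarrow> a \<le> b \<Longrightarrow> (\<lambda>\<tau>. F \<tau> (x \<tau>)) integrable_on {a..b}"
  by (auto simp: caratheodory_on_def)

lemma integral_equation_imp_caratheodory_on:
  assumes int: "(\<lambda>\<tau>. F \<tau> (x \<tau>)) integrable_on {a..b}"
    and eq: "\<And>t. t \<in> {a..b} \<Longrightarrow> x t = x a + integral {a..t} (\<lambda>\<tau>. F \<tau> (x \<tau>))"
  shows "caratheodory_on F x a b"
  unfolding caratheodory_on_def
proof
  fix t assume t: "t \<in> {a..b}"
  then have "(\<lambda>\<tau>. F \<tau> (x \<tau>)) integrable_on {a..t}"
    by (auto intro: integrable_subinterval_real[OF int])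
  then show "((\<lambda>\<tau>. F \<tau> (x \<tau>)) has_integral x t - x a) {a..t}"
    using eq[OF t] by (simp add: has_integral_iff)
qed

lemma caratheodory_on_continuous:
  assumes "caratheodory_on F x a b"
  shows "continuous_on {a..b} x"
proof (cases "a \<le> b")
  case True
  then have "continuous_on {a..b} (\<lambda>t. x a + integral {a..t} (\<lambda>\<tau>. F \<tau> (x \<tau>)))"
    using assms
    by (intro continuous_intros indefinite_integral_continuous_1 caratheodory_on_integrable)
  then show ?thesis
    by (rule continuous_on_eq) (rule caratheodory_on_eq_integral[OF assms, symmetric])
qed auto

lemma caratheodory_on_subinterval:
  assumes x: "caratheodory_on F x a b" and sub: "a \<le> a'" "b' \<le> b"
  shows "caratheodory_on F x a' b'"
  unfolding caratheodory_on_def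
proof
  fix t assume t: "t \<in> {a'..b'}"
  let ?F = "\<lambda>\<tau>. F \<tau> (x \<tau>)"
  have "?F integrable_on {a..t}"
    using x t sub by (auto simp: caratheodory_on_def)
  then have "?F integrable_on {a'..t}" "integral {a..a'} ?F + integral {a'..t} ?F = integral {a..t} ?F"
    using t sub
    by (auto intro: integrable_subinterval_real Henstock_Kurzweil_Integration.integral_combine)
  then show "(?F has_integral (x t - x a')) {a'..t}"
    using caratheodory_on_eq_integral[OF x, of t] caratheodory_on_eq_integral[OF x, of a'] t sub
    by (simp add: has_integral_iff algebra_simps)
qed

lemma caratheodory_on_cong:
  assumes x: "caratheodory_on F x a b" and eq: "\<And>t. t \<in> {a..b} \<Longrightarrow> x t = y t"
    "\<And>t. t \<in> {a..<b} \<Longrightarrow> F t (x t) = F' t (y t)"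
  shows "caratheodory_on F' y a b"
  unfolding caratheodory_on_def
proof
  fix t assume t: "t \<in> {a..b}"
  have "((\<lambda>\<tau>. F \<tau> (x \<tau>)) has_integral (y t - y a)) {a..t}"
    using bspec[OF x[unfolded caratheodory_on_def] t] t eq(1)[of a] eq(1)[OF t] by simp
  then show "((\<lambda>\<tau>. F' \<tau> (y \<tau>)) has_integral (y t - y a)) {a..t}"
    by (rule has_integral_spike[of "{b}", rotated 2]) (use t eq(2) in auto)
qed

lemma caratheodory_on_has_right_derivative:
  assumes x: "caratheodory_on F x a b" and s: "a \<le> s" "s < b"
    and cont: "continuous (at_right s) (\<lambda>\<tau>. F \<tau> (x \<tau>))"
  shows "(x has_vector_derivative F s (x s)) (at_right s)"
proof -
  let ?F = "\<lambda>\<tau>. F \<tau> (x \<tau>)"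
  have x': "caratheodory_on F x s b" using s by (intro caratheodory_on_subinterval[OF x]) auto
  have at: "at s within {s..b} = at_right s" using s by (intro at_within_Icc_at_right)
  have "((\<lambda>t. integral {s..t} ?F) has_vector_derivative ?F s) (at s within {s..b})"
    using integral_has_vector_derivative_continuous_at[of ?F s b s "{}"] s cont
    by (simp add: caratheodory_on_integrable[OF x'] at)
  then have "((\<lambda>t. x s + integral {s..t} ?F) has_vector_derivative ?F s) (at s within {s..b})"
    by (auto intro!: derivative_eq_intros)
  then have "(x has_vector_derivative ?F s) (at s within {s..b})"
    by (rule has_vector_derivative_transform[rotated 2])
       (use s in \<open>auto intro: caratheodory_on_eq_integral[OF x']\<close>)
  then show ?thesis by (simp add: at)
qed

lemma caratheodory_on_unique:
  assumes x: "caratheodory_on F x a b" and y: "caratheodory_on F y a b" and "a \<le> b" "x a = y a"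
    and cont: "\<And>s. \<lbrakk>a \<le> s; s < b\<rbrakk> \<Longrightarrow> continuous (at_right s) (\<lambda>\<tau>. F \<tau> (x \<tau>))"
      "\<And>s. \<lbrakk>a \<le> s; s < b\<rbrakk> \<Longrightarrow> continuous (at_right s) (\<lambda>\<tau>. F \<tau> (y \<tau>))"
    and lip: "\<And>s. \<lbrakk>a \<le> s; s < b\<rbrakk> \<Longrightarrow> norm (F s (x s) - F s (y s)) \<le> L * norm (x s - y s)"
  shows "x b = y b"
proof -
  have "norm (x b - y b) \<le> exp (L * (b - a)) * norm (x a - y a)"
  proof (rule upper_dini_gronwall[OF \<open>a \<le> b\<close>])
    show "continuous_on {a..b} (\<lambda>t. norm (x t - y t))"
      by (intro continuous_intros caratheodory_on_continuous[OF x] caratheodory_on_continuous[OF y])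
    fix s assume s: "a \<le> s" "s < b"
    have "((\<lambda>t. x t - y t) has_vector_derivative F s (x s) - F s (y s)) (at_right s)"
      by (intro has_vector_derivative_diff caratheodory_on_has_right_derivative[OF x]
          caratheodory_on_has_right_derivative[OF y] cont s)
    then show "upper_dini_le (\<lambda>t. norm (x t - y t)) (L * norm (x s - y s)) s"
      by (rule upper_dini_le_mono[OF upper_dini_le_norm lip[OF s]])
  qed
  then show ?thesis using \<open>x a = y a\<close> by simp
qed

lemma norm_integral_diff_le_exp_weight:
  fixes F :: "real \<Rightarrow> 'a::euclidean_space \<Rightarrow> 'a"
  assumes "L > 0" "a \<le> t"
    and int: "(\<lambda>\<tau>. F \<tau> (x \<tau>)) integrable_on {a..t}" "(\<lambda>\<tau>. F \<tau> (y \<tau>)) integrable_on {a..t}"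
    and lip: "\<And>\<tau>. \<tau> \<in> {a..t} \<Longrightarrow> norm (F \<tau> (x \<tau>) - F \<tau> (y \<tau>)) \<le> L * norm (x \<tau> - y \<tau>)"
    and close: "\<And>\<tau>. \<tau> \<in> {a..t} \<Longrightarrow> norm (x \<tau> - y \<tau>) \<le> exp (2 * L * (\<tau> - a)) * M"
  shows "norm (integral {a..t} (\<lambda>\<tau>. F \<tau> (x \<tau>)) - integral {a..t} (\<lambda>\<tau>. F \<tau> (y \<tau>)))
    \<le> exp (2 * L * (t - a)) * M / 2"
proof -
  define E where "E \<tau> = exp (2 * L * (\<tau> - a))" for \<tau>
  have "0 \<le> M" using close[of a] \<open>a \<le> t\<close> order_trans[OF norm_ge_zero] by fastforce
  have E_int: "((\<lambda>\<tau>. L * (E \<tau> * M)) has_integral E t * M / 2 - E a * M / 2) {a..t}"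
  proof (rule fundamental_theorem_of_calculus[OF \<open>a \<le> t\<close>])
    show "((\<lambda>\<tau>. E \<tau> * M / 2) has_vector_derivative L * (E \<tau> * M)) (at \<tau> within {a..t})" for \<tau>
      unfolding E_def has_real_derivative_iff_has_vector_derivative[symmetric]
      by (auto intro!: derivative_eq_intros)
  qed
  have "norm (integral {a..t} (\<lambda>\<tau>. F \<tau> (x \<tau>)) - integral {a..t} (\<lambda>\<tau>. F \<tau> (y \<tau>)))
      = norm (integral {a..t} (\<lambda>\<tau>. F \<tau> (x \<tau>) - F \<tau> (y \<tau>)))"
    using int by (simp add: integral_diff)
  also have "\<dots> \<le> integral {a..t} (\<lambda>\<tau>. L * (E \<tau> * M))"
  proof (rule integral_norm_bound_integral)
    show "(\<lambda>\<tau>. F \<tau> (x \<tau>) - F \<tau> (y \<tau>)) integrable_on {a..t}" by (intro integrable_diff int)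
    show "(\<lambda>\<tau>. L * (E \<tau> * M)) integrable_on {a..t}" using E_int by blast
    fix \<tau> assume \<tau>: "\<tau> \<in> {a..t}"
    have "L * norm (x \<tau> - y \<tau>) \<le> L * (E \<tau> * M)"
      using close[OF \<tau>] \<open>L > 0\<close> by (simp add: E_def)
    with lip[OF \<tau>] show "norm (F \<tau> (x \<tau>) - F \<tau> (y \<tau>)) \<le> L * (E \<tau> * M)" by (rule order_trans)
  qed
  also have "\<dots> = E t * M / 2 - E a * M / 2" using E_int by (rule integral_unique)
  also have "\<dots> \<le> E t * M / 2" using \<open>0 \<le> M\<close> by (simp add: E_def)
  finally show ?thesis by (simp add: E_def)
qed

text \<open>The substitution \<open>x(t) = exp (2 L (t - a)) z(t)\<close> makes the Picard operator a contraction
  in the sup norm on the whole interval.\<close>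

definition weighted_picard ::
  "(real \<Rightarrow> 'a::euclidean_space \<Rightarrow> 'a) \<Rightarrow> real \<Rightarrow> real \<Rightarrow> 'a \<Rightarrow> (real \<Rightarrow> 'a) \<Rightarrow> real \<Rightarrow> 'a" where
  "weighted_picard F L a x0 z t =
    (x0 + integral {a..t} (\<lambda>\<tau>. F \<tau> (exp (2 * L * (\<tau> - a)) *\<^sub>R z \<tau>))) /\<^sub>R exp (2 * L * (t - a))"

lemma dist_weighted_picard_le:
  assumes "L > 0" "a \<le> t"
    and int: "(\<lambda>\<tau>. F \<tau> (exp (2 * L * (\<tau> - a)) *\<^sub>R z \<tau>)) integrable_on {a..t}"
      "(\<lambda>\<tau>. F \<tau> (exp (2 * L * (\<tau> - a)) *\<^sub>R w \<tau>)) integrable_on {a..t}"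
    and lip: "\<And>\<tau> x y. \<tau> \<in> {a..t} \<Longrightarrow> norm (F \<tau> x - F \<tau> y) \<le> L * norm (x - y)"
    and close: "\<And>\<tau>. dist (z \<tau>) (w \<tau>) \<le> M"
  shows "dist (weighted_picard F L a x0 z t) (weighted_picard F L a x0 w t) \<le> 1/2 * M"
proof -
  define E where "E t = exp (2 * L * (t - a))" for t
  have "E t > 0" by (simp add: E_def)
  define I where "I z = integral {a..t} (\<lambda>\<tau>. F \<tau> (E \<tau> *\<^sub>R z \<tau>))" for z
  have "norm (I z - I w) \<le> E t * M / 2"
    unfolding I_def E_def
  proof (rule norm_integral_diff_le_exp_weight[OF assms(1,2) int lip])
    show "norm (exp (2 * L * (\<tau> - a)) *\<^sub>R z \<tau> - exp (2 * L * (\<tau> - a)) *\<^sub>R w \<tau>)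
        \<le> exp (2 * L * (\<tau> - a)) * M" for \<tau>
      using close[of \<tau>] by (simp add: dist_norm scaleR_diff_right[symmetric])
  qed
  moreover have "dist (weighted_picard F L a x0 z t) (weighted_picard F L a x0 w t)
      = norm (I z - I w) / E t"
    using \<open>E t > 0\<close>
    by (simp add: weighted_picard_def I_def E_def dist_norm scaleR_diff_right[symmetric]
        divide_inverse_commute)
  ultimately show ?thesis
    using \<open>E t > 0\<close> by (simp add: pos_divide_le_eq ac_simps)
qed

lemma caratheodory_on_exists:
  fixes F :: "real \<Rightarrow> 'a::euclidean_space \<Rightarrow> 'a"
  assumes "a \<le> b"
    and int: "\<And>x. continuous_on {a..b} x \<Longrightarrow> (\<lambda>\<tau>. F \<tau> (x \<tau>)) integrable_on {a..b}"
    and lip: "\<And>t x y. t \<in> {a..b} \<Longrightarrow> norm (F t x - F t y) \<le> L * norm (x - y)"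
  obtains x where "x a = x0" "caratheodory_on F x a b"
proof -
  define l where "l = max L 1"
  have "l > 0" by (simp add: l_def)
  have lip': "norm (F t x - F t y) \<le> l * norm (x - y)" if "t \<in> {a..b}" for t x y
    using lip[OF that, of x y] mult_right_mono[of L l "norm (x - y)"] by (simp add: l_def)
  define unscale :: "(real \<Rightarrow>\<^sub>C 'a) \<Rightarrow> real \<Rightarrow> 'a"
    where "unscale z t = exp (2 * l * (t - a)) *\<^sub>R apply_bcontfun z t" for z t
  have F_int: "(\<lambda>\<tau>. F \<tau> (unscale z \<tau>)) integrable_on {a..b}" for z
    unfolding unscale_def by (intro int continuous_intros continuous_on_apply_bcontfun)
  have "continuous_on {a..b} (weighted_picard F l a x0 (apply_bcontfun z))" for z
    unfolding weighted_picard_def[abs_def]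
    by (intro continuous_intros indefinite_integral_continuous_1 F_int[unfolded unscale_def]) simp
  then have "\<exists>g::real \<Rightarrow>\<^sub>C 'a. \<forall>t. g t = weighted_picard F l a x0 (apply_bcontfun z) (clamp a b t)"
    for z
    unfolding box_real(2)[symmetric] by (rule continuous_on_cbox_bcontfunE) blast
  then obtain P :: "(real \<Rightarrow>\<^sub>C 'a) \<Rightarrow> (real \<Rightarrow>\<^sub>C 'a)"
    where P: "\<And>z t. P z t = weighted_picard F l a x0 (apply_bcontfun z) (clamp a b t)"
    by metis
  have "dist (P z) (P w) \<le> 1/2 * dist z w" for z w
  proof (rule dist_bound)
    fix t
    have t: "clamp a b t \<in> {a..b}"
      unfolding box_real(2)[symmetric] using \<open>a \<le> b\<close> by (intro clamp_in_interval) simp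
    then have "(\<lambda>\<tau>. F \<tau> (unscale z \<tau>)) integrable_on {a..clamp a b t}" for z
      by (auto intro: integrable_subinterval_real[OF F_int])
    then show "dist (P z t) (P w t) \<le> 1/2 * dist z w"
      unfolding P unscale_def using t
      by (intro dist_weighted_picard_le[OF \<open>l > 0\<close>]) (auto intro: lip' dist_bounded)
  qed
  then obtain z where z: "P z = z" using banach_fix_type[of "1/2" P] by auto
  have eq: "unscale z t = x0 + integral {a..t} (\<lambda>\<tau>. F \<tau> (unscale z \<tau>))" if "t \<in> {a..b}" for t
    using P[of z t] that by (simp add: z unscale_def weighted_picard_def)
  from eq[of a] have start: "unscale z a = x0" using \<open>a \<le> b\<close> by simp
  have "caratheodory_on F (unscale z) a b"
    using F_int eq unfolding start[symmetric] by (rule integral_equation_imp_caratheodory_on)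
  with start show ?thesis by (rule that)
qed

abbreviation driven :: "('x \<Rightarrow> 'u \<Rightarrow> 'y) \<Rightarrow> (real \<Rightarrow> 'u) \<Rightarrow> real \<Rightarrow> 'x \<Rightarrow> 'y" where
  "driven f u \<equiv> \<lambda>\<tau> y. f y (u \<tau>)"

lemma integrable_on_continuous_along_curve:
  fixes f :: "'x::euclidean_space \<Rightarrow> 'u::euclidean_space \<Rightarrow> 'y::euclidean_space"
  assumes x: "continuous_on {a..b} x"
    and u: "u \<in> borel_measurable (lebesgue_on {a..b})" "bounded (u ` {a..b})"
    and f: "continuous_on UNIV (\<lambda>p. f (fst p) (snd p))"
  shows "(\<lambda>\<tau>. f (x \<tau>) (u \<tau>)) integrable_on {a..b::real}"
proof -
  define K where "K = (x ` {a..b}) \<times> closure (u ` {a..b})"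
  have "compact K"
    unfolding K_def using x u(2) by (intro compact_Times compact_continuous_image) auto
  then have "bounded ((\<lambda>p. f (fst p) (snd p)) ` K)"
    by (intro compact_imp_bounded compact_continuous_image continuous_on_subset[OF f]) auto
  then obtain M where M: "\<And>p. p \<in> K \<Longrightarrow> norm (f (fst p) (snd p)) \<le> M"
    by (auto simp: bounded_iff)
  show ?thesis
  proof (rule measurable_bounded_by_integrable_imp_integrable)
    show "(\<lambda>\<tau>. f (x \<tau>) (u \<tau>)) \<in> borel_measurable (lebesgue_on {a..b})"
      using borel_measurable_continuous_Pair[OF continuous_imp_measurable_on_sets_lebesgue[OF x] u(1) f]
      by simp
    show "(\<lambda>_. M) integrable_on {a..b}" by (rule integrable_const_ivl)
    show "norm (f (x \<tau>) (u \<tau>)) \<le> M" if "\<tau> \<in> {a..b}" for \<tau>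
      using M[of "(x \<tau>, u \<tau>)"] that subsetD[OF closure_subset[of "u ` {a..b}"], of "u \<tau>"]
      by (auto simp: K_def)
  qed auto
qed

lemma continuous_at_right_along_curve:
  fixes f :: "'x::euclidean_space \<Rightarrow> 'u::euclidean_space \<Rightarrow> 'y::euclidean_space"
  assumes f: "continuous_on UNIV (\<lambda>p. f (fst p) (snd p))"
    and x: "caratheodory_on F x a b" "a \<le> s" "s < b" and u: "continuous (at_right s) u"
  shows "continuous (at_right s) (\<lambda>\<tau>. f (x \<tau>) (u \<tau>))"
proof -
  have "continuous_on {s..b} x"
    using x by (intro caratheodory_on_continuous[OF caratheodory_on_subinterval[OF x(1)]]) auto
  then have "(x \<longlongrightarrow> x s) (at_right s)"
    using x(3) by (rule continuous_on_Icc_at_rightD)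
  then have "((\<lambda>\<tau>. (x \<tau>, u \<tau>)) \<longlongrightarrow> (x s, u s)) (at_right s)"
    using u by (intro tendsto_Pair) (auto simp: continuous_within)
  moreover have "isCont (\<lambda>p. f (fst p) (snd p)) (x s, u s)"
    using f by (simp add: continuous_on_eq_continuous_at)
  ultimately show ?thesis
    using isCont_tendsto_compose[of "(x s, u s)" "\<lambda>p. f (fst p) (snd p)" "\<lambda>\<tau>. (x \<tau>, u \<tau>)"]
    by (simp add: continuous_within)
qed

section \<open>Impulse times\<close>

definition last_impulse :: "real \<Rightarrow> real set \<Rightarrow> real \<Rightarrow> real" where
  "last_impulse t0 T t = Max (insert t0 (T \<inter> {..t}))"

definition prev_impulse :: "real \<Rightarrow> real set \<Rightarrow> real \<Rightarrow> real" where
  "prev_impulse t0 T t = Max (insert t0 (T \<inter> {..<t}))"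

context
  fixes t0 :: real and T :: "real set"
  assumes T: "impulse_times t0 T"
begin

lemma impulse_times_finite: "finite (T \<inter> {..t})" "finite (T \<inter> {..<t})" "finite (T \<inter> {r<..t})"
proof -
  show "finite (T \<inter> {..t})" using T by (simp add: impulse_times_def)
  then show "finite (T \<inter> {..<t})" "finite (T \<inter> {r<..t})"
    by (auto elim!: finite_subset[rotated])
qed

lemma impulse_times_greater: "\<tau> \<in> T \<Longrightarrow> t0 < \<tau>"
  using T by (auto simp: impulse_times_def)

lemma last_impulse:
  assumes "t0 \<le> t"
  shows "t0 \<le> last_impulse t0 T t" "last_impulse t0 T t \<le> t"
    "last_impulse t0 T t = t0 \<or> last_impulse t0 T t \<in> T" "T \<inter> {last_impulse t0 T t<..t} = {}"
proof -
  have fin: "finite (insert t0 (T \<inter> {..t}))" using impulse_times_finite by simp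
  then have "last_impulse t0 T t \<in> insert t0 (T \<inter> {..t})"
    unfolding last_impulse_def by (intro Max_in) auto
  then show "last_impulse t0 T t \<le> t" "last_impulse t0 T t = t0 \<or> last_impulse t0 T t \<in> T"
    using assms by auto
  show "t0 \<le> last_impulse t0 T t" unfolding last_impulse_def using fin by (intro Max_ge) auto
  show "T \<inter> {last_impulse t0 T t<..t} = {}"
    using Max_ge[OF fin] unfolding last_impulse_def[symmetric] by force
qed

lemma last_impulse_eqI:
  assumes "r = t0 \<or> r \<in> T" "r \<le> t" "T \<inter> {r<..t} = {}"
  shows "last_impulse t0 T t = r"
  unfolding last_impulse_def
proof (rule Max_eqI)
  fix s assume "s \<in> insert t0 (T \<inter> {..t})"
  then show "s \<le> r" using assms impulse_times_greater[of r] by (force simp: not_le[symmetric])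
qed (use assms impulse_times_finite in auto)

lemma prev_impulse:
  assumes "t0 < t"
  shows "t0 \<le> prev_impulse t0 T t" "prev_impulse t0 T t < t"
    "prev_impulse t0 T t = t0 \<or> prev_impulse t0 T t \<in> T" "T \<inter> {prev_impulse t0 T t<..<t} = {}"
proof -
  have fin: "finite (insert t0 (T \<inter> {..<t}))" using impulse_times_finite by simp
  then have "prev_impulse t0 T t \<in> insert t0 (T \<inter> {..<t})"
    unfolding prev_impulse_def by (intro Max_in) auto
  then show "prev_impulse t0 T t < t" "prev_impulse t0 T t = t0 \<or> prev_impulse t0 T t \<in> T"
    using assms by auto
  show "t0 \<le> prev_impulse t0 T t" unfolding prev_impulse_def using fin by (intro Max_ge) auto
  show "T \<inter> {prev_impulse t0 T t<..<t} = {}"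
    using Max_ge[OF fin] unfolding prev_impulse_def[symmetric] by force
qed

lemma card_impulses_less:
  assumes "s < t" "t \<in> T"
  shows "card (T \<inter> {..s}) < card (T \<inter> {..t})"
proof (rule psubset_card_mono[OF impulse_times_finite(1)])
  have "t \<in> T \<inter> {..t}" "t \<notin> T \<inter> {..s}" "T \<inter> {..s} \<subseteq> T \<inter> {..t}" using assms by auto
  then show "T \<inter> {..s} \<subset> T \<inter> {..t}" by blast
qed

lemma Ncount_add:
  assumes "r \<le> s" "s \<le> t"
  shows "Ncount T t r = Ncount T t s + Ncount T s r"
proof -
  have "T \<inter> {r<..t} = (T \<inter> {s<..t}) \<union> (T \<inter> {r<..s})" using assms by auto
  then show ?thesis
    unfolding Ncount_def using impulse_times_finite by (simp, subst card_Un_disjoint) auto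
qed

end

lemma impulse_times_induct [consumes 2, case_names start flow jump]:
  assumes T: "impulse_times t0 T" and "t0 \<le> t" and start: "P t0"
    and flow: "\<And>a t. \<lbrakk>t0 \<le> a; a \<le> t; T \<inter> {a<..t} = {}; P a\<rbrakk> \<Longrightarrow> P t"
    and jump: "\<And>\<tau>. \<lbrakk>\<tau> \<in> T; \<And>s. t0 \<le> s \<Longrightarrow> s < \<tau> \<Longrightarrow> P s\<rbrakk> \<Longrightarrow> P \<tau>"
  shows "P t"
  using \<open>t0 \<le> t\<close>
proof (induction "card (T \<inter> {..t})" arbitrary: t rule: less_induct)
  case less
  note r = last_impulse[OF T \<open>t0 \<le> t\<close>]
  have "P (last_impulse t0 T t)"
  proof (cases "last_impulse t0 T t \<in> T")
    case True
    have "card (T \<inter> {..s}) < card (T \<inter> {..t})" if "s < last_impulse t0 T t" for s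
      using card_impulses_less[OF T that True] card_mono[of "T \<inter> {..t}" "T \<inter> {..last_impulse t0 T t}"]
        impulse_times_finite[OF T] r(2) by force
    then show ?thesis by (intro jump[OF True] less.hyps)
  next
    case False
    then show ?thesis using r(3) start by simp
  qed
  then show ?case using r by (intro flow[of "last_impulse t0 T t" t])
qed

definition impulse_weight :: "real \<Rightarrow> real \<Rightarrow> real \<Rightarrow> real set \<Rightarrow> real \<Rightarrow> real" where
  "impulse_weight c d t0 T t = exp (c * (t - t0) + d * real (Ncount T t t0))"

lemma impulse_weight_pos: "impulse_weight c d t0 T t > 0"
  by (simp add: impulse_weight_def)

lemma impulse_weight_start: "impulse_weight c d t0 T t0 = 1"
  by (simp add: impulse_weight_def Ncount_def)

lemma impulse_weight_eq:
  assumes "impulse_times t0 T" "t0 \<le> s" "s \<le> t"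
  shows "impulse_weight c d t0 T t
    = impulse_weight c d t0 T s * exp (c * (t - s) + d * real (Ncount T t s))"
  unfolding impulse_weight_def Ncount_add[OF assms] by (simp add: exp_add[symmetric] algebra_simps)

lemma impulse_weight_flow:
  assumes "impulse_times t0 T" "t0 \<le> s" "s \<le> t" "T \<inter> {s<..t} = {}"
  shows "impulse_weight c d t0 T t = impulse_weight c d t0 T s * exp (c * (t - s))"
  using assms(4) by (simp add: impulse_weight_eq[OF assms(1-3)] Ncount_def)

lemma impulse_weight_jump:
  assumes "impulse_times t0 T" "t0 \<le> s" "s < \<tau>" "\<tau> \<in> T" "T \<inter> {s<..<\<tau>} = {}"
  shows "impulse_weight c d t0 T \<tau> = impulse_weight c d t0 T s * exp (c * (\<tau> - s)) * exp d"
proof -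
  have "T \<inter> {s<..\<tau>} = {\<tau>}" using assms(3-5) by force
  then show ?thesis
    using assms(3) by (simp add: impulse_weight_eq[OF assms(1,2), of \<tau>] Ncount_def exp_add)
qed

lemma seq_class_impulse_weight_le:
  assumes "T \<in> seq_class t0 c d \<mu> lam" "t0 \<le> s" "s \<le> t"
  shows "impulse_weight c d t0 T s \<le> exp (\<mu> - lam * (t - s)) * impulse_weight c d t0 T t"
proof -
  have "0 \<le> \<mu> - lam * (t - s) + (c * (t - s) + d * real (Ncount T t s))"
    using assms by (force simp: seq_class_def algebra_simps)
  then have "1 \<le> exp (\<mu> - lam * (t - s)) * exp (c * (t - s) + d * real (Ncount T t s))"
    by (simp add: exp_add[symmetric])
  then have "impulse_weight c d t0 T s * 1 \<le> impulse_weight c d t0 T s *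
      (exp (\<mu> - lam * (t - s)) * exp (c * (t - s) + d * real (Ncount T t s)))"
    using impulse_weight_pos by (intro mult_left_mono) (auto intro: less_imp_le)
  moreover have "impulse_times t0 T" using assms(1) by (simp add: seq_class_def)
  ultimately show ?thesis
    using assms(2,3) by (simp add: impulse_weight_eq[of t0 T s t] ac_simps)
qed

section \<open>Decay of a Lyapunov function along solutions\<close>

definition ae_dissipative ::
  "('x::euclidean_space \<Rightarrow> 'u::euclidean_space \<Rightarrow> 'x) \<Rightarrow> ('x \<Rightarrow> real) \<Rightarrow> (real \<Rightarrow> real) \<Rightarrow> real \<Rightarrow> bool"
where
  "ae_dissipative f W \<gamma> c \<longleftrightarrow> (\<exists>Z\<in>null_sets lebesgue. \<forall>x. x \<notin> Z \<longrightarrow>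
    (\<exists>D. (W has_derivative D) (at x) \<and> (\<forall>u. W x \<ge> \<gamma> (norm u) \<longrightarrow> D (f x u) \<le> - c * W x)))"

locale flow_lyapunov =
  fixes f :: "'x::euclidean_space \<Rightarrow> 'u::euclidean_space \<Rightarrow> 'x"
    and W :: "'x \<Rightarrow> real" and \<gamma> :: "real \<Rightarrow> real" and c :: real
  assumes f_lip: "loc_lipschitz_on UNIV (\<lambda>p. f (fst p) (snd p))"
    and W_cont: "continuous_on UNIV W"
    and W_lip: "loc_lipschitz_on (UNIV - {0}) W"
    and W_0: "W 0 = 0" and W_pos: "x \<noteq> 0 \<Longrightarrow> W x > 0"
    and W_unbounded: "filterlim W at_top at_infinity"
    and gain: "Kinf \<gamma>"
    and dissipative: "ae_dissipative f W \<gamma> c"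
begin

lemma f_cont: "continuous_on UNIV (\<lambda>p. f (fst p) (snd p))"
  by (rule loc_lipschitz_on_continuous[OF f_lip])

lemma W_nonneg: "W x \<ge> 0"
  using W_0 W_pos[of x] by (cases "x = 0") auto

lemma tendsto_W: "(x \<longlongrightarrow> l) F \<Longrightarrow> ((\<lambda>t. W (x t)) \<longlongrightarrow> W l) F"
  using W_cont by (auto simp: continuous_on_eq_continuous_at intro: isCont_tendsto_compose)

lemma W_lipschitz_near:
  assumes "p \<noteq> 0"
  obtains U L where "open U" "p \<in> U" "L-lipschitz_on U W"
proof -
  obtain U L where U: "open U" "p \<in> U" and L: "L-lipschitz_on (U - {0}) W"
    using W_lip assms unfolding loc_lipschitz_on_iff_open
    by (metis DiffI Int_Diff Int_UNIV_right UNIV_I singletonD)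
  show ?thesis using U assms by (intro that[OF _ _ L]) (auto simp: open_delete)
qed

lemma W_flow_derivative_near:
  assumes large: "\<gamma> (norm v) < W p"
  obtains Z where "negligible Z" "\<And>e. e > 0 \<Longrightarrow>
    \<forall>\<^sub>F q in nhds p. q \<notin> Z \<longrightarrow> (\<exists>D. (W has_derivative D) (at q) \<and> D (f p v) \<le> - c * W p + e)"
proof -
  obtain Z where Z: "negligible Z" and der: "\<And>q. q \<notin> Z \<Longrightarrow> \<exists>D. (W has_derivative D) (at q) \<and>
      (\<forall>u. W q \<ge> \<gamma> (norm u) \<longrightarrow> D (f q u) \<le> - c * W q)"
    using dissipative by (auto simp: ae_dissipative_def negligible_iff_null_sets)
  have "p \<noteq> 0" using large W_0 Kinf_nonneg[OF gain, of "norm v"] by auto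
  then obtain U L where U: "open U" "p \<in> U" and L: "L-lipschitz_on U W" by (rule W_lipschitz_near)
  have W_near: "((\<lambda>q. W q) \<longlongrightarrow> W p) (nhds p)"
    by (intro tendsto_W filterlim_ident)
  have "isCont (\<lambda>p. f (fst p) (snd p)) (p, v)"
    using f_cont by (simp add: continuous_on_eq_continuous_at)
  then have f_near: "((\<lambda>q. f q v) \<longlongrightarrow> f p v) (nhds p)"
    using isCont_tendsto_compose[of "(p, v)" "\<lambda>p. f (fst p) (snd p)" "\<lambda>q. (q, v)" "nhds p"]
    by (simp add: tendsto_Pair filterlim_ident)
  have "\<forall>\<^sub>F q in nhds p. q \<notin> Z \<longrightarrow> (\<exists>D. (W has_derivative D) (at q) \<and> D (f p v) \<le> - c * W p + e)"
    if "e > 0" for e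
  proof -
    have "((\<lambda>q. - c * W q + L * norm (f p v - f q v))
        \<longlongrightarrow> - c * W p + L * norm (f p v - f p v)) (nhds p)"
      by (intro tendsto_intros W_near f_near)
    then have "\<forall>\<^sub>F q in nhds p. - c * W q + L * norm (f p v - f q v) < - c * W p + e"
      using \<open>e > 0\<close> by (intro order_tendstoD(2)) auto
    with order_tendstoD(1)[OF W_near large] eventually_nhds_in_open[OF U]
    show ?thesis
    proof eventually_elim
      case (elim q)
      have "\<exists>D. (W has_derivative D) (at q) \<and> D (f p v) \<le> - c * W p + e" if "q \<notin> Z"
      proof -
        obtain D where D: "(W has_derivative D) (at q)" "D (f q v) \<le> - c * W q"
          using der[OF \<open>q \<notin> Z\<close>] elim(1) by (meson less_imp_le)
        have "D (f p v) = D (f q v) + D (f p v - f q v)"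
          using linear_diff[OF has_derivative_linear[OF D(1)], of "f p v" "f q v"] by simp
        also have "\<dots> \<le> - c * W q + L * norm (f p v - f q v)"
          using lipschitz_on_imp_norm_derivative_le[OF L U(1) elim(2) D(1), of "f p v - f q v"] D(2)
          by auto
        finally show ?thesis using D(1) elim(3) by force
      qed
      then show ?case by blast
    qed
  qed
  with Z show ?thesis by (rule that)
qed

lemma upper_dini_W_le:
  assumes x: "(x has_vector_derivative f (x s) v) (at_right s)" and large: "\<gamma> (norm v) < W (x s)"
  shows "upper_dini_le (\<lambda>t. W (x t)) (- c * W (x s)) s"
proof -
  have "x s \<noteq> 0" using large W_0 Kinf_nonneg[OF gain, of "norm v"] by auto
  then obtain U L where U: "open U" "x s \<in> U" and L: "L-lipschitz_on U W" by (rule W_lipschitz_near)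
  obtain Z where "negligible Z" "\<And>e. e > 0 \<Longrightarrow> \<forall>\<^sub>F q in nhds (x s). q \<notin> Z \<longrightarrow>
      (\<exists>D. (W has_derivative D) (at q) \<and> D (f (x s) v) \<le> - c * W (x s) + e)"
    using W_flow_derivative_near[OF large] by blast
  then have "upper_dini_le (\<lambda>t. W (x s + (t - s) *\<^sub>R f (x s) v)) (- c * W (x s)) s"
    by (rule upper_dini_le_line[OF L U])
  then show ?thesis by (rule upper_dini_le_tangent[OF x L U])
qed

lemma flow_barrier:
  assumes "a \<le> b" and x: "caratheodory_on (driven f u) x a b"
    and u: "\<And>s. a \<le> s \<Longrightarrow> s < b \<Longrightarrow> continuous (at_right s) u"
    and R: "\<And>s. a \<le> s \<Longrightarrow> s < b \<Longrightarrow> \<gamma> (norm (u s)) \<le> R"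
    and M: "W (x a) \<le> M" "\<And>s. a \<le> s \<Longrightarrow> s < b \<Longrightarrow> exp (c * (s - a)) * R \<le> M"
  shows "exp (c * (b - a)) * W (x b) \<le> M"
proof (rule upper_dini_barrier[OF \<open>a \<le> b\<close>])
  show "continuous_on {a..b} (\<lambda>s. exp (c * (s - a)) * W (x s))"
    by (intro continuous_intros continuous_on_compose2[OF W_cont] caratheodory_on_continuous[OF x]) simp
  show "exp (c * (a - a)) * W (x a) \<le> M" using M(1) by simp
  fix s assume s: "a \<le> s" "s < b" and above: "M < exp (c * (s - a)) * W (x s)"
  have "exp (c * (s - a)) * R < exp (c * (s - a)) * W (x s)"
    using M(2)[OF s] above by linarith
  then have "\<gamma> (norm (u s)) < W (x s)"
    using R[OF s] by simp
  moreover have "(x has_vector_derivative f (x s) (u s)) (at_right s)"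
    using continuous_at_right_along_curve[OF f_cont x s u[OF s]]
    by (rule caratheodory_on_has_right_derivative[OF x s])
  ultimately have dini: "upper_dini_le (\<lambda>t. W (x t)) (- c * W (x s)) s"
    by (intro upper_dini_W_le)
  have "((\<lambda>t. exp (c * (t - a))) has_real_derivative c * exp (c * (s - a))) (at_right s)"
    by (auto intro!: derivative_eq_intros)
  from upper_dini_le_mult[OF dini this]
  show "upper_dini_le (\<lambda>t. exp (c * (t - a)) * W (x t)) 0 s" by (simp add: algebra_simps)
qed

lemma flow_growth:
  assumes "a \<le> b" and x: "caratheodory_on (driven f u) x a b"
    and u: "\<And>s. a \<le> s \<Longrightarrow> s < b \<Longrightarrow> continuous (at_right s) u"
    and R: "\<And>s. a \<le> s \<Longrightarrow> s < b \<Longrightarrow> \<gamma> (norm (u s)) \<le> R"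
  shows "W (x b) \<le> exp (2 * \<bar>c\<bar> * (b - a)) * max (W (x a)) R"
proof -
  let ?m = "max (W (x a)) R"
  have m: "0 \<le> ?m" using W_nonneg[of "x a"] by simp
  have exp_le: "exp (k * (s - a)) \<le> exp (\<bar>c\<bar> * (b - a))" if "k \<le> \<bar>c\<bar>" "a \<le> s" "s \<le> b" for k s
  proof -
    have "k * (s - a) \<le> \<bar>c\<bar> * (b - a)" using that by (intro mult_mono) auto
    then show ?thesis by simp
  qed
  have "exp (c * (b - a)) * W (x b) \<le> exp (\<bar>c\<bar> * (b - a)) * ?m"
  proof (rule flow_barrier[OF \<open>a \<le> b\<close> x u R])
    have "1 * W (x a) \<le> exp (\<bar>c\<bar> * (b - a)) * ?m"
      using \<open>a \<le> b\<close> m W_nonneg by (intro mult_mono) auto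
    then show "W (x a) \<le> exp (\<bar>c\<bar> * (b - a)) * ?m" by simp
    show "exp (c * (s - a)) * R \<le> exp (\<bar>c\<bar> * (b - a)) * ?m" if "a \<le> s" "s < b" for s
    proof -
      have "exp (c * (s - a)) * R \<le> exp (c * (s - a)) * ?m" by simp
      also have "\<dots> \<le> exp (\<bar>c\<bar> * (b - a)) * ?m"
        using that m by (intro mult_right_mono exp_le) auto
      finally show ?thesis .
    qed
  qed
  from mult_mono[OF exp_le[of "- c" b] this]
  have "exp (- c * (b - a)) * (exp (c * (b - a)) * W (x b))
      \<le> exp (\<bar>c\<bar> * (b - a)) * (exp (\<bar>c\<bar> * (b - a)) * ?m)"
    using \<open>a \<le> b\<close> W_nonneg by simp
  then show ?thesis
    by (simp add: mult.assoc[symmetric] exp_add[symmetric])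
qed

end

lemma is_solution_caratheodory_on:
  assumes "is_solution f g t0 T u x" "t0 \<le> a" "T \<inter> {a<..b} = {}"
  shows "caratheodory_on (driven f u) x a b"
  unfolding caratheodory_on_def
proof
  fix t assume t: "t \<in> {a..b}"
  then have "T \<inter> {a<..t} = {}" using assms(3) by auto
  then show "((\<lambda>\<tau>. f (x \<tau>) (u \<tau>)) has_integral x t - x a) {a..t}"
    using assms(1,2) t unfolding is_solution_def by auto
qed

locale impulsive_lyapunov = flow_lyapunov f W \<gamma> c
  for f g :: "'x::euclidean_space \<Rightarrow> 'u::euclidean_space \<Rightarrow> 'x"
    and W :: "'x \<Rightarrow> real" and \<gamma> :: "real \<Rightarrow> real" and c d :: real +
  assumes W_jump: "W (g x u) \<le> max (exp (- d) * W x) (\<gamma> (norm u))"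
begin

lemma weighted_flow_step:
  assumes T: "impulse_times t0 T" and u: "admissible_input t0 u" and x: "is_solution f g t0 T u x"
    and a: "t0 \<le> a" "a \<le> t" "T \<inter> {a<..t} = {}"
    and U: "\<And>s. s \<in> {a..t} \<Longrightarrow> norm (u s) \<le> U"
    and M: "impulse_weight c d t0 T a * W (x a) \<le> M"
      "\<And>s. s \<in> {a..t} \<Longrightarrow> impulse_weight c d t0 T s * \<gamma> U \<le> M"
  shows "impulse_weight c d t0 T t * W (x t) \<le> M"
proof -
  let ?\<rho> = "impulse_weight c d t0 T"
  have \<rho>: "?\<rho> s = ?\<rho> a * exp (c * (s - a))" if "s \<in> {a..t}" for s
    using that a(1,3) by (intro impulse_weight_flow[OF T]) auto
  have "exp (c * (t - a)) * W (x t) \<le> M / ?\<rho> a"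
  proof (rule flow_barrier[OF a(2) is_solution_caratheodory_on[OF x a(1,3)]])
    show "continuous (at_right s) u" if "a \<le> s" for s
      using u that a(1) by (simp add: admissible_input_def)
    show "\<gamma> (norm (u s)) \<le> \<gamma> U" if "a \<le> s" "s < t" for s
      using that by (intro Kinf_mono[OF gain] U) auto
    show "W (x a) \<le> M / ?\<rho> a"
      using M(1) by (simp add: pos_le_divide_eq[OF impulse_weight_pos] mult.commute)
    show "exp (c * (s - a)) * \<gamma> U \<le> M / ?\<rho> a" if "a \<le> s" "s < t" for s
      using M(2)[of s] \<rho>[of s] that by (simp add: pos_le_divide_eq[OF impulse_weight_pos] ac_simps)
  qed
  then show ?thesis
    using \<rho>[of t] a(2) by (simp add: pos_le_divide_eq[OF impulse_weight_pos] ac_simps)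
qed

lemma weighted_jump_step:
  assumes T: "impulse_times t0 T" and x: "is_solution f g t0 T u x" and \<tau>: "\<tau> \<in> T"
    and U: "\<And>s. t0 \<le> s \<Longrightarrow> s < \<tau> \<Longrightarrow> norm (u s) \<le> U"
    and M: "\<And>s. t0 \<le> s \<Longrightarrow> s < \<tau> \<Longrightarrow> impulse_weight c d t0 T s * W (x s) \<le> M"
      "impulse_weight c d t0 T \<tau> * \<gamma> U \<le> M"
  shows "impulse_weight c d t0 T \<tau> * W (x \<tau>) \<le> M"
proof -
  let ?\<rho> = "impulse_weight c d t0 T"
  define a where "a = prev_impulse t0 T \<tau>"
  have a: "t0 \<le> a" "a < \<tau>" "T \<inter> {a<..<\<tau>} = {}"
    unfolding a_def using prev_impulse[OF T impulse_times_greater[OF T \<tau>]] by auto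
  obtain xl ul where lim: "(x \<longlongrightarrow> xl) (at_left \<tau>)" "(u \<longlongrightarrow> ul) (at_left \<tau>)" "x \<tau> = g xl ul"
    using x \<tau> unfolding is_solution_def by blast
  have "norm ul \<le> U"
  proof (rule tendsto_upperbound[OF tendsto_norm[OF lim(2)]])
    show "\<forall>\<^sub>F s in at_left \<tau>. norm (u s) \<le> U"
      unfolding eventually_at_left_field using a by (intro exI[of _ a]) (auto intro: U)
  qed simp
  then have "\<gamma> (norm ul) \<le> \<gamma> U" by (intro Kinf_mono[OF gain]) auto
  have "?\<rho> a * exp (c * (\<tau> - a)) * W xl \<le> M"
  proof (rule tendsto_upperbound)
    show "((\<lambda>s. ?\<rho> a * exp (c * (s - a)) * W (x s)) \<longlongrightarrow> ?\<rho> a * exp (c * (\<tau> - a)) * W xl) (at_left \<tau>)"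
      by (intro tendsto_intros tendsto_W lim)
    have "?\<rho> a * exp (c * (s - a)) * W (x s) \<le> M" if "a < s" "s < \<tau>" for s
    proof -
      have "T \<inter> {a<..s} = {}" using a(3) that by auto
      then show ?thesis using M(1)[of s] impulse_weight_flow[OF T a(1), of s] that a(1) by simp
    qed
    then show "\<forall>\<^sub>F s in at_left \<tau>. ?\<rho> a * exp (c * (s - a)) * W (x s) \<le> M"
      unfolding eventually_at_left_field using a(2) by blast
  qed simp
  then have "?\<rho> \<tau> * (exp (- d) * W xl) \<le> M"
    unfolding impulse_weight_jump[OF T a(1,2) \<tau> a(3)] by (simp add: exp_minus field_simps)
  moreover have "W (x \<tau>) \<le> max (exp (- d) * W xl) (\<gamma> U)"
    using W_jump[of xl ul] \<open>\<gamma> (norm ul) \<le> \<gamma> U\<close> by (auto simp: lim(3))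
  then have "?\<rho> \<tau> * W (x \<tau>) \<le> ?\<rho> \<tau> * max (exp (- d) * W xl) (\<gamma> U)"
    using impulse_weight_pos by (intro mult_left_mono) (auto intro: less_imp_le)
  ultimately show ?thesis
    using M(2) by (auto simp: max_def split: if_splits)
qed

lemma solution_barrier:
  assumes T: "impulse_times t0 T" and u: "admissible_input t0 u" and x: "is_solution f g t0 T u x"
    and "t0 \<le> b" and U: "\<And>s. s \<in> {t0..b} \<Longrightarrow> norm (u s) \<le> U"
    and M: "W (x t0) \<le> M" "\<And>s. s \<in> {t0..b} \<Longrightarrow> impulse_weight c d t0 T s * \<gamma> U \<le> M"
  shows "impulse_weight c d t0 T b * W (x b) \<le> M"
proof -
  have "t \<le> b \<longrightarrow> impulse_weight c d t0 T t * W (x t) \<le> M" if "t0 \<le> t" for t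
    using T that
  proof (induction rule: impulse_times_induct)
    case start
    then show ?case using M(1) by (simp add: impulse_weight_start)
  next
    case (flow a t)
    show ?case
      by (intro impI weighted_flow_step[where U = U, OF T u x flow(1-3)]) (use flow U M(2) in auto)
  next
    case (jump \<tau>)
    show ?case
      by (intro impI weighted_jump_step[where U = U, OF T x jump(1)])
         (use jump U M(2) impulse_times_greater[OF T jump(1)] in auto)
  qed
  then show ?thesis using \<open>t0 \<le> b\<close> by simp
qed

lemma solution_bound:
  assumes T: "T \<in> seq_class t0 c d \<mu> lam" and "lam > 0"
    and u: "admissible_input t0 u" and x: "is_solution f g t0 T u x"
    and "t0 \<le> b" and U: "\<And>s. s \<in> {t0..b} \<Longrightarrow> norm (u s) \<le> U"
  shows "W (x b) \<le> max (exp (\<mu> - lam * (b - t0)) * W (x t0)) (exp \<mu> * \<gamma> U)"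
proof -
  let ?\<rho> = "impulse_weight c d t0 T"
  have "impulse_times t0 T" using T by (simp add: seq_class_def)
  have "0 \<le> U" using order_trans[OF norm_ge_zero U[of t0]] \<open>t0 \<le> b\<close> by simp
  then have "0 \<le> \<gamma> U" by (rule Kinf_nonneg[OF gain])
  have \<rho>_le: "?\<rho> s \<le> exp \<mu> * ?\<rho> b" if "s \<in> {t0..b}" for s
  proof -
    have "?\<rho> s \<le> exp (\<mu> - lam * (b - s)) * ?\<rho> b"
      using that by (intro seq_class_impulse_weight_le[OF T]) auto
    also have "\<dots> \<le> exp \<mu> * ?\<rho> b"
      using that \<open>lam > 0\<close> impulse_weight_pos[of c d t0 T b] by (intro mult_right_mono) auto
    finally show ?thesis .
  qed
  have start: "W (x t0) \<le> ?\<rho> b * (exp (\<mu> - lam * (b - t0)) * W (x t0))"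
    using mult_right_mono[OF seq_class_impulse_weight_le[OF T order_refl \<open>t0 \<le> b\<close>] W_nonneg[of "x t0"]]
    by (simp add: impulse_weight_start ac_simps)
  have "?\<rho> b * W (x b) \<le> max (W (x t0)) (?\<rho> b * (exp \<mu> * \<gamma> U))"
  proof (rule solution_barrier[OF \<open>impulse_times t0 T\<close> u x \<open>t0 \<le> b\<close> U])
    show "?\<rho> s * \<gamma> U \<le> max (W (x t0)) (?\<rho> b * (exp \<mu> * \<gamma> U))" if "s \<in> {t0..b}" for s
      using mult_right_mono[OF \<rho>_le[OF that] \<open>0 \<le> \<gamma> U\<close>] by (simp add: ac_simps max.coboundedI2)
  qed simp_all
  also have "\<dots> \<le> max (?\<rho> b * (exp (\<mu> - lam * (b - t0)) * W (x t0))) (?\<rho> b * (exp \<mu> * \<gamma> U))"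
    by (rule max.mono[OF start order_refl])
  also have "\<dots> = ?\<rho> b * max (exp (\<mu> - lam * (b - t0)) * W (x t0)) (exp \<mu> * \<gamma> U)"
    using impulse_weight_pos[of c d t0 T b] by (simp add: max_mult_distrib_left)
  finally show ?thesis using impulse_weight_pos by simp
qed

end

section \<open>Existence of global solutions\<close>

lemma admissible_input_norm_le:
  assumes "admissible_input t0 u"
  obtains U where "\<And>s. s \<in> {t0..b} \<Longrightarrow> norm (u s) \<le> U"
proof -
  have "bounded (u ` {t0..b})" using assms by (simp add: admissible_input_def)
  then obtain U where "\<forall>s\<in>{t0..b}. norm (u s) \<le> U" by (auto simp: bounded_iff)
  then show ?thesis using that by blast
qed

lemma admissible_input_bounded:
  assumes "admissible_input t0 u" "t0 \<le> a"
  shows "bounded (u ` {a..b})"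
proof (rule bounded_subset)
  show "bounded (u ` {t0..b})" using assms(1) by (simp add: admissible_input_def)
qed (use assms(2) in auto)

lemma admissible_input_measurable:
  assumes "admissible_input t0 u" "t0 \<le> a"
  shows "u \<in> borel_measurable (lebesgue_on {a..b})"
proof -
  have "(\<lambda>t. indicator {t0..} t *\<^sub>R u t) \<in> borel_measurable (lebesgue_on {a..b})"
    using assms(1) unfolding admissible_input_def set_borel_measurable_def
    by (intro measurable_restrict_space1) auto
  then show ?thesis
    by (rule measurable_cong[THEN iffD1, rotated]) (use assms(2) in auto)
qed

lemma admissible_input_continuous_at_right:
  "admissible_input t0 u \<Longrightarrow> t0 \<le> s \<Longrightarrow> continuous (at_right s) u"
  by (simp add: admissible_input_def)

lemma driven_flow_unique:
  fixes f :: "'x::euclidean_space \<Rightarrow> 'u::euclidean_space \<Rightarrow> 'x"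
  assumes f: "loc_lipschitz_on UNIV (\<lambda>p. f (fst p) (snd p))" and u: "admissible_input t0 u" "t0 \<le> a"
    and x: "caratheodory_on (driven f u) x a b" and y: "caratheodory_on (driven f u) y a b"
    and "a \<le> b" "x a = y a"
  shows "x b = y b"
proof -
  let ?X = "x ` {a..b} \<union> y ` {a..b}" and ?U = "closure (u ` {a..b})"
  have "compact ?X" "compact ?U"
    using admissible_input_bounded[OF u]
    by (auto intro!: compact_Un compact_continuous_image caratheodory_on_continuous[OF x]
        caratheodory_on_continuous[OF y])
  then obtain L where L: "\<And>v. v \<in> ?U \<Longrightarrow> L-lipschitz_on ?X (\<lambda>p. f p v)"
    by (rule loc_lipschitz_on_compact_imp_lipschitz[OF f]) blast
  show ?thesis
  proof (rule caratheodory_on_unique[OF x y \<open>a \<le> b\<close> \<open>x a = y a\<close>])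
    fix s assume s: "a \<le> s" "s < b"
    have "continuous (at_right s) u"
      using s u(2) by (intro admissible_input_continuous_at_right[OF u(1)]) simp
    note right_continuous =
      continuous_at_right_along_curve[OF loc_lipschitz_on_continuous[OF f] _ s this]
    show "continuous (at_right s) (\<lambda>\<tau>. f (x \<tau>) (u \<tau>))" by (rule right_continuous[OF x])
    show "continuous (at_right s) (\<lambda>\<tau>. f (y \<tau>) (u \<tau>))" by (rule right_continuous[OF y])
    have "u s \<in> ?U" using s by (intro subsetD[OF closure_subset]) auto
    then show "norm (f (x s) (u s) - f (y s) (u s)) \<le> L * norm (x s - y s)"
      using s by (intro lipschitz_on_normD[OF L]) auto
  qed
qed

lemma truncated_flow_exists:
  fixes f :: "'x::euclidean_space \<Rightarrow> 'u::euclidean_space \<Rightarrow> 'x"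
  assumes f: "loc_lipschitz_on UNIV (\<lambda>p. f (fst p) (snd p))" and u: "admissible_input t0 u" "t0 \<le> a"
    and "a \<le> b" "0 < r"
  obtains x where "x a = x0" "caratheodory_on (driven (\<lambda>y. f (closest_point (cball 0 r) y)) u) x a b"
proof -
  define pr :: "'x \<Rightarrow> 'x" where "pr = closest_point (cball 0 r)"
  have pr_in: "pr y \<in> cball 0 r" for y
    unfolding pr_def using \<open>0 < r\<close> by (intro closest_point_in_set) auto
  have pr_lip: "dist (pr y) (pr z) \<le> dist y z" for y z
    unfolding pr_def using \<open>0 < r\<close> by (intro closest_point_lipschitz) auto
  have pr_cont: "continuous_on S (\<lambda>s. pr (y s))" if "continuous_on S y" for S and y :: "real \<Rightarrow> 'x"
    using continuous_on_compose2[OF continuous_on_closest_point[of "cball 0 r" UNIV] that] \<open>0 < r\<close>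
    by (simp add: pr_def)
  note bounded_u = admissible_input_bounded[OF u, of b]
  have "compact (closure (u ` {a..b}))" using bounded_u by simp
  then obtain L where L: "\<And>v. v \<in> closure (u ` {a..b}) \<Longrightarrow> L-lipschitz_on (cball 0 r) (\<lambda>p. f p v)"
    by (rule loc_lipschitz_on_compact_imp_lipschitz[OF f compact_cball]) blast
  have "norm (f (pr y) (u t) - f (pr z) (u t)) \<le> L * norm (y - z)" if "t \<in> {a..b}" for t y z
  proof -
    have ut: "u t \<in> closure (u ` {a..b})" using that by (intro subsetD[OF closure_subset]) auto
    have "norm (f (pr y) (u t) - f (pr z) (u t)) \<le> L * dist (pr y) (pr z)"
      using lipschitz_onD[OF L[OF ut] pr_in[of y] pr_in[of z]] by (simp add: dist_norm)
    also have "\<dots> \<le> L * dist y z"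
      using lipschitz_on_nonneg[OF L[OF ut]] by (intro mult_left_mono pr_lip)
    finally show ?thesis by (simp add: dist_norm)
  qed
  moreover have "(\<lambda>\<tau>. f (pr (y \<tau>)) (u \<tau>)) integrable_on {a..b}" if "continuous_on {a..b} y" for y
    by (intro integrable_on_continuous_along_curve pr_cont that admissible_input_measurable[OF u]
        bounded_u loc_lipschitz_on_continuous[OF f])
  ultimately show ?thesis
    using caratheodory_on_exists[OF \<open>a \<le> b\<close>, of "\<lambda>\<tau> y. f (pr y) (u \<tau>)" L x0] that
    unfolding pr_def by blast
qed

lemma less_by_first_exit:
  fixes y :: "real \<Rightarrow> real"
  assumes cont: "continuous_on {a..b} y"
    and step: "\<And>\<tau>. \<lbrakk>\<tau> \<in> {a..b}; \<And>s. a \<le> s \<Longrightarrow> s < \<tau> \<Longrightarrow> y s < r\<rbrakk> \<Longrightarrow> y \<tau> < r"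
    and "t \<in> {a..b}"
  shows "y t < r"
proof (rule ccontr)
  assume "\<not> y t < r"
  define S where "S = {s \<in> {a..b}. r \<le> y s}"
  have "t \<in> S" using \<open>t \<in> {a..b}\<close> \<open>\<not> y t < r\<close> by (auto simp: S_def)
  have "closed S"
    unfolding S_def by (intro continuous_on_closed_Collect_le cont continuous_on_const) simp
  have bdd: "bdd_below S" by (auto simp: S_def)
  have "Inf S \<in> S" using \<open>t \<in> S\<close> by (intro closed_contains_Inf \<open>closed S\<close> bdd) auto
  moreover have "y s < r" if "a \<le> s" "s < Inf S" for s
  proof -
    have "s \<notin> S" using that cInf_lower[OF _ bdd, of s] by auto
    then show ?thesis using that \<open>Inf S \<in> S\<close> by (auto simp: S_def)
  qed
  ultimately show False using step[of "Inf S"] by (auto simp: S_def)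
qed

lemma caratheodory_on_untruncate:
  fixes x :: "real \<Rightarrow> 'a::euclidean_space"
  assumes "caratheodory_on (driven (\<lambda>y. f (closest_point (cball 0 r) y)) u) x a b"
    and "\<And>s. a \<le> s \<Longrightarrow> s < b \<Longrightarrow> norm (x s) < r"
  shows "caratheodory_on (driven f u) x a b"
  using assms(2)
  by (intro caratheodory_on_cong[OF assms(1)]) (simp_all add: closest_point_self less_imp_le)

context flow_lyapunov
begin

lemma truncated_flow_inside:
  assumes u: "admissible_input t0 u" "t0 \<le> a"
    and x: "caratheodory_on (driven (\<lambda>y. f (closest_point (cball 0 r) y)) u) x a b"
    and U: "\<And>s. s \<in> {a..b} \<Longrightarrow> norm (u s) \<le> U"
    and sublevel: "\<And>y. W y \<le> exp (2 * \<bar>c\<bar> * (b - a)) * max (W (x a)) (\<gamma> U) \<Longrightarrow> norm y < r"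
    and "t \<in> {a..b}"
  shows "norm (x t) < r"
proof (rule less_by_first_exit[OF continuous_on_norm _ \<open>t \<in> {a..b}\<close>])
  show "continuous_on {a..b} x" by (rule caratheodory_on_continuous[OF x])
  fix \<tau> assume \<tau>: "\<tau> \<in> {a..b}" and before: "\<And>s. a \<le> s \<Longrightarrow> s < \<tau> \<Longrightarrow> norm (x s) < r"
  let ?m = "max (W (x a)) (\<gamma> U)"
  have "W (x \<tau>) \<le> exp (2 * \<bar>c\<bar> * (\<tau> - a)) * ?m"
  proof (rule flow_growth)
    have "caratheodory_on (driven (\<lambda>y. f (closest_point (cball 0 r) y)) u) x a \<tau>"
      using \<tau> by (intro caratheodory_on_subinterval[OF x]) auto
    then show "caratheodory_on (driven f u) x a \<tau>"
      by (rule caratheodory_on_untruncate) (rule before)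
    show "continuous (at_right s) u" if "a \<le> s" for s
      using that u(2) by (intro admissible_input_continuous_at_right[OF u(1)]) simp
    show "\<gamma> (norm (u s)) \<le> \<gamma> U" if "a \<le> s" "s < \<tau>" for s
      using that \<tau> by (intro Kinf_mono[OF gain] U) auto
  qed (use \<tau> in simp)
  moreover have "2 * \<bar>c\<bar> * (\<tau> - a) \<le> 2 * \<bar>c\<bar> * (b - a)"
    using \<tau> by (intro mult_left_mono) auto
  then have "exp (2 * \<bar>c\<bar> * (\<tau> - a)) * ?m \<le> exp (2 * \<bar>c\<bar> * (b - a)) * ?m"
    using W_nonneg[of "x a"] by (intro mult_right_mono) auto
  ultimately show "norm (x \<tau>) < r" by (intro sublevel) (rule order_trans)
qed

text \<open>Precomposing \<open>f\<close> with the projection onto a large ball makes it globally Lipschitz in the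
  state; the Lyapunov bound shows that the solution never reaches the boundary of that ball.\<close>

lemma driven_flow_exists_interval:
  assumes u: "admissible_input t0 u" "t0 \<le> a" and "a \<le> b"
  obtains x where "x a = x0" "caratheodory_on (driven f u) x a b"
proof -
  obtain U where U: "\<And>s. s \<in> {t0..b} \<Longrightarrow> norm (u s) \<le> U"
    using admissible_input_norm_le[OF u(1)] by blast
  have "\<forall>\<^sub>F y in at_infinity. exp (2 * \<bar>c\<bar> * (b - a)) * max (W x0) (\<gamma> U) < W y"
    using W_unbounded by (simp add: filterlim_at_top_dense)
  then obtain R where R: "\<And>y. R \<le> norm y \<Longrightarrow> exp (2 * \<bar>c\<bar> * (b - a)) * max (W x0) (\<gamma> U) < W y"
    unfolding eventually_at_infinity by blast
  define r where "r = max R 1"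
  have sublevel: "norm y < r" if "W y \<le> exp (2 * \<bar>c\<bar> * (b - a)) * max (W x0) (\<gamma> U)" for y
    using R[of y] that by (cases "R \<le> norm y") (auto simp: r_def)
  have "0 < r" by (simp add: r_def)
  then obtain x where "x a = x0"
    and x: "caratheodory_on (driven (\<lambda>y. f (closest_point (cball 0 r) y)) u) x a b"
    using truncated_flow_exists[OF f_lip u \<open>a \<le> b\<close>] by blast
  have "norm (x t) < r" if "t \<in> {a..b}" for t
    using u(2) sublevel \<open>x a = x0\<close>
    by (intro truncated_flow_inside[OF u x _ _ that, of U] U) auto
  then have "caratheodory_on (driven f u) x a b"
    by (intro caratheodory_on_untruncate[where f = f, OF x]) simp
  with \<open>x a = x0\<close> show ?thesis by (rule that)
qed

lemma driven_flow_exists: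
  assumes u: "admissible_input t0 u" "t0 \<le> a"
  obtains x where "x a = x0" "\<And>b. caratheodory_on (driven f u) x a b"
proof -
  have "\<exists>x. x a = x0 \<and> caratheodory_on (driven f u) x a b" if "a \<le> b" for b
    using driven_flow_exists_interval[OF u that] by metis
  then obtain X where X: "\<And>b. a \<le> b \<Longrightarrow> X b a = x0"
    "\<And>b. a \<le> b \<Longrightarrow> caratheodory_on (driven f u) (X b) a b"
    by metis
  have consistent: "X b t = X t t" if t: "t \<in> {a..b}" for b t
  proof (rule driven_flow_unique[OF f_lip u, where x = "X b" and y = "X t"])
    show "caratheodory_on (driven f u) (X b) a t"
      using t by (intro caratheodory_on_subinterval[OF X(2)[of b]]) auto
  qed (use X t in auto)
  have "caratheodory_on (driven f u) (\<lambda>t. X t t) a b" for b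
  proof (cases "a \<le> b")
    case True
    show ?thesis
    proof (rule caratheodory_on_cong[OF X(2)[OF True] consistent])
      show "f (X b t) (u t) = f (X t t) (u t)" if "t \<in> {a..<b}" for t
        using consistent[of t b] that by simp
    qed
  qed (simp add: caratheodory_on_def)
  then show ?thesis using that[of "\<lambda>t. X t t"] X(1) by simp
qed

end

lemma impulse_recursion:
  assumes T: "impulse_times t0 T"
  obtains p where "p t0 = x0" "\<And>\<tau>. \<tau> \<in> T \<Longrightarrow> p \<tau> = h \<tau> (p (prev_impulse t0 T \<tau>))"
proof -
  define R where "R = {(prev_impulse t0 T \<tau>, \<tau>) | \<tau>. \<tau> \<in> T}"
  have "R \<subseteq> Wellfounded.measure (\<lambda>\<tau>. card (T \<inter> {..\<tau>}))"
    using prev_impulse(2)[OF T] impulse_times_greater[OF T] card_impulses_less[OF T]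
    by (auto simp: R_def)
  then have "wf R" by (rule wf_subset[OF wf_measure])
  define p where "p = wfrec R (\<lambda>q \<tau>. if \<tau> \<in> T then h \<tau> (q (prev_impulse t0 T \<tau>)) else x0)"
  have p: "p \<tau> = (if \<tau> \<in> T then h \<tau> (p (prev_impulse t0 T \<tau>)) else x0)" for \<tau>
    unfolding p_def by (subst wfrec[OF \<open>wf R\<close>]) (auto simp: cut_def R_def)
  have "t0 \<notin> T" using impulse_times_greater[OF T] by blast
  show ?thesis
  proof (rule that)
    show "p t0 = x0" using p[of t0] \<open>t0 \<notin> T\<close> by simp
    show "p \<tau> = h \<tau> (p (prev_impulse t0 T \<tau>))" if "\<tau> \<in> T" for \<tau>
      using p[of \<tau>] that by simp
  qed
qed

lemma concatenated_flows_solution: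
  assumes T: "impulse_times t0 T"
    and \<Phi>: "\<And>a p. t0 \<le> a \<Longrightarrow> \<Phi> a p a = p"
      "\<And>a p b. t0 \<le> a \<Longrightarrow> caratheodory_on (driven f u) (\<Phi> a p) a b"
    and ul: "\<And>\<tau>. \<tau> \<in> T \<Longrightarrow> (u \<longlongrightarrow> ul \<tau>) (at_left \<tau>)"
    and p: "\<And>\<tau>. \<tau> \<in> T \<Longrightarrow>
      p \<tau> = g (\<Phi> (prev_impulse t0 T \<tau>) (p (prev_impulse t0 T \<tau>)) \<tau>) (ul \<tau>)"
  shows "is_solution f g t0 T u (\<lambda>t. \<Phi> (last_impulse t0 T t) (p (last_impulse t0 T t)) t)"
    (is "is_solution f g t0 T u ?x")
  unfolding is_solution_def
proof (intro conjI allI impI ballI)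
  fix a t assume a: "t0 \<le> a" "a \<le> t" and no: "T \<inter> {a<..t} = {}"
  define \<theta> where "\<theta> = last_impulse t0 T a"
  have \<theta>: "t0 \<le> \<theta>" "\<theta> \<le> a" "\<theta> = t0 \<or> \<theta> \<in> T" "T \<inter> {\<theta><..a} = {}"
    unfolding \<theta>_def by (rule last_impulse[OF T a(1)])+
  have "last_impulse t0 T s = \<theta>" if "s \<in> {a..t}" for s
  proof (rule last_impulse_eqI[OF T \<theta>(3)])
    show "T \<inter> {\<theta><..s} = {}" using \<theta>(4) no that by (force simp: not_le[symmetric])
  qed (use \<theta> that in auto)
  then have "caratheodory_on (driven f u) ?x a t"
    using \<theta>
    by (intro caratheodory_on_cong[OF caratheodory_on_subinterval[OF \<Phi>(2)[of \<theta> "p \<theta>" t]]]) auto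
  then show "((\<lambda>\<tau>. f (?x \<tau>) (u \<tau>)) has_integral (?x t - ?x a)) {a..t}"
    using a by (simp add: caratheodory_on_def)
next
  fix \<tau> assume \<tau>: "\<tau> \<in> T"
  then have "t0 < \<tau>" by (rule impulse_times_greater[OF T])
  define a where "a = prev_impulse t0 T \<tau>"
  have a: "t0 \<le> a" "a < \<tau>" "a = t0 \<or> a \<in> T" "T \<inter> {a<..<\<tau>} = {}"
    unfolding a_def by (rule prev_impulse[OF T \<open>t0 < \<tau>\<close>])+
  have "last_impulse t0 T s = a" if "a < s" "s < \<tau>" for s
    using a(4) that by (intro last_impulse_eqI[OF T a(3)]) auto
  then have "\<forall>\<^sub>F s in at_left \<tau>. \<Phi> a (p a) s = ?x s"
    unfolding eventually_at_left_field using a(2) by (intro exI[of _ a]) auto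
  then have "(?x \<longlongrightarrow> \<Phi> a (p a) \<tau>) (at_left \<tau>)"
    using continuous_on_Icc_at_leftD[OF caratheodory_on_continuous[OF \<Phi>(2)[OF a(1)]] a(2)]
    by (rule Lim_transform_eventually[rotated])
  moreover have "last_impulse t0 T \<tau> = \<tau>" using \<tau> by (intro last_impulse_eqI[OF T]) auto
  then have "?x \<tau> = g (\<Phi> a (p a) \<tau>) (ul \<tau>)"
    using \<Phi>(1)[of \<tau> "p \<tau>"] p[OF \<tau>] \<open>t0 < \<tau>\<close> by (simp add: a_def)
  ultimately show "\<exists>xl ul. (?x \<longlongrightarrow> xl) (at_left \<tau>) \<and> (u \<longlongrightarrow> ul) (at_left \<tau>) \<and> ?x \<tau> = g xl ul"
    using ul[OF \<tau>] by blast
qed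

lemma (in flow_lyapunov) solution_exists:
  assumes u: "admissible_input t0 u" and T: "impulse_times t0 T"
  obtains x where "is_solution f g t0 T u x" "x t0 = x0"
proof -
  have "\<exists>x. x a = p \<and> (\<forall>b. caratheodory_on (driven f u) x a b)" if "t0 \<le> a" for a p
    using driven_flow_exists[OF u that] by metis
  then obtain \<Phi> where \<Phi>: "\<And>a p. t0 \<le> a \<Longrightarrow> \<Phi> a p a = p"
    "\<And>a p b. t0 \<le> a \<Longrightarrow> caratheodory_on (driven f u) (\<Phi> a p) a b"
    by metis
  have "\<exists>l. (u \<longlongrightarrow> l) (at_left \<tau>)" if "\<tau> \<in> T" for \<tau>
    using u impulse_times_greater[OF T that] by (auto simp: admissible_input_def)
  then obtain ul where ul: "\<And>\<tau>. \<tau> \<in> T \<Longrightarrow> (u \<longlongrightarrow> ul \<tau>) (at_left \<tau>)" by metis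
  obtain p where "p t0 = x0" and p: "\<And>\<tau>. \<tau> \<in> T \<Longrightarrow>
      p \<tau> = g (\<Phi> (prev_impulse t0 T \<tau>) (p (prev_impulse t0 T \<tau>)) \<tau>) (ul \<tau>)"
    using impulse_recursion[OF T, of x0 "\<lambda>\<tau> q. g (\<Phi> (prev_impulse t0 T \<tau>) q \<tau>) (ul \<tau>)"] by blast
  have "last_impulse t0 T t0 = t0" by (intro last_impulse_eqI[OF T]) auto
  then show ?thesis
    using that[OF concatenated_flows_solution[where \<Phi> = \<Phi> and p = p and ul = ul, OF T \<Phi> ul p]]
      \<Phi>(1)[of t0 x0] \<open>p t0 = x0\<close> by simp
qed

section \<open>Uniform input-to-state stability\<close>

context impulsive_lyapunov
begin

lemma solution_norm_bound:
  assumes \<alpha>: "\<And>x. W x \<le> \<alpha> (norm x)" and \<sigma>: "Kinf \<sigma>" "\<And>x. norm x \<le> \<sigma> (W x)"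
    and T: "T \<in> seq_class t0 c d \<mu> lam" "lam > 0"
    and u: "admissible_input t0 u" and x: "is_solution f g t0 T u x" and "t0 \<le> t"
  shows "norm (x t) \<le> max (\<sigma> (exp (\<mu> - lam * (t - t0)) * \<alpha> (norm (x t0))))
    (\<sigma> (exp \<mu> * \<gamma> (Sup ((\<lambda>\<tau>. norm (u \<tau>)) ` {t0..t}))))"
proof -
  define U where "U = Sup ((\<lambda>\<tau>. norm (u \<tau>)) ` {t0..t})"
  obtain U' where "\<And>s. s \<in> {t0..t} \<Longrightarrow> norm (u s) \<le> U'"
    using admissible_input_norm_le[OF u] by blast
  then have U: "norm (u s) \<le> U" if "s \<in> {t0..t}" for s
    unfolding U_def using that by (intro cSup_upper bdd_aboveI2) auto
  have "norm (x t) \<le> \<sigma> (W (x t))" by (rule \<sigma>(2))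
  also have "W (x t) \<le> max (exp (\<mu> - lam * (t - t0)) * W (x t0)) (exp \<mu> * \<gamma> U)"
    by (rule solution_bound[OF T u x \<open>t0 \<le> t\<close> U])
  then have "\<sigma> (W (x t)) \<le> \<sigma> (max (exp (\<mu> - lam * (t - t0)) * \<alpha> (norm (x t0))) (exp \<mu> * \<gamma> U))"
    using \<alpha>[of "x t0"]
    by (intro Kinf_mono[OF \<sigma>(1)] W_nonneg) (auto intro: max.mono mult_left_mono elim!: order_trans)
  finally show ?thesis by (auto simp: U_def max_def split: if_splits)
qed

theorem uniform_ISS:
  assumes "lam > 0"
  shows "unif_ISS f g t0 (seq_class t0 c d \<mu> lam)"
proof -
  obtain \<alpha> where \<alpha>: "Kinf \<alpha>" "\<And>x. W x \<le> \<alpha> (norm x)"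
    using Kinf_upper_bound[OF W_cont W_0] by blast
  obtain \<sigma> where \<sigma>: "Kinf \<sigma>" "\<And>x. norm x \<le> \<sigma> (W x)"
    using Kinf_lower_bound[OF W_cont W_0 W_pos W_unbounded] by blast
  show ?thesis
    unfolding unif_ISS_def
  proof (intro exI[of _ "\<lambda>r t. \<sigma> (exp (\<mu> - lam * t) * \<alpha> r)"] exI[of _ "\<lambda>r. \<sigma> (exp \<mu> * \<gamma> r)"]
      conjI ballI allI impI)
    show "KL (\<lambda>r t. \<sigma> (exp (\<mu> - lam * t) * \<alpha> r))" by (rule KL_exp_decay[OF \<sigma>(1) \<alpha>(1) \<open>lam > 0\<close>])
    show "Kinf (\<lambda>r. \<sigma> (exp \<mu> * \<gamma> r))" by (intro Kinf_compose[OF \<sigma>(1)] Kinf_cmult gain) simp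
    fix T and x0 :: 'x and u :: "real \<Rightarrow> 'u"
    assume T: "T \<in> seq_class t0 c d \<mu> lam" and u: "admissible_input t0 u"
    then have "impulse_times t0 T" by (simp add: seq_class_def)
    then show "\<exists>x. is_solution f g t0 T u x \<and> x t0 = x0"
      using solution_exists[OF u] by metis
    fix x t assume "is_solution f g t0 T u x" "x t0 = x0" "t0 \<le> t"
    then show "norm (x t) \<le> max (\<sigma> (exp (\<mu> - lam * (t - t0)) * \<alpha> (norm x0)))
        (\<sigma> (exp \<mu> * \<gamma> (Sup ((\<lambda>\<tau>. norm (u \<tau>)) ` {t0..t}))))"
      using solution_norm_bound[OF \<alpha>(2) \<sigma> T \<open>lam > 0\<close> u] by blast
  qed
qed

end

section \<open>The max-type Lyapunov function of the interconnection\<close>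

lemma bproj_inner_Basis:
  assumes "B \<subseteq> Basis" "b \<in> Basis"
  shows "bproj B x \<bullet> b = (if b \<in> B then x \<bullet> b else 0)"
proof -
  have "finite B" using assms(1) finite_Basis finite_subset by blast
  have "bproj B x \<bullet> b = (\<Sum>b'\<in>B. if b' = b then x \<bullet> b else 0)"
    unfolding bproj_def inner_sum_left using assms
    by (intro sum.cong) (auto simp: inner_Basis subset_iff)
  then show ?thesis using \<open>finite B\<close> by simp
qed

lemma norm_bproj_le:
  assumes "B \<subseteq> Basis"
  shows "norm (bproj B x) \<le> norm x"
  by (rule norm_le_componentwise) (simp add: bproj_inner_Basis[OF assms])

lemma bounded_linear_bproj: "bounded_linear (bproj B)"
  unfolding linear_conv_bounded_linear[symmetric]
  by (rule linearI)
    (simp_all add: bproj_def inner_add_left scaleR_add_left sum.distrib scaleR_sum_right)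

lemma lipschitz_on_bproj:
  assumes "B \<subseteq> Basis"
  shows "1-lipschitz_on S (bproj B)"
proof (rule lipschitz_onI)
  fix x y
  show "dist (bproj B x) (bproj B y) \<le> 1 * dist x y"
    using norm_bproj_le[OF assms, of "x - y"]
    by (simp add: dist_norm linear_diff[OF bounded_linear.linear[OF bounded_linear_bproj]])
qed simp

lemma bproj_in_span: "bproj B x \<in> span B"
  unfolding bproj_def by (intro span_sum span_scale span_base)

lemma sum_bproj:
  fixes B :: "nat \<Rightarrow> 'a::euclidean_space set"
  assumes "basis_partition n B"
  shows "(\<Sum>i<n. bproj (B i) x) = x"
proof -
  have un: "(\<Union>i<n. B i) = Basis" and dj: "\<forall>i<n. \<forall>j<n. i \<noteq> j \<longrightarrow> B i \<inter> B j = {}"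
    using assms by (auto simp: basis_partition_def)
  have "finite (B i)" if "i < n" for i
    using un that by (intro finite_subset[OF _ finite_Basis]) auto
  then have "(\<Sum>i<n. bproj (B i) x) = (\<Sum>b\<in>(\<Union>i<n. B i). (x \<bullet> b) *\<^sub>R b)"
    unfolding bproj_def using dj by (subst sum.UNION_disjoint) auto
  then show ?thesis by (simp add: un euclidean_representation)
qed

lemma basis_partition_subset: "basis_partition n B \<Longrightarrow> i < n \<Longrightarrow> B i \<subseteq> Basis"
  by (auto simp: basis_partition_def)

lemma exists_bproj_nonzero:
  assumes "basis_partition n B" "x \<noteq> 0"
  obtains i where "i < n" "bproj (B i) x \<noteq> 0"
proof -
  have "(\<Sum>i<n. bproj (B i) x) = 0" if "\<forall>i<n. bproj (B i) x = 0"
    using that by (intro sum.neutral) auto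
  then show ?thesis using sum_bproj[OF assms(1), of x] assms(2) that by metis
qed

lemma others_le_iff:
  "others n B V G i x \<le> k \<longleftrightarrow> 0 \<le> k \<and> (\<forall>j<n. j \<noteq> i \<longrightarrow> G i j * V j (bproj (B j) x) \<le> k)"
  unfolding others_def by (subst Max_le_iff) auto

lemma gain_entry_le_Gam: "j < n \<Longrightarrow> G i j * v j \<le> Gam n G v i"
  unfolding Gam_def by (intro Max_ge) auto

lemma cmin_le: "i < n \<Longrightarrow> cmin n c \<le> c i"
  unfolding cmin_def by (intro Min_le) auto

lemma finite_dmin_set:
  fixes n :: nat
  shows "finite (d ` {..<n} \<union> {- ln (s j / s i * G i j) | i j. i < n \<and> j < n \<and> j \<noteq> i \<and> G i j > 0})"
proof -
  have sub: "{- ln (s j / s i * G i j) | i j. i < n \<and> j < n \<and> j \<noteq> i \<and> G i j > 0}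
      \<subseteq> (\<lambda>(i, j). - ln (s j / s i * G i j)) ` ({..<n} \<times> {..<n})" by auto
  show ?thesis
    by (intro finite_UnI finite_imageI finite_lessThan finite_subset[OF sub] finite_cartesian_product)
qed

lemma dmin_le: "i < n \<Longrightarrow> dmin n G s d \<le> d i"
  unfolding dmin_def by (intro Min_le finite_dmin_set) auto

lemma gain_entry_le_exp_dmin:
  assumes "i < n" "j < n" "j \<noteq> i" "0 \<le> G i j" "0 < s i" "0 < s j"
  shows "G i j * s j \<le> exp (- dmin n G s d) * s i"
proof (cases "G i j > 0")
  case True
  have "dmin n G s d \<le> - ln (s j / s i * G i j)"
    unfolding dmin_def using assms True by (intro Min_le finite_dmin_set) auto
  then have "ln (s j / s i * G i j) \<le> - dmin n G s d" by simp
  moreover have "s j / s i * G i j > 0" using True assms by simp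
  ultimately have "s j / s i * G i j \<le> exp (- dmin n G s d)" by (metis exp_ln exp_le_cancel_iff)
  then show ?thesis using \<open>0 < s i\<close> by (simp add: field_simps)
next
  case False
  then show ?thesis using assms by simp
qed

locale interconnection =
  fixes n :: nat
    and B :: "nat \<Rightarrow> 'x::euclidean_space set" and C :: "nat \<Rightarrow> 'u::euclidean_space set"
    and f g :: "'x \<Rightarrow> 'u \<Rightarrow> 'x"
    and V :: "nat \<Rightarrow> 'x \<Rightarrow> real" and G :: "nat \<Rightarrow> nat \<Rightarrow> real"
    and gam :: "nat \<Rightarrow> real \<Rightarrow> real" and c d s :: "nat \<Rightarrow> real"
  assumes B_part: "basis_partition n B" and C_part: "basis_partition n C"
    and f_lip: "loc_lipschitz_on UNIV (\<lambda>p. f (fst p) (snd p))"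
    and G_nonneg: "\<And>i j. i < n \<Longrightarrow> j < n \<Longrightarrow> G i j \<ge> 0"
    and lyap: "\<And>i. i < n \<Longrightarrow> sub_exp_iss_lyap n B C f g V G gam c d i"
    and s_pos: "\<And>i. i < n \<Longrightarrow> s i > 0"
    and s_Gam: "\<And>i. i < n \<Longrightarrow> Gam n G s i < s i"
begin

abbreviation W :: "'x \<Rightarrow> real" where
  "W \<equiv> Vtot n B V s"

definition scaled_V :: "nat \<Rightarrow> 'x \<Rightarrow> real" where
  "scaled_V i x = V i (bproj (B i) x) / s i"

definition max_gain :: "real \<Rightarrow> real" where
  "max_gain r = Max ((\<lambda>i. gam i r / s i) ` {..<n})"

lemma index_set_nonempty: "{..<n} \<noteq> {}"
proof
  assume "{..<n} = {}"
  then have "(Basis :: 'x set) = {}" using B_part by (simp add: basis_partition_def)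
  then show False using nonempty_Basis by metis
qed

lemma V_candidate: "i < n \<Longrightarrow> sub_lyap_candidate (B i) (V i)"
  using lyap[of i] by (auto simp: sub_exp_iss_lyap_def)

lemma Kinf_gam: "i < n \<Longrightarrow> Kinf (gam i)"
  using lyap[of i] by (auto simp: sub_exp_iss_lyap_def)

lemma V_eq: "i < n \<Longrightarrow> V i (bproj (B i) x) = s i * scaled_V i x"
  using s_pos[of i] by (simp add: scaled_V_def)

lemma scaled_V_pos: "i < n \<Longrightarrow> bproj (B i) x \<noteq> 0 \<Longrightarrow> scaled_V i x > 0"
  using V_candidate[of i] s_pos[of i] bproj_in_span[of "B i" x]
  by (auto simp: sub_lyap_candidate_def scaled_V_def)

lemma scaled_V_eq_0: "i < n \<Longrightarrow> bproj (B i) x = 0 \<Longrightarrow> scaled_V i x = 0"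
  using V_candidate[of i] by (simp add: sub_lyap_candidate_def scaled_V_def)

lemma scaled_V_nonneg: "i < n \<Longrightarrow> scaled_V i x \<ge> 0"
  using scaled_V_pos[of i x] scaled_V_eq_0[of i x] by linarith

lemma W_eq_Max: "W = (\<lambda>x. Max ((\<lambda>i. scaled_V i x) ` {..<n}))"
  by (simp add: fun_eq_iff Vtot_def scaled_V_def)

lemma scaled_V_le_W: "i < n \<Longrightarrow> scaled_V i x \<le> W x"
  unfolding W_eq_Max by (intro Max_ge) auto

lemma W_attained: obtains i where "i < n" "W x = scaled_V i x"
  unfolding W_eq_Max using obtains_MAX[OF finite_lessThan index_set_nonempty] by (metis lessThan_iff)

lemma W_nonneg: "W x \<ge> 0"
  using W_attained[of x] scaled_V_nonneg by metis

lemma W_pos: "x \<noteq> 0 \<Longrightarrow> W x > 0"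
  using exists_bproj_nonzero[OF B_part] scaled_V_pos scaled_V_le_W by (metis less_le_trans)

lemma W_zero: "W 0 = 0"
proof -
  obtain i where "i < n" "W 0 = scaled_V i 0" by (rule W_attained)
  then show ?thesis by (simp add: scaled_V_eq_0 bproj_def)
qed

lemma isCont_scaled_V:
  assumes "i < n"
  shows "isCont (scaled_V i) x"
proof -
  have "continuous_on (span (B i)) (V i)"
    using V_candidate[OF assms] by (simp add: sub_lyap_candidate_def)
  then have "continuous_on UNIV (\<lambda>x. V i (bproj (B i) x))"
    by (rule continuous_on_compose2)
       (auto intro: bproj_in_span linear_continuous_on bounded_linear_bproj)
  then have "continuous_on UNIV (scaled_V i)"
    unfolding scaled_V_def using s_pos[OF assms] by (intro continuous_intros) auto
  then show ?thesis by (simp add: continuous_on_eq_continuous_at)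
qed

lemma lipschitz_near_scaled_V:
  assumes i: "i < n" and z: "bproj (B i) z \<noteq> 0"
  shows "\<exists>U L. open U \<and> z \<in> U \<and> L-lipschitz_on U (scaled_V i)"
proof -
  let ?P = "bproj (B i)"
  have "loc_lipschitz_on (span (B i) - {0}) (V i)"
    using V_candidate[OF i] by (simp add: sub_lyap_candidate_def)
  then obtain U L where U: "open U" "?P z \<in> U" and L: "L-lipschitz_on (U \<inter> (span (B i) - {0})) (V i)"
    using z bproj_in_span unfolding loc_lipschitz_on_iff_open by blast
  define U' where "U' = ?P -` (U - {0})"
  have "L-lipschitz_on (?P ` U') (V i)"
    by (rule lipschitz_on_subset[OF L]) (auto simp: U'_def bproj_in_span)
  then have "(L * 1)-lipschitz_on U' (\<lambda>x. V i (?P x))"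
    by (intro lipschitz_on_compose2 lipschitz_on_bproj basis_partition_subset[OF B_part i])
  then have "(\<bar>1 / s i\<bar> * (L * 1))-lipschitz_on U' (\<lambda>x. 1 / s i * V i (?P x))"
    by (rule lipschitz_on_cmult_real)
  then have "(\<bar>1 / s i\<bar> * (L * 1))-lipschitz_on U' (scaled_V i)"
    by (simp add: scaled_V_def[abs_def])
  moreover have "open U'" "z \<in> U'"
    using U z unfolding U'_def
    by (auto intro!: open_vimage open_delete linear_continuous_on bounded_linear_bproj)
  ultimately show ?thesis by blast
qed

lemma W_locally_lipschitz: "loc_lipschitz_on (UNIV - {0}) W"
  unfolding loc_lipschitz_on_iff_open
proof
  fix z :: 'x assume "z \<in> UNIV - {0}"
  then have "W z > 0" by (intro W_pos) simp
  have "\<exists>U L. open U \<and> z \<in> U \<and> L-lipschitz_on U W"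
    unfolding W_eq_Max
  proof (rule lipschitz_near_Max_image[OF finite_lessThan index_set_nonempty])
    fix i assume "i \<in> {..<n}"
    then have i: "i < n" by simp
    show "isCont (scaled_V i) z" by (rule isCont_scaled_V[OF i])
    assume "scaled_V i z = Max ((\<lambda>i. scaled_V i z) ` {..<n})"
    then have "scaled_V i z > 0" using \<open>W z > 0\<close> by (simp add: W_eq_Max)
    then show "\<exists>U L. open U \<and> z \<in> U \<and> L-lipschitz_on U (scaled_V i)"
      using scaled_V_eq_0[OF i] by (intro lipschitz_near_scaled_V[OF i]) auto
  qed
  then show "\<exists>U L. open U \<and> z \<in> U \<and> L-lipschitz_on (U \<inter> (UNIV - {0})) W"
    by (meson inf_le1 lipschitz_on_subset)
qed

lemma W_continuous: "continuous_on UNIV W"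
  unfolding W_eq_Max
  by (intro continuous_on_Max_image finite_lessThan index_set_nonempty
      continuous_at_imp_continuous_on ballI isCont_scaled_V) simp

lemma W_radially_unbounded: "filterlim W at_top at_infinity"
  unfolding filterlim_at_top eventually_at_infinity
proof
  fix M :: real
  have "\<exists>r. \<forall>\<xi>\<in>span (B i). V i \<xi> \<in> {0..M * s i} \<longrightarrow> norm \<xi> \<le> r" if "i < n" for i
  proof -
    have "compact {\<xi>\<in>span (B i). V i \<xi> \<in> {0..M * s i}}"
      using V_candidate[OF that] compact_Icc unfolding sub_lyap_candidate_def by blast
    then have "bounded {\<xi>\<in>span (B i). V i \<xi> \<in> {0..M * s i}}" by (rule compact_imp_bounded)
    then show ?thesis unfolding bounded_iff by auto
  qed
  then obtain r where r: "\<And>i \<xi>. i < n \<Longrightarrow> \<xi> \<in> span (B i) \<Longrightarrow> V i \<xi> \<in> {0..M * s i} \<Longrightarrow> norm \<xi> \<le> r i"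
    by metis
  have bounded: "norm x \<le> sum r {..<n}" if "W x \<le> M" for x
  proof -
    have "norm (bproj (B i) x) \<le> r i" if i: "i < n" for i
    proof (rule r[OF i bproj_in_span])
      have "scaled_V i x \<le> M" using scaled_V_le_W[OF i, of x] \<open>W x \<le> M\<close> by linarith
      then show "V i (bproj (B i) x) \<in> {0..M * s i}"
        using s_pos[OF i] scaled_V_nonneg[OF i] by (simp add: V_eq[OF i] mult.commute)
    qed
    then have "(\<Sum>i<n. norm (bproj (B i) x)) \<le> sum r {..<n}" by (intro sum_mono) auto
    moreover have "norm x \<le> (\<Sum>i<n. norm (bproj (B i) x))"
      using norm_sum[of "\<lambda>i. bproj (B i) x" "{..<n}"] by (simp add: sum_bproj[OF B_part])
    ultimately show ?thesis by linarith
  qed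
  show "\<exists>b. \<forall>x. b \<le> norm x \<longrightarrow> M \<le> W x"
  proof (intro exI[of _ "sum r {..<n} + 1"] allI impI)
    fix x :: 'x assume "sum r {..<n} + 1 \<le> norm x"
    then show "M \<le> W x" using bounded[of x] by linarith
  qed
qed

lemma Kinf_max_gain: "Kinf max_gain"
proof -
  have "Kinf (\<lambda>r. gam i r / s i)" if "i < n" for i
    using Kinf_cmult[OF Kinf_gam[OF that], of "1 / s i"] s_pos[OF that] by simp
  then show ?thesis
    unfolding max_gain_def[abs_def] by (intro Kinf_Max_image finite_lessThan index_set_nonempty) simp
qed

lemma gam_le_max_gain:
  assumes "i < n"
  shows "gam i (norm (bproj (C i) u)) \<le> s i * max_gain (norm u)"
proof -
  have "gam i (norm (bproj (C i) u)) \<le> gam i (norm u)"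
    using assms by (intro Kinf_mono[OF Kinf_gam] norm_bproj_le basis_partition_subset[OF C_part]) auto
  moreover have "gam i (norm u) / s i \<le> max_gain (norm u)"
    unfolding max_gain_def using assms by (intro Max_ge) auto
  ultimately show ?thesis using s_pos[OF assms] by (simp add: field_simps)
qed

lemma others_le:
  assumes "i < n" "0 \<le> k" "\<And>j. j < n \<Longrightarrow> j \<noteq> i \<Longrightarrow> G i j * s j \<le> k * s i"
  shows "others n B V G i x \<le> s i * (k * W x)"
  unfolding others_le_iff
proof (intro conjI allI impI)
  show "0 \<le> s i * (k * W x)" using s_pos[OF assms(1)] assms(2) W_nonneg by simp
  fix j assume j: "j < n" "j \<noteq> i"
  have "G i j * V j (bproj (B j) x) = G i j * s j * scaled_V j x" by (simp add: V_eq[OF j(1)])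
  also have "\<dots> \<le> k * s i * W x"
    using s_pos[OF assms(1)] assms(2)
    by (intro mult_mono[OF assms(3)[OF j] scaled_V_le_W[OF j(1)]] scaled_V_nonneg[OF j(1)]) auto
  finally show "G i j * V j (bproj (B j) x) \<le> s i * (k * W x)" by (simp add: ac_simps)
qed

lemma W_jump_bound: "W (g x u) \<le> max (exp (- dmin n G s d) * W x) (max_gain (norm u))"
proof -
  let ?e = "exp (- dmin n G s d)"
  let ?K = "max (?e * W x) (max_gain (norm u))"
  obtain i where i: "i < n" "W (g x u) = scaled_V i (g x u)" by (rule W_attained)
  have si: "s i > 0" using s_pos i by simp
  have "exp (- d i) * scaled_V i x \<le> ?e * W x"
    using dmin_le scaled_V_le_W scaled_V_nonneg i(1) by (intro mult_mono) auto
  then have "exp (- d i) * V i (bproj (B i) x) \<le> s i * (?e * W x)"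
    using si by (simp add: V_eq[OF i(1)] mult.left_commute)
  moreover have "others n B V G i x \<le> s i * (?e * W x)"
    using i(1) G_nonneg s_pos by (intro others_le gain_entry_le_exp_dmin) auto
  moreover have "gam i (norm (bproj (C i) u)) \<le> s i * max_gain (norm u)"
    by (rule gam_le_max_gain[OF i(1)])
  moreover have "s i * (?e * W x) \<le> s i * ?K" "s i * max_gain (norm u) \<le> s i * ?K"
    using si by (auto intro: mult_left_mono)
  moreover have "V i (bproj (B i) (g x u)) \<le>
      max (exp (- d i) * V i (bproj (B i) x))
        (max (others n B V G i x) (gam i (norm (bproj (C i) u))))"
    using lyap[OF i(1)] by (simp add: sub_exp_iss_lyap_def)
  ultimately have "V i (bproj (B i) (g x u)) \<le> s i * ?K" by linarith
  then show ?thesis using si i by (simp add: V_eq[OF i(1)])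
qed

lemma scaled_V_has_derivative:
  assumes "(V i has_derivative D) (at (bproj (B i) x) within span (B i))"
  shows "(scaled_V i has_derivative (\<lambda>h. D (bproj (B i) h) / s i)) (at x)"
proof -
  have "(bproj (B i) has_derivative bproj (B i)) (at x)"
    by (rule bounded_linear_imp_has_derivative[OF bounded_linear_bproj])
  moreover have "(V i has_derivative D) (at (bproj (B i) x) within range (bproj (B i)))"
    by (rule has_derivative_subset[OF assms]) (auto intro: bproj_in_span)
  ultimately have "((\<lambda>x. V i (bproj (B i) x)) has_derivative (\<lambda>h. D (bproj (B i) h))) (at x)"
    by (rule has_derivative_in_compose)
  from has_derivative_mult_right[OF this, of "inverse (s i)"] show ?thesis
    by (simp add: scaled_V_def[abs_def] divide_inverse mult.commute)
qed

definition decaying_derivative :: "nat \<Rightarrow> 'x \<Rightarrow> ('x \<Rightarrow> real) \<Rightarrow> bool" where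
  "decaying_derivative i x D \<longleftrightarrow> (V i has_derivative D) (at (bproj (B i) x) within span (B i)) \<and>
    (\<forall>u. V i (bproj (B i) x) \<ge> max (others n B V G i x) (gam i (norm (bproj (C i) u))) \<longrightarrow>
      D (bproj (B i) (f x u)) \<le> - c i * V i (bproj (B i) x))"

lemma decaying_derivative_ae:
  obtains Z where "negligible Z" "\<And>x i. x \<notin> Z \<Longrightarrow> i < n \<Longrightarrow> \<exists>D. decaying_derivative i x D"
proof -
  have "\<exists>Z. negligible Z \<and> (\<forall>x. x \<notin> Z \<longrightarrow> (\<exists>D. decaying_derivative i x D))" if "i < n" for i
    using lyap[OF that]
    by (auto simp: sub_exp_iss_lyap_def decaying_derivative_def negligible_iff_null_sets)
  then obtain Z where Z: "\<And>i. i < n \<Longrightarrow> negligible (Z i)"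
      "\<And>i x. i < n \<Longrightarrow> x \<notin> Z i \<Longrightarrow> \<exists>D. decaying_derivative i x D"
    by metis
  have "negligible (\<Union>i<n. Z i)" using Z(1) by (intro negligible_Union) auto
  then show ?thesis by (rule that) (use Z(2) in auto)
qed

lemma active_subsystem_decay:
  assumes i: "i < n" "W x = scaled_V i x" and D: "decaying_derivative i x D"
    and u: "max_gain (norm u) \<le> W x"
  shows "D (bproj (B i) (f x u)) / s i \<le> - cmin n c * W x"
proof -
  have si: "s i > 0" using s_pos i by simp
  have "G i j * s j \<le> 1 * s i" if "j < n" for j
    using gain_entry_le_Gam[OF that, of G i s] s_Gam[OF i(1)] by simp
  then have "others n B V G i x \<le> V i (bproj (B i) x)"
    using others_le[OF i(1), of 1 x] by (simp add: V_eq[OF i(1)] i(2))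
  moreover have "s i * max_gain (norm u) \<le> s i * W x"
    using u si by simp
  then have "gam i (norm (bproj (C i) u)) \<le> V i (bproj (B i) x)"
    using gam_le_max_gain[OF i(1), of u] by (simp add: V_eq[OF i(1)] i(2))
  ultimately have "D (bproj (B i) (f x u)) \<le> - c i * (s i * W x)"
    using D by (simp add: decaying_derivative_def V_eq[OF i(1)] i(2))
  then have "D (bproj (B i) (f x u)) / s i \<le> - c i * W x"
    using si by (simp add: pos_divide_le_eq ac_simps)
  also have "\<dots> \<le> - cmin n c * W x"
    using cmin_le[OF i(1)] W_nonneg by (intro mult_right_mono) auto
  finally show ?thesis .
qed

lemma W_dissipative: "ae_dissipative f W max_gain (cmin n c)"
proof -
  obtain Z where Z: "negligible Z" "\<And>x i. x \<notin> Z \<Longrightarrow> i < n \<Longrightarrow> \<exists>D. decaying_derivative i x D"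
    by (rule decaying_derivative_ae) blast
  obtain N where N: "negligible N" "\<And>x D i. \<lbrakk>x \<notin> N;
      \<And>j. j < n \<Longrightarrow> (scaled_V j has_derivative D j) (at x); i < n; W x = scaled_V i x\<rbrakk>
      \<Longrightarrow> (W has_derivative D i) (at x)"
    unfolding W_eq_Max
    using has_derivative_Max_image_ae[OF finite_lessThan index_set_nonempty, of scaled_V]
    by (metis lessThan_iff)
  have "\<exists>D. (W has_derivative D) (at x) \<and>
      (\<forall>u. W x \<ge> max_gain (norm u) \<longrightarrow> D (f x u) \<le> - cmin n c * W x)" if x: "x \<notin> Z \<union> N" for x
  proof -
    obtain D where D: "\<And>i. i < n \<Longrightarrow> decaying_derivative i x (D i)"
      using Z(2)[of x] x by (metis UnCI)
    obtain i where i: "i < n" "W x = scaled_V i x" by (rule W_attained)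
    have "(W has_derivative (\<lambda>h. D i (bproj (B i) h) / s i)) (at x)"
      by (rule N(2)[where D = "\<lambda>i h. D i (bproj (B i) h) / s i", OF _ scaled_V_has_derivative i])
         (use x D in \<open>auto simp: decaying_derivative_def\<close>)
    then show ?thesis using active_subsystem_decay[OF i D[OF i(1)]] by blast
  qed
  moreover have "negligible (Z \<union> N)" using Z(1) N(1) by (rule negligible_Un)
  ultimately show ?thesis
    unfolding ae_dissipative_def by (intro bexI[of _ "Z \<union> N"]) (auto simp: negligible_iff_null_sets)
qed

sublocale total: impulsive_lyapunov f g W max_gain "cmin n c" "dmin n G s d"
  by unfold_locales
    (fact f_lip W_continuous W_locally_lipschitz W_zero W_pos W_radially_unbounded Kinf_max_gain
      W_dissipative W_jump_bound)+

lemma W_exp_iss_lyap: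
  "exp_iss_lyap f g W (cmin n c) (dmin n G s d) (gain n gam s (dmin n G s d))"
proof -
  let ?d = "dmin n G s d"
  let ?\<gamma> = "gain n gam s ?d"
  have gain_eq: "?\<gamma> = (\<lambda>r. max (exp ?d) 1 * max_gain r)"
    by (simp add: fun_eq_iff gain_def max_gain_def)
  have gain_ge: "max_gain (norm u) \<le> ?\<gamma> (norm u)" "exp ?d * max_gain (norm u) \<le> ?\<gamma> (norm u)"
    for u :: 'u
    using Kinf_nonneg[OF Kinf_max_gain norm_ge_zero[of u]]
      mult_right_mono[of 1 "max (exp ?d) 1" "max_gain (norm u)"]
      mult_right_mono[of "exp ?d" "max (exp ?d) 1" "max_gain (norm u)"]
    by (simp_all add: gain_eq)
  have "Kinf ?\<gamma>" unfolding gain_eq by (intro Kinf_cmult Kinf_max_gain) simp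
  moreover have "W (g x u) \<le> exp (- ?d) * W x" if "?\<gamma> (norm u) \<le> W x" for x u
  proof -
    have "exp ?d * max_gain (norm u) \<le> W x" using gain_ge(2) that by (rule order_trans)
    then have "max_gain (norm u) \<le> exp (- ?d) * W x" by (simp add: exp_minus field_simps)
    then show ?thesis using W_jump_bound[of x u] by simp
  qed
  moreover have "ae_dissipative f W ?\<gamma> (cmin n c)"
    using W_dissipative gain_ge(1) unfolding ae_dissipative_def by (meson order_trans)
  ultimately show ?thesis
    unfolding exp_iss_lyap_def ae_dissipative_def
    using W_continuous W_locally_lipschitz W_zero W_pos W_radially_unbounded by blast
qed

end

theorem theorem4:
  fixes n :: nat
    and B :: "nat \<Rightarrow> 'x::euclidean_space set" and C :: "nat \<Rightarrow> 'u::euclidean_space set"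
    and f g :: "'x \<Rightarrow> 'u \<Rightarrow> 'x"
    and V :: "nat \<Rightarrow> 'x \<Rightarrow> real" and G :: "nat \<Rightarrow> nat \<Rightarrow> real"
    and gam :: "nat \<Rightarrow> real \<Rightarrow> real" and c d s :: "nat \<Rightarrow> real" and t0 :: real
  assumes B_part: "basis_partition n B" and B_ne: "\<forall>i<n. B i \<noteq> {}"
    and C_part: "basis_partition n C"
    and f_struct: "\<forall>i<n. \<forall>x u u'. bproj (C i) u = bproj (C i) u' \<longrightarrow>
                      bproj (B i) (f x u) = bproj (B i) (f x u')"
    and g_struct: "\<forall>i<n. \<forall>x u u'. bproj (C i) u = bproj (C i) u' \<longrightarrow>
                      bproj (B i) (g x u) = bproj (B i) (g x u')"
    and f_lip: "loc_lipschitz_on UNIV (\<lambda>p. f (fst p) (snd p))"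
    and G_nonneg: "\<forall>i<n. \<forall>j<n. G i j \<ge> 0" and G_diag: "\<forall>i<n. G i i = 0"
    and lyap: "\<forall>i<n. sub_exp_iss_lyap n B C f g V G gam c d i"
    and d_nz: "\<forall>i<n. d i \<noteq> 0"
    and small_gain: "\<forall>v. (\<forall>i<n. v i \<ge> 0) \<longrightarrow> (\<exists>i<n. v i \<noteq> 0) \<longrightarrow> (\<exists>i<n. Gam n G v i < v i)"
    and s_pos: "\<forall>i<n. s i > 0" and s_Gam: "\<forall>i<n. Gam n G s i < s i"
  shows "exp_iss_lyap f g (Vtot n B V s) (cmin n c) (dmin n G s d) (gain n gam s (dmin n G s d)) \<and>
         (\<forall>\<mu> lam. \<mu> > 0 \<longrightarrow> lam > 0 \<longrightarrow>
            unif_ISS f g t0 (seq_class t0 (cmin n c) (dmin n G s d) \<mu> lam))"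
proof -
  interpret interconnection n B C f g V G gam c d s
    using B_part C_part f_lip G_nonneg lyap s_pos s_Gam by unfold_locales auto
  show ?thesis using W_exp_iss_lyap total.uniform_ISS by blast
qed

end
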